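(* Let $(G,H,\mathcal{L})$ be a cut-and-project scheme, let $W\subseteq H$ be compact, let $\omega$ be a ping-pong measure for $\curlywedge(W)$ and let $\varphi\in C_c(G)$ be an auxiliary function for $\omega$. Then: (Ping) If $\gamma$ is any Fourier transformable measure on $G$ with $\operatorname{supp}(\gamma)\subseteq\curlywedge(W)$, then $\nu:=|\check\varphi|^2\,\widehat\gamma$ is a finite measure on $\widehat G$ and $$\widehat\gamma=\widehat\omega*\nu .$$ (Pong) If $\nu$ is a finite measure on $\widehat G$, then the measure $\gamma:=\check\nu\,\omega$ satisfies $\operatorname{supp}(\gamma)\subseteq\operatorname{supp}(\omega)$, $\gamma$ is Fourier transformable, and $$\widehat\gamma=\widehat\omega*\nu .$$
   Context: $G$ is a second countable locally compact Abelian group (LCAG). Measures are (complex) Radon measures; a finite measure is one with finite total variation. A cut-and-project scheme $(G,H,\mathcal{L})$ consists of $G$, an LCAG $H$ and a lattice (discrete co-compact subgroup) $\mathcal{L}\subseteq G\times H$ such that the projection $\pi_G$ is one-to-one on $\mathcal{L}$ and $\pi_H(\mathcal{L})$ is dense in $H$. For $W\subseteq H$, $\curlywedge(W):=\{\pi_G(l): l\in\mathcal{L},\ \pi_H(l)\in W\}$. Notation: $\tilde\varphi(x)=\overline{\varphi(-x)}$, $\check\varphi(\chi)=\int_G\chi(x)\varphi(x)\,dx$, and for a finite measure $\nu$ on $\widehat G$, $\check\nu(x)=\int_{\widehat G}\chi(x)\,d\nu(\chi)$. A measure $\gamma$ on $G$ is Fourier transformable if there is a measure $\widehat\gamma$ on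 $\widehat G$ (its Fourier transform, unique) such that for all $\varphi\in C_c(G)$: $\check\varphi\in L^2(|\widehat\gamma|)$ and $\int_G\varphi*\tilde\varphi\,d\gamma=\int_{\widehat G}|\check\varphi|^2\,d\widehat\gamma$. It is twice Fourier transformable if $\gamma$ and $\widehat\gamma$ are both Fourier transformable. A set $\Lambda\subseteq G$ is $V$-uniformly discrete (for $V \subseteq G$) if $(x+V)\cap(y+V)=\varnothing$ for all distinct $x,y\in\Lambda$; it is uniformly discrete if it is $V$-uniformly discrete for some neighbourhood $V$ of $0$. A measure $\omega$ on $G$ is a ping-pong measure for a uniformly discrete set $\Lambda\subseteq G$ if: $\operatorname{supp}(\omega)$ is uniformly discrete; $\omega(\{x\})=1$ for all $x\in\Lambda$; $\omega$ is twice Fourier transformable; and $\widehat\omega$ is pure point. A function $\varphi\in C_c(G)$ is an auxiliary function for $\omega$ if $\varphi*\tilde\varphi(0)=1$ and $\operatorname{supp}(\omega)$ is $\operatorname{supp}(\varphi*\tilde\varphi)$-uniformly discrete. Fourier transforms of measures are translation bounded, so $\widehat\omega*\nu$ is well defined for finite $\nu$. *)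

theory Defs
  imports "HOL-Analysis.Analysis"
begin

text \<open>
  A locally compact Abelian group is a type of sort
  \<open>{topological_ab_group_add, t2_space}\<close> (Hausdorff is part of the convention) together with the
  hypothesis \<open>locally_compact_space euclidean\<close>; there is no type class for local compactness.
\<close>

section \<open>The dual group\<close>

text \<open>
  Characters take values in the unit circle of \<open>\<complex>\<close>. The dual group is written additively, so
  that it is again a topological Abelian group in the sense of the type classes:
  \<open>(\<xi> + \<psi>)(x) = \<xi>(x) \<psi>(x)\<close>. Its topology is that of uniform convergence on compact sets.
\<close>

typedef (overloaded) ('g::topological_ab_group_add) character =
  "{\<xi>. continuous_on UNIV (\<xi> :: 'g \<Rightarrow> complex) \<and> (\<forall>x. norm (\<xi> x) = 1) \<and>
        (\<forall>x y. \<xi> (x + y) = \<xi> x * \<xi> y)}"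
  morphisms char_apply Abs_character
  by (rule exI[of _ "\<lambda>_. 1"]) auto

setup_lifting type_definition_character

lemma char_apply_continuous: "continuous_on A (char_apply \<xi>)"
  using char_apply[of \<xi>] continuous_on_subset by auto

lemma norm_char_apply [simp]: "norm (char_apply \<xi> x) = 1"
  using char_apply[of \<xi>] by auto

lemma char_apply_add: "char_apply \<xi> (x + y) = char_apply \<xi> x * char_apply \<xi> y"
  using char_apply[of \<xi>] by auto

lemma char_apply_nonzero [simp]: "char_apply \<xi> x \<noteq> 0"
  using norm_char_apply[of \<xi> x] by (metis norm_zero zero_neq_one)

instantiation character :: (topological_ab_group_add) ab_group_add
begin

lift_definition zero_character :: "'a character" is "\<lambda>_. 1" by auto

lift_definition plus_character :: "'a character \<Rightarrow> 'a character \<Rightarrow> 'a character"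
  is "\<lambda>\<xi> \<psi> x. \<xi> x * \<psi> x"
  by (auto intro!: continuous_on_mult continuous_on_inverse simp: norm_mult)

lift_definition uminus_character :: "'a character \<Rightarrow> 'a character"
  is "\<lambda>\<xi> x. inverse (\<xi> x)"
  by (auto intro!: continuous_on_mult continuous_on_inverse simp: norm_inverse) (metis norm_zero zero_neq_one)

definition minus_character :: "'a character \<Rightarrow> 'a character \<Rightarrow> 'a character"
  where "minus_character \<xi> \<psi> = \<xi> + - \<psi>"

instance
proof
  fix a b c :: "'a character"
  show "a + b + c = a + (b + c)" by transfer (simp add: mult.assoc)
  show "a + b = b + a" by transfer (simp add: mult.commute)
  show "0 + a = a" by transfer simp
  show "- a + a = 0"
  proof transfer
    fix \<xi> :: "'a \<Rightarrow> complex"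
    assume "continuous_on UNIV \<xi> \<and> (\<forall>x. norm (\<xi> x) = 1) \<and> (\<forall>x y. \<xi> (x + y) = \<xi> x * \<xi> y)"
    then have "\<xi> x \<noteq> 0" for x by (metis norm_zero zero_neq_one)
    then show "(\<lambda>x. inverse (\<xi> x) * \<xi> x) = (\<lambda>_. 1)" by simp
  qed
  show "a - b = a + - b" by (simp add: minus_character_def)
qed

end

definition char_nbhd ::
  "'g::topological_ab_group_add character \<Rightarrow> 'g set \<Rightarrow> real \<Rightarrow> 'g character set" where
  "char_nbhd \<xi> K e = {\<psi>. \<forall>x\<in>K. dist (char_apply \<psi> x) (char_apply \<xi> x) < e}"

instantiation character :: (topological_ab_group_add) topological_space
begin

definition open_character :: "'a character set \<Rightarrow> bool" where
  "open_character S \<longleftrightarrow> (\<forall>\<xi>\<in>S. \<exists>K e. compact K \<and> e > 0 \<and> char_nbhd \<xi> K e \<subseteq> S)"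

instance
proof
  show "open (UNIV :: 'a character set)"
    unfolding open_character_def
    by (intro ballI, rule exI[of _ "{}"], rule exI[of _ "1::real"]) simp
next
  fix S T :: "'a character set"
  assume "open S" "open T"
  show "open (S \<inter> T)"
    unfolding open_character_def
  proof
    fix \<xi> assume "\<xi> \<in> S \<inter> T"
    then have "\<xi> \<in> S" "\<xi> \<in> T" by simp_all
    obtain K e where K: "compact K" "e > 0" "char_nbhd \<xi> K e \<subseteq> S"
      using bspec[OF \<open>open S\<close>[unfolded open_character_def] \<open>\<xi> \<in> S\<close>] by (elim exE conjE)
    obtain K' e' where K': "compact K'" "e' > 0" "char_nbhd \<xi> K' e' \<subseteq> T"
      using bspec[OF \<open>open T\<close>[unfolded open_character_def] \<open>\<xi> \<in> T\<close>] by (elim exE conjE)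
    have "char_nbhd \<xi> (K \<union> K') (min e e') \<subseteq> S \<inter> T"
    proof
      fix \<psi> assume "\<psi> \<in> char_nbhd \<xi> (K \<union> K') (min e e')"
      then have "\<psi> \<in> char_nbhd \<xi> K e" "\<psi> \<in> char_nbhd \<xi> K' e'" by (auto simp: char_nbhd_def)
      then show "\<psi> \<in> S \<inter> T" using K(3) K'(3) by (simp add: subset_iff)
    qed
    moreover have "compact (K \<union> K')" "min e e' > 0" using K K' by (simp_all add: compact_Un)
    ultimately show "\<exists>K e. compact K \<and> e > 0 \<and> char_nbhd \<xi> K e \<subseteq> S \<inter> T"
      by (intro exI[of _ "K \<union> K'"], intro exI[of _ "min e e'"]) simp
  qed
next
  fix C :: "'a character set set"
  assume C: "\<forall>S\<in>C. open S"
  show "open (\<Union>C)"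
    unfolding open_character_def
  proof
    fix \<xi> assume "\<xi> \<in> \<Union>C"
    then obtain S where S: "S \<in> C" "\<xi> \<in> S" by (elim UnionE)
    obtain K e where "compact K" "e > 0" "char_nbhd \<xi> K e \<subseteq> S"
      using bspec[OF bspec[OF C S(1), unfolded open_character_def] S(2)] by (elim exE conjE)
    then show "\<exists>K e. compact K \<and> e > 0 \<and> char_nbhd \<xi> K e \<subseteq> \<Union>C"
      using S(1) by (intro exI[of _ K], intro exI[of _ e]) (simp add: Union_upper subset_trans)
  qed
qed

end

lemma char_nbhd_open:
  assumes "compact K"
  shows "open (char_nbhd \<xi> K e)"
  unfolding open_character_def
proof
  fix \<psi> assume \<psi>: "\<psi> \<in> char_nbhd \<xi> K e"
  show "\<exists>K' e'. compact K' \<and> e' > 0 \<and> char_nbhd \<psi> K' e' \<subseteq> char_nbhd \<xi> K e"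
  proof (cases "K = {}")
    case True
    then show ?thesis
      by (intro exI[of _ "{}"], intro exI[of _ "1::real"]) (simp add: char_nbhd_def)
  next
    case False
    have "continuous_on K (\<lambda>x. dist (char_apply \<psi> x) (char_apply \<xi> x))"
      by (intro continuous_intros char_apply_continuous)
    from continuous_attains_sup[OF assms False this] obtain x0 where x0: "x0 \<in> K"
      and le: "\<And>x. x \<in> K \<Longrightarrow> dist (char_apply \<psi> x) (char_apply \<xi> x) \<le> dist (char_apply \<psi> x0) (char_apply \<xi> x0)"
      by blast
    let ?d = "e - dist (char_apply \<psi> x0) (char_apply \<xi> x0)"
    have "?d > 0" using \<psi> x0 by (auto simp: char_nbhd_def)
    moreover have "char_nbhd \<psi> K ?d \<subseteq> char_nbhd \<xi> K e"
    proof (unfold char_nbhd_def, intro subsetI CollectI ballI, drule CollectD)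
      fix \<eta> x assume h: "\<forall>x\<in>K. dist (char_apply \<eta> x) (char_apply \<psi> x) < ?d" and "x \<in> K"
      have "dist (char_apply \<eta> x) (char_apply \<xi> x)
          \<le> dist (char_apply \<eta> x) (char_apply \<psi> x) + dist (char_apply \<psi> x) (char_apply \<xi> x)"
        by (rule dist_triangle)
      moreover have "dist (char_apply \<eta> x) (char_apply \<psi> x) < ?d"
        using h \<open>x \<in> K\<close> by (rule bspec)
      ultimately show "dist (char_apply \<eta> x) (char_apply \<xi> x) < e"
        using le[OF \<open>x \<in> K\<close>] by linarith
    qed
    ultimately show ?thesis using assms by (intro exI[of _ K] exI[of _ ?d]) simp
  qed
qed

lemma tendsto_character_iff:
  "(f \<longlongrightarrow> \<xi>) F \<longleftrightarrow> (\<forall>K e. compact K \<and> e > 0 \<longrightarrow> (\<forall>\<^sub>F i in F. f i \<in> char_nbhd \<xi> K e))"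
proof
  assume f: "(f \<longlongrightarrow> \<xi>) F"
  show "\<forall>K e. compact K \<and> e > 0 \<longrightarrow> (\<forall>\<^sub>F i in F. f i \<in> char_nbhd \<xi> K e)"
  proof (intro allI impI, elim conjE)
    fix K :: "'b set" and e :: real assume "compact K" "e > 0"
    show "\<forall>\<^sub>F i in F. f i \<in> char_nbhd \<xi> K e"
    proof (rule topological_tendstoD[OF f])
      show "open (char_nbhd \<xi> K e)" using \<open>compact K\<close> by (rule char_nbhd_open)
      show "\<xi> \<in> char_nbhd \<xi> K e" using \<open>e > 0\<close> by (simp add: char_nbhd_def)
    qed
  qed
next
  assume *: "\<forall>K e. compact K \<and> e > 0 \<longrightarrow> (\<forall>\<^sub>F i in F. f i \<in> char_nbhd \<xi> K e)"
  show "(f \<longlongrightarrow> \<xi>) F"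
  proof (rule topological_tendstoI)
    fix S assume "open S" "\<xi> \<in> S"
    from bspec[OF \<open>open S\<close>[unfolded open_character_def] \<open>\<xi> \<in> S\<close>]
    obtain K e where "compact K" "e > 0" "char_nbhd \<xi> K e \<subseteq> S" by (elim exE conjE)
    then have "\<forall>\<^sub>F i in F. f i \<in> char_nbhd \<xi> K e" using * by simp
    then show "\<forall>\<^sub>F i in F. f i \<in> S"
      by (rule eventually_mono) (use \<open>char_nbhd \<xi> K e \<subseteq> S\<close> in auto)
  qed
qed

lemma eventually_nhds_char_nbhd:
  assumes "compact K" "e > 0"
  shows "\<forall>\<^sub>F \<psi> in nhds \<xi>. \<psi> \<in> char_nbhd \<xi> K e"
  using assms by (intro eventually_nhds_in_open char_nbhd_open) (simp_all add: char_nbhd_def)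

instance character :: (topological_ab_group_add) topological_ab_group_add
proof
  fix a b :: "'a character"
  show "LIM x (nhds a \<times>\<^sub>F nhds b). fst x + snd x :> nhds (a + b)"
    unfolding tendsto_character_iff
  proof (intro allI impI, elim conjE)
    fix K :: "'a set" and e :: real assume K: "compact K" and "e > 0"
    have "\<forall>\<^sub>F x in nhds a. x \<in> char_nbhd a K (e/2)" "\<forall>\<^sub>F x in nhds b. x \<in> char_nbhd b K (e/2)"
      using K \<open>e > 0\<close> by (simp_all add: eventually_nhds_char_nbhd)
    then have "\<forall>\<^sub>F x in nhds a \<times>\<^sub>F nhds b. fst x \<in> char_nbhd a K (e/2) \<and> snd x \<in> char_nbhd b K (e/2)"
      by (intro eventually_prodI)
    then show "\<forall>\<^sub>F x in nhds a \<times>\<^sub>F nhds b. fst x + snd x \<in> char_nbhd (a + b) K e"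
    proof (rule eventually_mono)
      fix x :: "'a character \<times> 'a character"
      assume *: "fst x \<in> char_nbhd a K (e/2) \<and> snd x \<in> char_nbhd b K (e/2)"
      show "fst x + snd x \<in> char_nbhd (a + b) K e"
        unfolding char_nbhd_def mem_Collect_eq plus_character.rep_eq
      proof
        fix y assume y: "y \<in> K"
        let ?p = "char_apply (fst x) y" and ?q = "char_apply (snd x) y"
        let ?a = "char_apply a y" and ?b = "char_apply b y"
        have "dist (?p * ?q) (?a * ?b) = norm ((?p - ?a) * ?q + ?a * (?q - ?b))"
          by (simp add: dist_norm algebra_simps)
        also have "\<dots> \<le> norm (?p - ?a) + norm (?q - ?b)"
          using norm_triangle_ineq[of "(?p - ?a) * ?q" "?a * (?q - ?b)"] by (simp add: norm_mult)
        also have "\<dots> < e/2 + e/2"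
          using * y by (intro add_strict_mono) (auto simp: char_nbhd_def dist_norm)
        finally show "dist (?p * ?q) (?a * ?b) < e" by simp
      qed
    qed
  qed
next
  fix a :: "'a character"
  show "(uminus \<longlongrightarrow> - a) (nhds a)"
    unfolding tendsto_character_iff
  proof (intro allI impI, elim conjE)
    fix K :: "'a set" and e :: real assume K: "compact K" and "e > 0"
    have "\<forall>\<^sub>F x in nhds a. x \<in> char_nbhd a K e"
      using K \<open>e > 0\<close> by (simp add: eventually_nhds_char_nbhd)
    then show "\<forall>\<^sub>F x in nhds a. - x \<in> char_nbhd (- a) K e"
    proof (rule eventually_mono)
      fix x assume *: "x \<in> char_nbhd a K e"
      have "dist (inverse (char_apply x y)) (inverse (char_apply a y)) = dist (char_apply x y) (char_apply a y)" for y
      proof -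
        have "inverse (char_apply x y) - inverse (char_apply a y)
            = inverse (char_apply x y) * (char_apply a y - char_apply x y) * inverse (char_apply a y)"
          by (simp add: field_simps)
        then show ?thesis
          by (simp add: dist_norm norm_mult norm_inverse norm_minus_commute)
      qed
      with * show "- x \<in> char_nbhd (- a) K e"
        by (simp add: char_nbhd_def uminus_character.rep_eq)
    qed
  qed
qed

instance character :: (topological_ab_group_add) t2_space
proof
  fix a b :: "'a character"
  assume "a \<noteq> b"
  then obtain x where x: "char_apply a x \<noteq> char_apply b x"
    using char_apply_inject[of a b] by (auto simp: fun_eq_iff)
  let ?d = "dist (char_apply a x) (char_apply b x) / 2"
  show "\<exists>U V. open U \<and> open V \<and> a \<in> U \<and> b \<in> V \<and> U \<inter> V = {}"
  proof (intro exI conjI)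
    show "open (char_nbhd a {x} ?d)" "open (char_nbhd b {x} ?d)"
      by (simp_all add: char_nbhd_open)
    show "a \<in> char_nbhd a {x} ?d" "b \<in> char_nbhd b {x} ?d"
      using x by (simp_all add: char_nbhd_def dist_commute)
    show "char_nbhd a {x} ?d \<inter> char_nbhd b {x} ?d = {}"
    proof (intro equals0I, elim IntE)
      fix c assume "c \<in> char_nbhd a {x} ?d" "c \<in> char_nbhd b {x} ?d"
      then show False
        using dist_triangle3[of "char_apply a x" "char_apply b x" "char_apply c x"]
        by (simp add: char_nbhd_def)
    qed
  qed
qed


section \<open>Complex Radon measures\<close>

text \<open>
  A complex Radon measure need not assign a value to every Borel set (for instance
  \<open>\<Sum>n. (-1)^n \<delta>\<^sub>n\<close> on \<open>\<real>\<close> does not), so it is represented by its values on the relatively compact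
  Borel sets, where it is countably additive. To make equality of measures coincide with equality
  of functions, the value on every other set is fixed to be \<open>0\<close>.
\<close>

type_synonym 'a cmeasure = "'a set \<Rightarrow> complex"

definition rc_borel :: "'a::topological_space set set" where
  "rc_borel = {A \<in> sets borel. compact (closure A)}"

definition total_variation :: "'a::topological_space cmeasure \<Rightarrow> 'a measure" where
  "total_variation \<mu> = measure_of UNIV (sets borel)
     (\<lambda>A. SUP F\<in>{F. finite F \<and> disjoint F \<and> F \<subseteq> rc_borel \<and> \<Union>F \<subseteq> A}. \<Sum>B\<in>F. ennreal (norm (\<mu> B)))"

text \<open>The last conjunct is inner regularity; local finiteness follows from countable additivity.\<close>

definition complex_radon_measure :: "'a::topological_space cmeasure \<Rightarrow> bool" where
  "complex_radon_measure \<mu> \<longleftrightarrow>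
     (\<forall>A. A \<notin> rc_borel \<longrightarrow> \<mu> A = 0) \<and>
     (\<forall>A :: nat \<Rightarrow> 'a set. range A \<subseteq> rc_borel \<and> disjoint_family A \<and> (\<Union>n. A n) \<in> rc_borel
        \<longrightarrow> (\<lambda>n. \<mu> (A n)) sums \<mu> (\<Union>n. A n)) \<and>
     (\<forall>A\<in>rc_borel. \<forall>e>0. \<exists>K. compact K \<and> K \<subseteq> A \<and> emeasure (total_variation \<mu>) (A - K) < ennreal e)"

definition finite_complex_measure :: "'a::topological_space cmeasure \<Rightarrow> bool" where
  "finite_complex_measure \<mu> \<longleftrightarrow> complex_radon_measure \<mu> \<and> emeasure (total_variation \<mu>) UNIV < \<infinity>"

definition msupp :: "'a::topological_space cmeasure \<Rightarrow> 'a set" where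
  "msupp \<mu> = - \<Union>{U. open U \<and> emeasure (total_variation \<mu>) U = 0}"

definition pure_point :: "'a::topological_space cmeasure \<Rightarrow> bool" where
  "pure_point \<mu> \<longleftrightarrow> (\<forall>A\<in>rc_borel. ((\<lambda>x. \<mu> {x}) has_sum \<mu> A) A)"

text \<open>
  Integration is defined by the Jordan decomposition of the real and imaginary parts. The function
  \<open>ennreal\<close> sends negative reals to \<open>0\<close>, which does not matter in the supremum below because
  of \<open>B = {}\<close>. As for the Bochner integral, the value is meaningful for functions that are
  integrable with respect to the total variation.
\<close>

definition positive_part :: "('a::topological_space set \<Rightarrow> real) \<Rightarrow> 'a measure" where
  "positive_part \<sigma> = measure_of UNIV (sets borel) (\<lambda>A. SUP B\<in>{B \<in> rc_borel. B \<subseteq> A}. ennreal (\<sigma> B))"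

definition cintegral :: "'a::topological_space cmeasure \<Rightarrow> ('a \<Rightarrow> complex) \<Rightarrow> complex" where
  "cintegral \<mu> f =
     ((\<integral>x. f x \<partial>positive_part (\<lambda>A. Re (\<mu> A))) - (\<integral>x. f x \<partial>positive_part (\<lambda>A. - Re (\<mu> A)))) +
     \<i> * ((\<integral>x. f x \<partial>positive_part (\<lambda>A. Im (\<mu> A))) - (\<integral>x. f x \<partial>positive_part (\<lambda>A. - Im (\<mu> A))))"

text \<open>The measure \<open>f \<mu>\<close> with density \<open>f\<close>.\<close>

definition cdensity :: "('a::topological_space \<Rightarrow> complex) \<Rightarrow> 'a cmeasure \<Rightarrow> 'a cmeasure" where
  "cdensity f \<mu> A = (if A \<in> rc_borel then cintegral \<mu> (\<lambda>x. indicator A x * f x) else 0)"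

text \<open>
  \<open>(\<mu> * \<nu>)(A) = \<integral>\<integral> 1\<^sub>A(x + y) d\<mu>(x) d\<nu>(y)\<close>, meaningful when \<open>\<mu>\<close> is translation bounded and \<open>\<nu>\<close> is
  finite; every Fourier transform of a measure is translation bounded.
\<close>

definition cconvolution ::
  "'a::topological_ab_group_add cmeasure \<Rightarrow> 'a cmeasure \<Rightarrow> 'a cmeasure" where
  "cconvolution \<mu> \<nu> A =
     (if A \<in> rc_borel then cintegral \<nu> (\<lambda>y. cintegral \<mu> (\<lambda>x. indicator A (x + y))) else 0)"

text \<open>
  The set functions in the definitions of \<open>total_variation\<close> and \<open>positive_part\<close> are measures, so
  that \<open>measure_of\<close> does not fall back to the null measure.
\<close>

lemma rc_borel_subset:
  fixes A :: "'a::topological_space set"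
  assumes "A \<in> rc_borel" "B \<in> sets borel" "B \<subseteq> A"
  shows "B \<in> rc_borel"
proof -
  have "closure A \<inter> closure B = closure B" using closure_mono[OF assms(3)] by blast
  moreover have "compact (closure A \<inter> closure B)"
    using assms(1) by (intro compact_Int_closed) (auto simp: rc_borel_def)
  ultimately show ?thesis using assms(2) by (simp add: rc_borel_def)
qed

lemma rc_borel_empty [simp]: "{} \<in> rc_borel"
  by (simp add: rc_borel_def)

lemma rc_borel_Un: "A \<in> rc_borel \<Longrightarrow> B \<in> rc_borel \<Longrightarrow> A \<union> B \<in> rc_borel"
  by (auto simp: rc_borel_def compact_Un)

lemma rc_borel_sets: "A \<in> rc_borel \<Longrightarrow> A \<in> sets borel"
  by (simp add: rc_borel_def)

lemma emeasure_measure_of_superadditive: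
  fixes g :: "'a::topological_space set \<Rightarrow> ennreal"
  assumes g0: "g {} = 0"
    and super: "\<And>A B. A \<in> sets borel \<Longrightarrow> B \<in> sets borel \<Longrightarrow> A \<inter> B = {} \<Longrightarrow> g A + g B \<le> g (A \<union> B)"
    and sub: "\<And>A :: nat \<Rightarrow> 'a set. range A \<subseteq> sets borel \<Longrightarrow> disjoint_family A \<Longrightarrow>
                g (\<Union>n. A n) \<le> (\<Sum>n. g (A n))"
    and A: "A \<in> sets borel"
  shows "emeasure (measure_of UNIV (sets borel) g) A = g A"
proof (rule emeasure_measure_of_sigma[OF _ _ _ A])
  show "sigma_algebra UNIV (sets (borel :: 'a measure))"
    using sets.sigma_algebra_axioms[of borel] by simp
  show "positive (sets borel) g" using g0 by (simp add: positive_def)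
  show "countably_additive (sets borel) g"
  proof (rule countably_additiveI)
    fix S :: "nat \<Rightarrow> 'a set"
    assume S: "range S \<subseteq> sets borel" "disjoint_family S"
    have mono: "g C \<le> g D" if "C \<in> sets borel" "D \<in> sets borel" "C \<subseteq> D" for C D
    proof -
      have "g C \<le> g C + g (D - C)" by simp
      also have "\<dots> \<le> g (C \<union> (D - C))" using that by (intro super) auto
      finally show ?thesis using that by (simp add: Un_absorb1)
    qed
    have dis: "(\<Union>n<N. S n) \<inter> S N = {}" for N
    proof -
      have "S n \<inter> S N = {}" if "n < N" for n
        using disjoint_family_onD[OF S(2), of n N] that by simp
      then show ?thesis by auto
    qed
    have fin: "(\<Sum>n<N. g (S n)) \<le> g (\<Union>n<N. S n)" for N
    proof (induction N)
      case 0 then show ?case by simp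
    next
      case (Suc N)
      have "(\<Sum>n<Suc N. g (S n)) \<le> g (\<Union>n<N. S n) + g (S N)"
        using Suc by (simp add: add_right_mono)
      also have "\<dots> \<le> g ((\<Union>n<N. S n) \<union> S N)"
        using S(1) dis by (intro super) auto
      finally show ?case by (simp add: lessThan_Suc Un_commute)
    qed
    have "(\<Sum>n. g (S n)) \<le> g (\<Union>n. S n)"
    proof (rule suminf_le_const)
      show "summable (\<lambda>n. g (S n))" by simp
      fix N
      show "(\<Sum>n<N. g (S n)) \<le> g (\<Union>n. S n)"
        using S by (intro order_trans[OF fin] mono) auto
    qed
    then show "(\<Sum>n. g (S n)) = g (\<Union>n. S n)"
      using sub[OF S] by (rule antisym)
  qed
qed

lemma emeasure_positive_part:
  fixes \<sigma> :: "'a::topological_space set \<Rightarrow> real"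
  assumes add: "\<And>A :: nat \<Rightarrow> 'a set. range A \<subseteq> rc_borel \<Longrightarrow> disjoint_family A \<Longrightarrow>
                  (\<Union>n. A n) \<in> rc_borel \<Longrightarrow> (\<lambda>n. \<sigma> (A n)) sums \<sigma> (\<Union>n. A n)"
    and A: "A \<in> sets borel"
  shows "emeasure (positive_part \<sigma>) A = (SUP B\<in>{B \<in> rc_borel. B \<subseteq> A}. ennreal (\<sigma> B))"
  unfolding positive_part_def
proof (rule emeasure_measure_of_superadditive[OF _ _ _ A])
  let ?g = "\<lambda>A. SUP B\<in>{B \<in> rc_borel. B \<subseteq> A}. ennreal (\<sigma> B)"
  have s0: "\<sigma> {} = 0"
  proof -
    have "(\<lambda>n::nat. \<sigma> {}) sums \<sigma> {}" using add[of "\<lambda>_. {}"] by (simp add: disjoint_family_on_def)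
    then show ?thesis using sums_summable summable_const_iff by blast
  qed
  have s2: "\<sigma> (B \<union> C) = \<sigma> B + \<sigma> C" if "B \<in> rc_borel" "C \<in> rc_borel" "B \<inter> C = {}" for B C
  proof -
    have "(\<lambda>n. \<sigma> (binaryset B C n)) sums \<sigma> (\<Union>n. binaryset B C n)"
      using that by (intro add)
        (auto simp: range_binaryset_eq UN_binaryset_eq rc_borel_Un disjoint_family_on_def binaryset_def)
    then show ?thesis
      using binaryset_sums[of \<sigma> B C] s0 by (simp add: UN_binaryset_eq sums_unique2)
  qed
  show "?g {} = 0"
    using s0 by (intro antisym SUP_least) auto
  show "?g A + ?g B \<le> ?g (A \<union> B)" if "A \<in> sets borel" "B \<in> sets borel" "A \<inter> B = {}" for A B
  proof -
    have "ennreal (\<sigma> C) + ennreal (\<sigma> D) \<le> ?g (A \<union> B)"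
      if "C \<in> rc_borel" "C \<subseteq> A" "D \<in> rc_borel" "D \<subseteq> B" for C D
    proof -
      have up: "ennreal (\<sigma> E) \<le> ?g (A \<union> B)" if "E \<in> rc_borel" "E \<subseteq> A \<union> B" for E
        using that by (intro SUP_upper) auto
      have "ennreal (\<sigma> C) + ennreal (\<sigma> D) = ennreal (\<sigma> (C \<union> D))" if "\<sigma> C \<ge> 0" "\<sigma> D \<ge> 0"
        using that s2[of C D] \<open>C \<subseteq> A\<close> \<open>D \<subseteq> B\<close> \<open>A \<inter> B = {}\<close> \<open>C \<in> rc_borel\<close> \<open>D \<in> rc_borel\<close>
        by (subst s2) auto
      then show ?thesis
        using up[of "C \<union> D"] up[of C] up[of D] that rc_borel_Un[of C D]
        by (cases "\<sigma> C \<ge> 0"; cases "\<sigma> D \<ge> 0") (auto simp: ennreal_neg)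
    qed
    note * = this
    have ne: "{B \<in> rc_borel. B \<subseteq> A} \<noteq> {}" for A :: "'a set"
      using rc_borel_empty by blast
    have "?g A + ?g B = (SUP D\<in>{D \<in> rc_borel. D \<subseteq> B}. SUP C\<in>{C \<in> rc_borel. C \<subseteq> A}. ennreal (\<sigma> C) + ennreal (\<sigma> D))"
      using ne by (simp add: ennreal_SUP_add_right ennreal_SUP_add_left)
    also have "\<dots> \<le> ?g (A \<union> B)"
      using * by (intro SUP_least) auto
    finally show ?thesis .
  qed
  show "?g (\<Union>n. S n) \<le> (\<Sum>n. ?g (S n))" if S: "range S \<subseteq> sets borel" "disjoint_family S" for S :: "nat \<Rightarrow> 'a set"
  proof (rule SUP_least)
    fix B assume "B \<in> {B \<in> rc_borel. B \<subseteq> (\<Union>n. S n)}"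
    then have B: "B \<in> rc_borel" "B = (\<Union>n. B \<inter> S n)" by auto
    have rc: "B \<inter> S n \<in> rc_borel" for n
      using S by (intro rc_borel_subset[OF B(1)]) (auto intro: rc_borel_sets B)
    have dj: "disjoint_family (\<lambda>n. B \<inter> S n)"
      by (rule disjoint_family_subset[OF S(2)]) simp
    have "(\<lambda>n. \<sigma> (B \<inter> S n)) sums \<sigma> (\<Union>n. B \<inter> S n)"
      by (rule add[OF _ dj]) (use rc B in auto)
    then have "(\<lambda>N. ennreal (\<Sum>n<N. \<sigma> (B \<inter> S n))) \<longlonglongrightarrow> ennreal (\<sigma> B)"
      using B(2) unfolding sums_def by (intro tendsto_ennrealI) simp
    moreover have "ennreal (\<Sum>n<N. \<sigma> (B \<inter> S n)) \<le> (\<Sum>n. ?g (S n))" for N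
    proof -
      have "ennreal (\<Sum>n<N. \<sigma> (B \<inter> S n)) \<le> (\<Sum>n<N. ennreal (\<sigma> (B \<inter> S n)))"
      proof (induction N)
        case (Suc N)
        have "ennreal (a + b) \<le> ennreal a + ennreal b" for a b
        proof -
          have "ennreal (a + b) \<le> ennreal (max 0 a + max 0 b)" by (intro ennreal_leI) auto
          also have "\<dots> = ennreal a + ennreal b"
            by (subst ennreal_plus) (auto simp: max_def ennreal_neg)
          finally show ?thesis .
        qed
        from this[of "\<Sum>n<N. \<sigma> (B \<inter> S n)" "\<sigma> (B \<inter> S N)"]
        show ?case using add_right_mono[OF Suc, of "ennreal (\<sigma> (B \<inter> S N))"]
          by (simp only: sum.lessThan_Suc)
      qed simp
      also have "\<dots> \<le> (\<Sum>n<N. ?g (S n))"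
        using rc by (intro sum_mono SUP_upper) auto
      also have "\<dots> \<le> (\<Sum>n. ?g (S n))" by (intro sum_le_suminf) auto
      finally show ?thesis .
    qed
    ultimately show "ennreal (\<sigma> B) \<le> (\<Sum>n. ?g (S n))"
      by (intro Lim_bounded[where M = 0]) (assumption | intro allI impI | rule meta_spec)+
  qed
qed

lemma emeasure_total_variation:
  fixes \<mu> :: "'a::topological_space cmeasure"
  assumes add: "\<And>A :: nat \<Rightarrow> 'a set. range A \<subseteq> rc_borel \<Longrightarrow> disjoint_family A \<Longrightarrow>
                  (\<Union>n. A n) \<in> rc_borel \<Longrightarrow> (\<lambda>n. \<mu> (A n)) sums \<mu> (\<Union>n. A n)"
    and A: "A \<in> sets borel"
  shows "emeasure (total_variation \<mu>) A =
    (SUP F\<in>{F. finite F \<and> disjoint F \<and> F \<subseteq> rc_borel \<and> \<Union>F \<subseteq> A}. \<Sum>B\<in>F. ennreal (norm (\<mu> B)))"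
  unfolding total_variation_def
proof (rule emeasure_measure_of_superadditive[OF _ _ _ A])
  let ?P = "\<lambda>A. {F. finite F \<and> disjoint F \<and> F \<subseteq> rc_borel \<and> \<Union>F \<subseteq> A}"
  let ?s = "\<lambda>F. \<Sum>B\<in>F. ennreal (norm (\<mu> B))"
  let ?g = "\<lambda>A. SUP F\<in>?P A. ?s F"
  have s0: "\<mu> {} = 0"
  proof -
    have "(\<lambda>n::nat. \<mu> {}) sums \<mu> {}" using add[of "\<lambda>_. {}"] by (simp add: disjoint_family_on_def)
    then have "(\<lambda>n::nat. \<mu> {}) \<longlonglongrightarrow> 0"
      by (intro summable_LIMSEQ_zero sums_summable)
    then show ?thesis by (rule LIMSEQ_unique[OF tendsto_const])
  qed
  show "?g {} = 0"
  proof (intro antisym SUP_least)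
    fix F :: "'a set set" assume "F \<in> ?P {}"
    then have "\<mu> B = 0" if "B \<in> F" for B using s0 that by (cases "B = {}") auto
    then show "?s F \<le> 0" by simp
  qed simp
  show "?g A + ?g B \<le> ?g (A \<union> B)" if AB: "A \<in> sets borel" "B \<in> sets borel" "A \<inter> B = {}" for A B
  proof -
    have *: "?s F + ?s G \<le> ?g (A \<union> B)" if F: "F \<in> ?P A" and G: "G \<in> ?P B" for F G
    proof -
      have FG: "a \<inter> b = {}" if "a \<in> F" "b \<in> G" for a b
      proof -
        have "a \<subseteq> A" "b \<subseteq> B" using F G that by auto
        then show ?thesis using AB(3) by blast
      qed
      have "B = {}" if "B \<in> F \<inter> G" for B using FG[of B B] that by simp
      then have 0: "?s (F \<inter> G) = 0" using s0 by (intro sum.neutral) auto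
      have "finite F" "finite G" using F G by simp_all
      from sum.union_inter[OF this, of "\<lambda>B. ennreal (norm (\<mu> B))"]
      have "?s F + ?s G = ?s (F \<union> G)" unfolding 0 by simp
      also have "\<dots> \<le> ?g (A \<union> B)"
      proof (intro SUP_upper)
        have "disjoint (F \<union> G)"
        proof (rule disjointI)
          fix a b assume ab: "a \<in> F \<union> G" "b \<in> F \<union> G" "a \<noteq> b"
          have F': "disjoint F" "disjoint G" using F G by auto
          from ab(1,2) show "a \<inter> b = {}"
          proof (elim UnE)
            assume "a \<in> F" "b \<in> F" then show ?thesis by (rule disjointD[OF F'(1) _ _ ab(3)])
          next
            assume "a \<in> G" "b \<in> G" then show ?thesis by (rule disjointD[OF F'(2) _ _ ab(3)])
          next
            assume "a \<in> F" "b \<in> G" then show ?thesis by (rule FG)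
          next
            assume "a \<in> G" "b \<in> F" then show ?thesis using FG[of b a] by (simp add: Int_commute)
          qed
        qed
        then show "F \<union> G \<in> ?P (A \<union> B)" using F G by (simp add: le_supI1 le_supI2)
      qed
      finally show ?thesis .
    qed
    have ne: "?P A \<noteq> {}" for A :: "'a set"
    proof -
      have "{} \<in> ?P A" by simp
      then show ?thesis by (metis empty_iff)
    qed
    have "?g A + ?g B = (SUP G\<in>?P B. SUP F\<in>?P A. ?s F + ?s G)"
      by (simp only: ennreal_SUP_add_right[OF ne] ennreal_SUP_add_left[OF ne])
    also have "\<dots> \<le> ?g (A \<union> B)"
      by (intro SUP_least *)
    finally show ?thesis .
  qed
  show "?g (\<Union>n. S n) \<le> (\<Sum>n. ?g (S n))" if S: "range S \<subseteq> sets borel" "disjoint_family S" for S :: "nat \<Rightarrow> 'a set"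
  proof (rule SUP_least)
    fix F assume "F \<in> ?P (\<Union>n. S n)"
    then have F: "finite F" "disjoint F" "F \<subseteq> rc_borel" "\<Union>F \<subseteq> (\<Union>n. S n)"
      by (simp_all only: mem_Collect_eq)
    have rc: "B \<inter> S n \<in> rc_borel" if "B \<in> F" for B n
    proof -
      have "B \<in> rc_borel" using F(3) that by (rule subsetD)
      moreover have "S n \<in> sets borel" using S(1) by (rule range_subsetD)
      ultimately show ?thesis
        by (auto intro: rc_borel_subset[OF \<open>B \<in> rc_borel\<close>] rc_borel_sets)
    qed
    have 1: "ennreal (norm (\<mu> B)) \<le> (\<Sum>n. ennreal (norm (\<mu> (B \<inter> S n))))" if B: "B \<in> F" for B
    proof -
      have Beq: "B = (\<Union>n. B \<inter> S n)" using F(4) B by blast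
      have dj: "disjoint_family (\<lambda>n. B \<inter> S n)"
        by (rule disjoint_family_subset[OF S(2)]) simp
      have "B \<in> rc_borel" using F(3) B by (rule subsetD)
      with Beq have Brc: "(\<Union>n. B \<inter> S n) \<in> rc_borel" by simp
      have "(\<lambda>n. \<mu> (B \<inter> S n)) sums \<mu> (\<Union>n. B \<inter> S n)"
        by (rule add[OF _ dj Brc]) (use rc[OF B] in auto)
      then have "(\<lambda>N. ennreal (norm (\<Sum>n<N. \<mu> (B \<inter> S n)))) \<longlonglongrightarrow> ennreal (norm (\<mu> B))"
        using Beq unfolding sums_def by (intro tendsto_ennrealI tendsto_norm) simp
      moreover have "ennreal (norm (\<Sum>n<N. \<mu> (B \<inter> S n))) \<le> (\<Sum>n. ennreal (norm (\<mu> (B \<inter> S n))))" for N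
      proof -
        have "ennreal (norm (\<Sum>n<N. \<mu> (B \<inter> S n))) \<le> ennreal (\<Sum>n<N. norm (\<mu> (B \<inter> S n)))"
          by (intro ennreal_leI norm_sum)
        also have "\<dots> = (\<Sum>n<N. ennreal (norm (\<mu> (B \<inter> S n))))" by simp
        also have "\<dots> \<le> (\<Sum>n. ennreal (norm (\<mu> (B \<inter> S n))))" by (intro sum_le_suminf) auto
        finally show ?thesis .
      qed
      ultimately show ?thesis by (intro Lim_bounded[where M = 0]) (assumption | intro allI impI | rule meta_spec)+
    qed
    have "?s F \<le> (\<Sum>B\<in>F. \<Sum>n. ennreal (norm (\<mu> (B \<inter> S n))))" by (intro sum_mono 1)
    also have "\<dots> = (\<Sum>n. \<Sum>B\<in>F. ennreal (norm (\<mu> (B \<inter> S n))))"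
      by (intro suminf_sum[symmetric]) auto
    also have "\<dots> \<le> (\<Sum>n. ?g (S n))"
    proof (intro suminf_le)
      fix n
      have "(\<Sum>B\<in>F. ennreal (norm (\<mu> (B \<inter> S n)))) = ?s ((\<lambda>B. B \<inter> S n) ` F)"
      proof (subst sum.reindex_nontrivial)
        fix B C assume "B \<in> F" "C \<in> F" "B \<noteq> C" "B \<inter> S n = C \<inter> S n"
        moreover have "B \<inter> C = {}"
          using F(2) \<open>B \<in> F\<close> \<open>C \<in> F\<close> \<open>B \<noteq> C\<close> by (rule disjointD)
        ultimately have "B \<inter> S n = {}" by blast
        then show "ennreal (norm (\<mu> (B \<inter> S n))) = 0" using s0 by simp
      qed (simp_all add: F(1) o_def)
      also have "\<dots> \<le> ?g (S n)"
      proof (intro SUP_upper)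
        have "disjoint ((\<lambda>B. B \<inter> S n) ` F)"
        proof (rule disjointI)
          fix a b assume "a \<in> (\<lambda>B. B \<inter> S n) ` F" "b \<in> (\<lambda>B. B \<inter> S n) ` F" "a \<noteq> b"
          then obtain B C where BC: "B \<in> F" "C \<in> F" "B \<noteq> C" "a = B \<inter> S n" "b = C \<inter> S n" by auto
          from disjointD[OF F(2) BC(1-3)] show "a \<inter> b = {}" using BC(4,5) by blast
        qed
        then show "(\<lambda>B. B \<inter> S n) ` F \<in> ?P (S n)" using F(1) rc by auto
      qed
      finally show "(\<Sum>B\<in>F. ennreal (norm (\<mu> (B \<inter> S n)))) \<le> ?g (S n)" .
    qed auto
    finally show "?s F \<le> (\<Sum>n. ?g (S n))" .
  qed
qed


section \<open>Fourier transforms\<close>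

definition haar_measure :: "'a::topological_ab_group_add measure \<Rightarrow> bool" where
  "haar_measure m \<longleftrightarrow>
     sets m = sets borel \<and> emeasure m UNIV \<noteq> 0 \<and>
     (\<forall>K. compact K \<longrightarrow> emeasure m K < \<infinity>) \<and>
     (\<forall>A\<in>sets borel. emeasure m A = (INF U\<in>{U. open U \<and> A \<subseteq> U}. emeasure m U)) \<and>
     (\<forall>U. open U \<longrightarrow> emeasure m U = (SUP K\<in>{K. compact K \<and> K \<subseteq> U}. emeasure m K)) \<and>
     (\<forall>A\<in>sets borel. \<forall>x. emeasure m ((+) x ` A) = emeasure m A)"

definition fsupp :: "('a::topological_space \<Rightarrow> complex) \<Rightarrow> 'a set" where
  "fsupp \<phi> = closure {x. \<phi> x \<noteq> 0}"

definition C_c :: "('a::topological_space \<Rightarrow> complex) set" where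
  "C_c = {\<phi>. continuous_on UNIV \<phi> \<and> compact (fsupp \<phi>)}"

definition tilde :: "('a::ab_group_add \<Rightarrow> complex) \<Rightarrow> 'a \<Rightarrow> complex" where
  "tilde \<phi> x = cnj (\<phi> (- x))"

definition fconvolution ::
  "'a::ab_group_add measure \<Rightarrow> ('a \<Rightarrow> complex) \<Rightarrow> ('a \<Rightarrow> complex) \<Rightarrow> 'a \<Rightarrow> complex" where
  "fconvolution m \<phi> \<psi> x = (\<integral>y. \<phi> y * \<psi> (x - y) \<partial>m)"

definition fcheck ::
  "'g::topological_ab_group_add measure \<Rightarrow> ('g \<Rightarrow> complex) \<Rightarrow> 'g character \<Rightarrow> complex" where
  "fcheck m \<phi> \<xi> = (\<integral>x. char_apply \<xi> x * \<phi> x \<partial>m)"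

definition mcheck ::
  "'g::topological_ab_group_add character cmeasure \<Rightarrow> 'g \<Rightarrow> complex" where
  "mcheck \<nu> x = cintegral \<nu> (\<lambda>\<xi>. char_apply \<xi> x)"

definition square_integrable :: "'a measure \<Rightarrow> ('a \<Rightarrow> complex) \<Rightarrow> bool" where
  "square_integrable M f \<longleftrightarrow> f \<in> borel_measurable M \<and> integrable M (\<lambda>x. (norm (f x))\<^sup>2)"

text \<open>
  \<open>has_fourier_transform m \<gamma> \<gamma>h\<close>: the measure \<open>\<gamma>\<close> is Fourier transformable with transform
  \<open>\<gamma>h\<close>, with respect to the Haar measure \<open>m\<close>.
\<close>

definition has_fourier_transform ::
  "'g::topological_ab_group_add measure \<Rightarrow> 'g cmeasure \<Rightarrow> 'g character cmeasure \<Rightarrow> bool" where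
  "has_fourier_transform m \<gamma> \<gamma>h \<longleftrightarrow>
     complex_radon_measure \<gamma> \<and> complex_radon_measure \<gamma>h \<and>
     (\<forall>\<phi>\<in>C_c. square_integrable (total_variation \<gamma>h) (fcheck m \<phi>) \<and>
        cintegral \<gamma> (fconvolution m \<phi> (tilde \<phi>)) =
        cintegral \<gamma>h (\<lambda>\<xi>. complex_of_real ((norm (fcheck m \<phi> \<xi>))\<^sup>2)))"

definition fourier_transformable ::
  "'g::topological_ab_group_add measure \<Rightarrow> 'g cmeasure \<Rightarrow> bool" where
  "fourier_transformable m \<gamma> \<longleftrightarrow> (\<exists>\<gamma>h. has_fourier_transform m \<gamma> \<gamma>h)"

text \<open>
  \<open>mh\<close> is a Haar measure on the dual group; changing its normalisation only rescales the transform
  of \<open>\<gamma>h\<close>, so transformability does not depend on it.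
\<close>

definition twice_fourier_transformable ::
  "'g::topological_ab_group_add measure \<Rightarrow> 'g character measure \<Rightarrow> 'g cmeasure \<Rightarrow> bool" where
  "twice_fourier_transformable m mh \<gamma> \<longleftrightarrow>
     (\<exists>\<gamma>h. has_fourier_transform m \<gamma> \<gamma>h \<and> fourier_transformable mh \<gamma>h)"


section \<open>Cut-and-project schemes\<close>

definition quotient_topology :: "('a::topological_space \<Rightarrow> 'b) \<Rightarrow> 'b topology" where
  "quotient_topology q = topology (\<lambda>U. U \<subseteq> range q \<and> open (q -` U))"

lemma openin_quotient_topology:
  "openin (quotient_topology q) U \<longleftrightarrow> U \<subseteq> range q \<and> open (q -` U)"
proof -
  have "istopology (\<lambda>U. U \<subseteq> range q \<and> open (q -` U))"
    unfolding istopology_def by (auto simp: vimage_Union)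
  then show ?thesis unfolding quotient_topology_def by simp
qed

definition is_lattice :: "'a::{topological_space, ab_group_add} set \<Rightarrow> bool" where
  "is_lattice L \<longleftrightarrow>
     0 \<in> L \<and> (\<forall>x\<in>L. \<forall>y\<in>L. x + y \<in> L) \<and> (\<forall>x\<in>L. - x \<in> L) \<and>
     discrete L \<and> compact_space (quotient_topology (\<lambda>x. (+) x ` L))"

definition cut_and_project_scheme ::
  "('g::topological_ab_group_add \<times> 'h::topological_ab_group_add) set \<Rightarrow> bool" where
  "cut_and_project_scheme L \<longleftrightarrow> is_lattice L \<and> inj_on fst L \<and> closure (snd ` L) = UNIV"

definition cps_projection :: "('g \<times> 'h) set \<Rightarrow> 'h set \<Rightarrow> 'g set" where
  "cps_projection L W = {fst l | l. l \<in> L \<and> snd l \<in> W}"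

definition uniformly_discrete_wrt :: "'g::ab_group_add set \<Rightarrow> 'g set \<Rightarrow> bool" where
  "uniformly_discrete_wrt V \<Lambda> \<longleftrightarrow>
     (\<forall>x\<in>\<Lambda>. \<forall>y\<in>\<Lambda>. x \<noteq> y \<longrightarrow> (+) x ` V \<inter> (+) y ` V = {})"

definition uniformly_discrete :: "'g::topological_ab_group_add set \<Rightarrow> bool" where
  "uniformly_discrete \<Lambda> \<longleftrightarrow> (\<exists>V. 0 \<in> interior V \<and> uniformly_discrete_wrt V \<Lambda>)"


section \<open>Ping-pong measures\<close>

definition ping_pong_measure ::
  "'g::topological_ab_group_add measure \<Rightarrow> 'g character measure \<Rightarrow> 'g cmeasure \<Rightarrow> 'g set \<Rightarrow> bool"
  where
  "ping_pong_measure m mh \<omega> \<Lambda> \<longleftrightarrow>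
     complex_radon_measure \<omega> \<and> uniformly_discrete \<Lambda> \<and>
     uniformly_discrete (msupp \<omega>) \<and> (\<forall>x\<in>\<Lambda>. \<omega> {x} = 1) \<and>
     twice_fourier_transformable m mh \<omega> \<and>
     (\<forall>\<omega>h. has_fourier_transform m \<omega> \<omega>h \<longrightarrow> pure_point \<omega>h)"

definition auxiliary_function ::
  "'g::topological_ab_group_add measure \<Rightarrow> ('g \<Rightarrow> complex) \<Rightarrow> 'g cmeasure \<Rightarrow> bool" where
  "auxiliary_function m \<phi> \<omega> \<longleftrightarrow>
     \<phi> \<in> C_c \<and> fconvolution m \<phi> (tilde \<phi>) 0 = 1 \<and>
     uniformly_discrete_wrt (fsupp (fconvolution m \<phi> (tilde \<phi>))) (msupp \<omega>)"

end

theory Submission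
  imports Defs
begin

text \<open>
  Let \<open>S\<close> be the support of \<open>\<omega>\<close>. Because \<open>S\<close> is uniformly discrete, integrals of compactly supported
  functions against \<open>\<omega>\<close>, or against any measure supported in \<open>S\<close>, are finite sums
  (\<open>cintegral_uniformly_discrete\<close>). Because \<open>\<omega>h\<close> is pure point, integrals against it are absolutely
  convergent series (\<open>pure_point_sequence\<close>, \<open>cintegral_pure_point\<close>), and \<open>\<omega>h * \<nu>\<close> is a series of
  translates of \<open>\<nu>\<close> (\<open>cconvolution_cintegral\<close>). All exchanges of integrals below are therefore
  exchanges of an integral with a finite sum or with a dominated series. For brevity
  \<open>\<phi>\<^sup>\<and>\<close> denotes \<open>fcheck m \<phi>\<close> in what follows.

  Pong. For a character \<open>\<eta>\<close> one has \<open>(\<eta>\<phi>) * (\<eta>\<phi>)~ = \<eta> (\<phi> * \<phi>~)\<close> and \<open>(\<eta>\<phi>)\<^sup>\<and>(\<xi>) = \<phi>\<^sup>\<and>(\<eta> + \<xi>)\<close>.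
  So the identity that defines \<open>\<omega>h\<close>, applied to \<open>\<eta>\<phi>\<close>, says that \<open>\<integral> \<eta> (\<phi> * \<phi>~) d\<omega>\<close> equals
  \<open>\<integral> |\<phi>\<^sup>\<and>(\<eta> + \<xi>)|\<^sup>2 d\<omega>h(\<xi>)\<close>. Integration over \<open>\<eta>\<close> with respect to \<open>\<nu>\<close> gives the identity for
  \<open>mcheck \<nu> \<omega>\<close> and \<open>\<omega>h * \<nu>\<close>. What makes this legitimate is the uniform bound on
  \<open>\<integral> |\<phi>\<^sup>\<and>(\<eta> + \<xi>)|\<^sup>2 d|\<omega>h|(\<xi>)\<close> over all \<open>\<eta>\<close>, a consequence of Baire's theorem
  (\<open>fcheck_square_translation_bounded\<close>).

  Ping. Put \<open>g = \<phi> * \<phi>~\<close> for the auxiliary function \<open>\<phi>\<close> and \<open>\<nu> = |\<phi>\<^sup>\<and>|\<^sup>2 \<gamma>h\<close>. The polarised form of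
  the defining identity of \<open>\<gamma>h\<close> (\<open>fourier_transform_polarized\<close>), applied to \<open>\<phi>\<close> and its translate by
  \<open>x\<close>, reads \<open>mcheck \<nu> x = \<integral> g(t - x) d\<gamma>(t)\<close>. For \<open>x \<in> S\<close> the discreteness of \<open>S\<close> relative to the
  support of \<open>g\<close> leaves only \<open>t = x\<close>, so \<open>mcheck \<nu> x = \<gamma> {x}\<close>. As \<open>\<omega>\<close> has mass one wherever
  \<open>\<gamma>\<close> can have mass, \<open>mcheck \<nu> \<omega> = \<gamma>\<close>. By Pong, \<open>\<omega>h * \<nu>\<close> is a Fourier transform of \<open>\<gamma>\<close>, and
  the Fourier transform is unique (\<open>fourier_transform_unique\<close>).

  Complex measures are handled through their integrals: \<open>cintegral \<mu>\<close> is a bounded linear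
  functional on the integrable functions of a positive measure, and conversely every such functional
  over a suitably regular positive measure comes from a complex Radon measure (\<open>complex_radon_of_functional\<close>). Densities, convolutions and
  differences of measures then reduce to operations on functionals.
\<close>

section \<open>Bounded functionals on integrable functions\<close>

text \<open>
  The constant is existential because its value never matters: only finiteness, null sets and convergence
  are deduced from the bound.
\<close>

definition L1_functional :: "'a measure \<Rightarrow> (('a \<Rightarrow> complex) \<Rightarrow> complex) \<Rightarrow> bool" where
  "L1_functional \<rho> \<Phi> \<longleftrightarrow>
     (\<forall>f g. integrable \<rho> f \<longrightarrow> integrable \<rho> g \<longrightarrow> \<Phi> (\<lambda>x. f x + g x) = \<Phi> f + \<Phi> g) \<and>
     (\<forall>f c. integrable \<rho> f \<longrightarrow> \<Phi> (\<lambda>x. c * f x) = c * \<Phi> f) \<and>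
     (\<exists>C\<ge>0. \<forall>f. integrable \<rho> f \<longrightarrow> norm (\<Phi> f) \<le> C * (\<integral>x. norm (f x) \<partial>\<rho>))"

lemma L1_functional_add:
  "L1_functional \<rho> \<Phi> \<Longrightarrow> integrable \<rho> f \<Longrightarrow> integrable \<rho> g \<Longrightarrow> \<Phi> (\<lambda>x. f x + g x) = \<Phi> f + \<Phi> g"
  by (auto simp: L1_functional_def)

lemma L1_functional_cmult:
  "L1_functional \<rho> \<Phi> \<Longrightarrow> integrable \<rho> f \<Longrightarrow> \<Phi> (\<lambda>x. c * f x) = c * \<Phi> f"
  by (auto simp: L1_functional_def)

lemma L1_functional_bound:
  assumes "L1_functional \<rho> \<Phi>"
  obtains C where "C > 0" "\<And>f. integrable \<rho> f \<Longrightarrow> norm (\<Phi> f) \<le> C * (\<integral>x. norm (f x) \<partial>\<rho>)"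
proof -
  obtain C where C: "C \<ge> 0" "\<And>f. integrable \<rho> f \<Longrightarrow> norm (\<Phi> f) \<le> C * (\<integral>x. norm (f x) \<partial>\<rho>)"
    using assms by (auto simp: L1_functional_def)
  have "norm (\<Phi> f) \<le> (C + 1) * (\<integral>x. norm (f x) \<partial>\<rho>)" if "integrable \<rho> f" for f
  proof -
    have "0 \<le> (\<integral>x. norm (f x) \<partial>\<rho>)" by simp
    then show ?thesis using C(2)[OF that] unfolding distrib_right by linarith
  qed
  with C(1) show thesis by (intro that[of "C + 1"]) auto
qed

lemma L1_functional_zero: "L1_functional \<rho> \<Phi> \<Longrightarrow> \<Phi> (\<lambda>x. 0) = 0"
  using L1_functional_cmult[of \<rho> \<Phi> "\<lambda>_. 0" 0] by simp

lemma L1_functional_diff: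
  assumes "L1_functional \<rho> \<Phi>" "integrable \<rho> f" "integrable \<rho> g"
  shows "\<Phi> (\<lambda>x. f x - g x) = \<Phi> f - \<Phi> g"
  using L1_functional_add[OF assms(1,2), of "\<lambda>x. - 1 * g x"] L1_functional_cmult[OF assms(1,3), of "- 1"]
    assms(3) by simp

lemma L1_functional_sum:
  assumes "L1_functional \<rho> \<Phi>" "\<And>i. i \<in> I \<Longrightarrow> integrable \<rho> (f i)"
  shows "\<Phi> (\<lambda>x. \<Sum>i\<in>I. f i x) = (\<Sum>i\<in>I. \<Phi> (f i))"
  using assms(2)
proof (induction I rule: infinite_finite_induct)
  case (insert i I)
  then show ?case
    using L1_functional_add[OF assms(1), of "f i" "\<lambda>x. \<Sum>i\<in>I. f i x"] by simp
qed (simp_all add: L1_functional_zero[OF assms(1)])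

lemma L1_functional_cong_AE:
  assumes "L1_functional \<rho> \<Phi>" "integrable \<rho> f" "integrable \<rho> g" "AE x in \<rho>. f x = g x"
  shows "\<Phi> f = \<Phi> g"
proof -
  obtain C where C: "\<And>f. integrable \<rho> f \<Longrightarrow> norm (\<Phi> f) \<le> C * (\<integral>x. norm (f x) \<partial>\<rho>)"
    using L1_functional_bound[OF assms(1)] by blast
  have "(\<integral>x. norm (f x - g x) \<partial>\<rho>) = (\<integral>x. 0 \<partial>\<rho>)"
    using assms(2-4) by (intro integral_cong_AE) auto
  with C[of "\<lambda>x. f x - g x"] assms(2,3) have "norm (\<Phi> (\<lambda>x. f x - g x)) \<le> 0" by simp
  then show ?thesis using L1_functional_diff[OF assms(1-3)] by simp
qed

lemma L1_functional_tendsto: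
  fixes f :: "'a \<Rightarrow> complex"
  assumes \<Phi>: "L1_functional \<rho> \<Phi>"
    and s: "\<And>n. s n \<in> borel_measurable \<rho>" and f: "f \<in> borel_measurable \<rho>"
    and w: "integrable \<rho> w" and lim: "AE x in \<rho>. (\<lambda>n. s n x) \<longlonglongrightarrow> f x"
    and bd: "\<And>n. AE x in \<rho>. norm (s n x) \<le> w x"
  shows "(\<lambda>n. \<Phi> (s n)) \<longlonglongrightarrow> \<Phi> f"
proof -
  obtain C where C: "\<And>f. integrable \<rho> f \<Longrightarrow> norm (\<Phi> f) \<le> C * (\<integral>x. norm (f x) \<partial>\<rho>)"
    using L1_functional_bound[OF \<Phi>] by blast
  note int = integrable_dominated_convergence[OF f s w lim bd]
    integrable_dominated_convergence2[OF f s w lim bd]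
  have bd': "AE x in \<rho>. norm (f x) \<le> w x"
  proof -
    have "AE x in \<rho>. \<forall>n. norm (s n x) \<le> w x" using bd by (simp add: AE_all_countable)
    with lim show ?thesis
    proof eventually_elim
      case (elim x)
      then show ?case by (intro Lim_bounded[OF tendsto_norm[OF elim(1)], of 0]) auto
    qed
  qed
  have "(\<lambda>n. \<integral>x. norm (s n x - f x) \<partial>\<rho>) \<longlonglongrightarrow> (\<integral>x. 0 \<partial>\<rho>)"
  proof (rule integral_dominated_convergence[where w = "\<lambda>x. 2 * w x"])
    show "AE x in \<rho>. (\<lambda>n. norm (s n x - f x)) \<longlonglongrightarrow> 0"
      using lim
    proof eventually_elim
      case (elim x)
      then have "(\<lambda>n. s n x - f x) \<longlonglongrightarrow> 0" by (rule LIM_zero)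
      then show ?case by (rule tendsto_norm_zero)
    qed
    show "AE x in \<rho>. norm (norm (s n x - f x)) \<le> 2 * w x" for n
      using bd[of n] bd'
    proof eventually_elim
      case (elim x)
      then show ?case using norm_triangle_ineq4[of "s n x" "f x"] by simp
    qed
  qed (use s f w in auto)
  then have lim0: "(\<lambda>n. C * (\<integral>x. norm (s n x - f x) \<partial>\<rho>)) \<longlonglongrightarrow> 0"
    using tendsto_mult_right_zero[of _ sequentially C] by simp
  have "norm (\<Phi> (s n) - \<Phi> f) \<le> C * (\<integral>x. norm (s n x - f x) \<partial>\<rho>)" for n
  proof -
    have "integrable \<rho> (\<lambda>x. s n x - f x)" using int by (intro Bochner_Integration.integrable_diff)
    from C[OF this] show ?thesis
      by (simp only: L1_functional_diff[OF \<Phi> int(2) int(1)])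
  qed
  then have "(\<lambda>n. \<Phi> (s n) - \<Phi> f) \<longlonglongrightarrow> 0"
    by (intro Lim_null_comparison[OF always_eventually lim0] allI)
  then show ?thesis by (rule LIM_zero_cancel)
qed

lemma L1_functional_lincomb:
  assumes "L1_functional \<rho> \<Phi>" "L1_functional \<rho> \<Psi>"
  shows "L1_functional \<rho> (\<lambda>f. \<Phi> f + c * \<Psi> f)"
proof -
  obtain C where C: "C > 0" "\<And>f. integrable \<rho> f \<Longrightarrow> norm (\<Phi> f) \<le> C * (\<integral>x. norm (f x) \<partial>\<rho>)"
    using L1_functional_bound[OF assms(1)] by blast
  obtain D where D: "D > 0" "\<And>f. integrable \<rho> f \<Longrightarrow> norm (\<Psi> f) \<le> D * (\<integral>x. norm (f x) \<partial>\<rho>)"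
    using L1_functional_bound[OF assms(2)] by blast
  note CD = C D
  have "norm (\<Phi> f + c * \<Psi> f) \<le> (C + norm c * D) * (\<integral>x. norm (f x) \<partial>\<rho>)" if f: "integrable \<rho> f" for f
  proof -
    have "norm (\<Phi> f + c * \<Psi> f) \<le> norm (\<Phi> f) + norm c * norm (\<Psi> f)"
      by (metis norm_mult norm_triangle_ineq)
    also have "\<dots> \<le> C * (\<integral>x. norm (f x) \<partial>\<rho>) + norm c * (D * (\<integral>x. norm (f x) \<partial>\<rho>))"
      using CD f by (intro add_mono mult_left_mono) auto
    finally show ?thesis by (simp add: algebra_simps)
  qed
  moreover have "0 \<le> C + norm c * D" using CD by simp
  ultimately show ?thesis
    unfolding L1_functional_def
    by (intro conjI allI impI exI[of _ "C + norm c * D"])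
      (simp_all add: L1_functional_add[OF assms(1)] L1_functional_add[OF assms(2)]
        L1_functional_cmult[OF assms(1)] L1_functional_cmult[OF assms(2)] ring_distribs mult.left_commute)
qed

text \<open>
  A functional may be moved to a larger positive measure; this puts functionals that stem from different
  measures on a common domain.
\<close>

lemma L1_functional_mono:
  assumes \<Phi>: "L1_functional \<sigma> \<Phi>" and sets: "sets \<rho> = sets \<sigma>"
    and C: "0 \<le> C" "\<And>f::'a \<Rightarrow> real. f \<in> borel_measurable \<sigma> \<Longrightarrow>
      (\<integral>\<^sup>+x. norm (f x) \<partial>\<sigma>) \<le> ennreal C * (\<integral>\<^sup>+x. norm (f x) \<partial>\<rho>)"
  shows "L1_functional \<rho> \<Phi>"
proof -
  obtain D where D: "D > 0" "\<And>f. integrable \<sigma> f \<Longrightarrow> norm (\<Phi> f) \<le> D * (\<integral>x. norm (f x) \<partial>\<sigma>)"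
    using L1_functional_bound[OF \<Phi>] by blast
  have *: "integrable \<sigma> f" "(\<integral>x. norm (f x) \<partial>\<sigma>) \<le> C * (\<integral>x. norm (f x) \<partial>\<rho>)" if f: "integrable \<rho> f" for f :: "'a \<Rightarrow> complex"
  proof -
    have m: "f \<in> borel_measurable \<sigma>"
      using borel_measurable_integrable[OF f] measurable_cong_sets[OF sets refl] by blast
    have le: "(\<integral>\<^sup>+x. norm (f x) \<partial>\<sigma>) \<le> ennreal C * (\<integral>\<^sup>+x. norm (f x) \<partial>\<rho>)"
      using C(2)[of "\<lambda>x. norm (f x)"] m by simp
    also have "\<dots> = ennreal (C * (\<integral>x. norm (f x) \<partial>\<rho>))"
      using f C(1) by (subst nn_integral_eq_integral) (auto simp: ennreal_mult)
    finally have le': "(\<integral>\<^sup>+x. norm (f x) \<partial>\<sigma>) \<le> ennreal (C * (\<integral>x. norm (f x) \<partial>\<rho>))" .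
    then show i: "integrable \<sigma> f"
      using m by (intro integrableI_bounded) (auto intro: le_less_trans)
    have "(\<integral>\<^sup>+x. norm (f x) \<partial>\<sigma>) = ennreal (\<integral>x. norm (f x) \<partial>\<sigma>)"
      using i by (intro nn_integral_eq_integral) auto
    with le' show "(\<integral>x. norm (f x) \<partial>\<sigma>) \<le> C * (\<integral>x. norm (f x) \<partial>\<rho>)"
      using C(1) by (simp add: ennreal_le_iff)
  qed
  have "norm (\<Phi> f) \<le> (D * C) * (\<integral>x. norm (f x) \<partial>\<rho>)" if "integrable \<rho> f" for f
    using order_trans[OF D(2)[OF *(1)[OF that]] mult_left_mono[OF *(2)[OF that], of D]] D(1) by (simp add: mult.assoc)
  moreover have "0 \<le> D * C" using C(1) D(1) by simp
  ultimately show ?thesis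
    unfolding L1_functional_def
    by (intro conjI allI impI exI[of _ "D * C"])
      (simp_all add: L1_functional_add[OF \<Phi>] L1_functional_cmult[OF \<Phi>] *(1))
qed

lemma L1_functional_integral: "L1_functional \<rho> (\<lambda>f. \<integral>x. f x \<partial>\<rho>)"
  unfolding L1_functional_def
  by (intro conjI exI[of _ 1]) (auto intro: integral_norm_bound)

lemma integrable_density_norm:
  fixes g f :: "'a \<Rightarrow> complex"
  assumes g: "g \<in> borel_measurable \<rho>" and f: "integrable (density \<rho> (\<lambda>x. ennreal (norm (g x)))) f"
  shows "integrable \<rho> (\<lambda>x. g x * f x)"
    and "(\<integral>x. norm (f x) \<partial>density \<rho> (\<lambda>x. ennreal (norm (g x)))) = (\<integral>x. norm (g x * f x) \<partial>\<rho>)"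
proof -
  have m: "f \<in> borel_measurable \<rho>"
    using borel_measurable_integrable[OF f] by simp
  have "integrable \<rho> (\<lambda>x. norm (g x) *\<^sub>R f x)"
    using f m g by (subst (asm) integrable_density) auto
  then show "integrable \<rho> (\<lambda>x. g x * f x)"
    by (rule Bochner_Integration.integrable_bound) (use m g in \<open>auto simp: norm_mult\<close>)
  show "(\<integral>x. norm (f x) \<partial>density \<rho> (\<lambda>x. ennreal (norm (g x)))) = (\<integral>x. norm (g x * f x) \<partial>\<rho>)"
    using m g by (subst integral_density) (auto simp: norm_mult)
qed

lemma L1_functional_density:
  fixes g :: "'a \<Rightarrow> complex"
  assumes \<Phi>: "L1_functional \<rho> \<Phi>" and g: "g \<in> borel_measurable \<rho>"
  shows "L1_functional (density \<rho> (\<lambda>x. ennreal (norm (g x)))) (\<lambda>f. \<Phi> (\<lambda>x. g x * f x))"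
proof -
  obtain C where C: "C > 0" "\<And>f. integrable \<rho> f \<Longrightarrow> norm (\<Phi> f) \<le> C * (\<integral>x. norm (f x) \<partial>\<rho>)"
    using L1_functional_bound[OF \<Phi>] by blast
  note * = integrable_density_norm[OF g]
  show ?thesis
    unfolding L1_functional_def
  proof (intro conjI allI impI exI[of _ C])
    fix f1 f2 :: "'a \<Rightarrow> complex" and c :: complex
    assume f: "integrable (density \<rho> (\<lambda>x. ennreal (norm (g x)))) f1"
    show "\<Phi> (\<lambda>x. g x * (c * f1 x)) = c * \<Phi> (\<lambda>x. g x * f1 x)"
      using L1_functional_cmult[OF \<Phi> *(1)[OF f], of c] by (simp add: mult_ac)
    show "norm (\<Phi> (\<lambda>x. g x * f1 x)) \<le> C * (\<integral>x. norm (f1 x) \<partial>density \<rho> (\<lambda>x. ennreal (norm (g x))))"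
      using C(2)[OF *(1)[OF f]] *(2)[OF f] by simp
    assume f2: "integrable (density \<rho> (\<lambda>x. ennreal (norm (g x)))) f2"
    show "\<Phi> (\<lambda>x. g x * (f1 x + f2 x)) = \<Phi> (\<lambda>x. g x * f1 x) + \<Phi> (\<lambda>x. g x * f2 x)"
      using L1_functional_add[OF \<Phi> *(1)[OF f] *(1)[OF f2]] by (simp add: algebra_simps)
  qed (use C in auto)
qed

text \<open>
  Total variations are suprema over relatively compact sets, so a set that is too large to be exhausted
  by such sets can only be controlled if almost all of it is covered by countably many of them. This
  replaces \<open>\<sigma>\<close>-compactness of the space.
\<close>

definition rc_carried :: "'a::topological_space measure \<Rightarrow> bool" where
  "rc_carried \<rho> \<longleftrightarrow> (\<exists>E :: nat \<Rightarrow> 'a set. range E \<subseteq> rc_borel \<and> emeasure \<rho> (- (\<Union>n. E n)) = 0)"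

definition rc_regular :: "'a::topological_space measure \<Rightarrow> bool" where
  "rc_regular \<rho> \<longleftrightarrow> sets \<rho> = sets borel \<and> (\<forall>A\<in>rc_borel. emeasure \<rho> A < \<infinity>) \<and>
     (\<forall>A\<in>rc_borel. \<forall>e>0. \<exists>K. compact K \<and> K \<subseteq> A \<and> emeasure \<rho> (A - K) < ennreal e) \<and> rc_carried \<rho>"

lemma rc_borel_finite_UN: "finite I \<Longrightarrow> (\<And>i. i \<in> I \<Longrightarrow> E i \<in> rc_borel) \<Longrightarrow> (\<Union>i\<in>I. E i) \<in> rc_borel"
  by (induction I rule: finite_induct) (auto intro: rc_borel_Un)

lemma rc_carried_countable:
  assumes "countable \<E>" "\<E> \<subseteq> rc_borel" "emeasure \<rho> (- \<Union>\<E>) = 0"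
  shows "rc_carried \<rho>"
proof (cases "\<E> = {}")
  case True
  then show ?thesis using assms by (auto simp: rc_carried_def intro!: exI[of _ "\<lambda>_. {}"])
next
  case False
  then show ?thesis using assms
    unfolding rc_carried_def
    by (intro exI[of _ "from_nat_into \<E>"]) (auto simp: range_from_nat_into from_nat_into subset_iff)
qed

lemma rc_carried_incseq:
  assumes "rc_carried \<rho>"
  obtains E where "incseq E" "\<And>n. E n \<in> rc_borel" "emeasure \<rho> (- (\<Union>n. E n)) = 0"
proof -
  obtain E :: "nat \<Rightarrow> 'a set" where E: "range E \<subseteq> rc_borel" "emeasure \<rho> (- (\<Union>n. E n)) = 0"
    using assms by (auto simp: rc_carried_def)
  have "(\<Union>n. \<Union>i\<le>n. E i) = (\<Union>n. E n)" by auto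
  moreover have "(\<Union>i\<le>n. E i) \<in> rc_borel" for n using E by (intro rc_borel_finite_UN) auto
  moreover have "incseq (\<lambda>n. \<Union>i\<le>n. E i)" by (force simp: incseq_def)
  ultimately show thesis using E(2) by (intro that[of "\<lambda>n. \<Union>i\<le>n. E i"]) auto
qed

lemma integrable_complex_indicator:
  assumes "A \<in> sets M" "emeasure M A < \<infinity>"
  shows "integrable M (indicator A :: 'a \<Rightarrow> complex)"
proof -
  have "integrable M (\<lambda>x. complex_of_real (indicator A x))"
    using assms by (intro integrable_of_real integrable_real_indicator) auto
  then show ?thesis by (simp add: of_real_indicator cong: integrable_cong)
qed

lemma rc_regular_integrable_indicator:
  "rc_regular \<rho> \<Longrightarrow> A \<in> rc_borel \<Longrightarrow> integrable \<rho> (indicator A :: 'a::topological_space \<Rightarrow> complex)"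
  by (intro integrable_complex_indicator) (auto simp: rc_regular_def rc_borel_sets)

text \<open>
  Indicators of relatively compact sets span a dense subspace of the integrable functions: a set of
  finite measure is, up to a null set, the increasing union of its relatively compact parts.
\<close>

lemma L1_functional_eqI:
  fixes f :: "'a::topological_space \<Rightarrow> complex"
  assumes \<rho>: "sets \<rho> = sets borel" "rc_carried \<rho>"
    and \<Phi>: "L1_functional \<rho> \<Phi>" and \<Psi>: "L1_functional \<rho> \<Psi>"
    and eq: "\<And>A. A \<in> rc_borel \<Longrightarrow> emeasure \<rho> A < \<infinity> \<Longrightarrow> \<Phi> (indicator A) = \<Psi> (indicator A)"
    and f: "integrable \<rho> f"
  shows "\<Phi> f = \<Psi> f"
  using f
proof (induction rule: integrable_induct)
  case (base A c)
  obtain E where E: "incseq E" "\<And>n. E n \<in> rc_borel" "emeasure \<rho> (- (\<Union>n. E n)) = 0"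
    using rc_carried_incseq[OF \<rho>(2)] by blast
  have A: "A \<in> sets borel" using base \<rho> by simp
  have Es: "E n \<in> sets borel" for n by (rule rc_borel_sets[OF E(2)])
  have AE: "AE x in \<rho>. x \<in> (\<Union>n. E n)"
    using E(3) Es \<rho>(1) sets_eq_imp_space_eq[OF \<rho>(1)]
    by (intro AE_I[where N = "- (\<Union>n. E n)"]) auto
  have lim: "(\<lambda>n. \<Theta> (indicator (A \<inter> E n))) \<longlonglongrightarrow> \<Theta> (indicator A)"
    if "L1_functional \<rho> \<Theta>" for \<Theta> :: "('a \<Rightarrow> complex) \<Rightarrow> complex"
  proof (rule L1_functional_tendsto[OF that, where w = "indicator A"])
    show "AE x in \<rho>. (\<lambda>n. indicator (A \<inter> E n) x) \<longlonglongrightarrow> (indicator A x :: complex)"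
      using AE
    proof eventually_elim
      case (elim x)
      then obtain k where "x \<in> E k" by blast
      then have "x \<in> E n" if "n \<ge> k" for n using E(1) that by (auto simp: incseq_def)
      then show ?case
        by (intro tendsto_eventually eventually_sequentiallyI[of k]) (auto simp: indicator_def)
    qed
    have "B \<in> sets \<rho> \<Longrightarrow> (indicator B :: 'a \<Rightarrow> complex) \<in> borel_measurable \<rho>" for B by simp
    then show "(indicator (A \<inter> E n) :: 'a \<Rightarrow> complex) \<in> borel_measurable \<rho>"
      "(indicator A :: 'a \<Rightarrow> complex) \<in> borel_measurable \<rho>" for n
      using base(1) A Es \<rho> by auto
    show "integrable \<rho> (indicator A :: 'a \<Rightarrow> real)" using base by (intro integrable_real_indicator) auto
    show "AE x in \<rho>. norm (indicator (A \<inter> E n) x :: complex) \<le> indicator A x" for n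
      by (auto simp: indicator_def)
  qed
  have "\<Phi> (indicator (A \<inter> E n)) = \<Psi> (indicator (A \<inter> E n))" for n
  proof (rule eq)
    show "A \<inter> E n \<in> rc_borel" using A Es by (intro rc_borel_subset[OF E(2)]) auto
    have "emeasure \<rho> (A \<inter> E n) \<le> emeasure \<rho> A" using base by (intro emeasure_mono) auto
    then show "emeasure \<rho> (A \<inter> E n) < \<infinity>" using base by (auto intro: le_less_trans)
  qed
  then have "\<Phi> (indicator A) = \<Psi> (indicator A)"
    using LIMSEQ_unique[OF lim[OF \<Phi>]] lim[OF \<Psi>] by simp
  moreover have "integrable \<rho> (indicator A :: 'a \<Rightarrow> complex)" using base by (intro integrable_complex_indicator) auto
  ultimately show ?case
    using L1_functional_cmult[OF \<Phi>, of "indicator A" c] L1_functional_cmult[OF \<Psi>, of "indicator A" c]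
    by (simp add: scaleR_conv_of_real mult.commute of_real_indicator)
next
  case (add f g)
  then show ?case using L1_functional_add[OF \<Phi>] L1_functional_add[OF \<Psi>] by simp
next
  case (lim f s)
  have "(\<lambda>n. \<Theta> (s n)) \<longlonglongrightarrow> \<Theta> f" if "L1_functional \<rho> \<Theta>" for \<Theta>
    using lim by (intro L1_functional_tendsto[OF that, where w = "\<lambda>x. 2 * norm (f x)"]) auto
  note * = this
  have "(\<lambda>n. \<Phi> (s n)) = (\<lambda>n. \<Psi> (s n))" using lim.IH by (intro ext)
  with *[OF \<Phi>] *[OF \<Psi>] show ?case using LIMSEQ_unique by metis
qed

section \<open>Complex Radon measures as functionals\<close>

lemma rc_borel_singleton [simp]: "{x} \<in> rc_borel" for x :: "'a::t1_space"
  by (simp add: rc_borel_def)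

lemma rc_borel_Diff: "A \<in> rc_borel \<Longrightarrow> B \<in> sets borel \<Longrightarrow> A - B \<in> rc_borel"
  by (rule rc_borel_subset[of A]) (auto intro: rc_borel_sets)

lemma compact_rc_borel: "compact K \<Longrightarrow> K \<in> rc_borel" for K :: "'a::t2_space set"
  by (simp add: rc_borel_def compact_imp_closed)

lemma complex_radon_sums:
  assumes "complex_radon_measure \<mu>" "range A \<subseteq> rc_borel" "disjoint_family A" "(\<Union>n. A n) \<in> rc_borel"
  shows "(\<lambda>n::nat. \<mu> (A n)) sums \<mu> (\<Union>n. A n)"
  using assms by (auto simp: complex_radon_measure_def)

lemma complex_radon_empty:
  assumes "complex_radon_measure \<mu>" shows "\<mu> {} = 0"
proof -
  have "(\<lambda>n::nat. \<mu> {}) sums \<mu> {}"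
    using complex_radon_sums[OF assms, of "\<lambda>_. {}"] by (simp add: disjoint_family_on_def)
  then have "(\<lambda>n::nat. \<mu> {}) \<longlonglongrightarrow> 0" by (intro summable_LIMSEQ_zero sums_summable)
  then show ?thesis by (rule LIMSEQ_unique[OF tendsto_const])
qed

lemma complex_radon_Un:
  assumes "complex_radon_measure \<mu>" "A \<in> rc_borel" "B \<in> rc_borel" "A \<inter> B = {}"
  shows "\<mu> (A \<union> B) = \<mu> A + \<mu> B"
proof -
  have "(\<lambda>n. \<mu> (binaryset A B n)) sums \<mu> (\<Union>n. binaryset A B n)"
    using assms by (intro complex_radon_sums)
      (auto simp: range_binaryset_eq UN_binaryset_eq rc_borel_Un disjoint_family_on_def binaryset_def)
  moreover have "(\<lambda>n. \<mu> (binaryset A B n)) sums (\<mu> A + \<mu> B)"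
    by (rule binaryset_sums) (rule complex_radon_empty[OF assms(1)])
  ultimately show ?thesis by (simp add: UN_binaryset_eq sums_unique2)
qed

lemma complex_radon_Diff:
  assumes "complex_radon_measure \<mu>" "A \<in> rc_borel" "B \<in> sets borel" "B \<subseteq> A"
  shows "\<mu> (A - B) = \<mu> A - \<mu> B"
proof -
  have "\<mu> (B \<union> (A - B)) = \<mu> B + \<mu> (A - B)"
    using assms by (intro complex_radon_Un) (auto intro: rc_borel_Diff rc_borel_subset)
  then show ?thesis using assms(4) by (simp add: Un_absorb1)
qed

lemma complex_radon_Union:
  assumes \<mu>: "complex_radon_measure \<mu>" and F: "finite F" "disjoint F" "F \<subseteq> rc_borel"
  shows "\<mu> (\<Union>F) = (\<Sum>B\<in>F. \<mu> B)"
  using F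
proof (induction F rule: finite_induct)
  case empty then show ?case using complex_radon_empty[OF \<mu>] by simp
next
  case (insert B F)
  have "\<Union>F \<in> rc_borel" using rc_borel_finite_UN[OF insert(1), of "\<lambda>B. B"] insert.prems by auto
  moreover have "B \<inter> \<Union>F = {}"
    using insert.prems(1) insert.hyps(2) by (force simp: disjoint_def)
  moreover have "disjoint F" using insert.prems(1) by (simp add: disjoint_def)
  ultimately show ?case
    using insert complex_radon_Un[OF \<mu>, of B "\<Union>F"] by simp
qed

lemma emeasure_tv:
  assumes "complex_radon_measure \<mu>" "A \<in> sets borel"
  shows "emeasure (total_variation \<mu>) A =
    (SUP F\<in>{F. finite F \<and> disjoint F \<and> F \<subseteq> rc_borel \<and> \<Union>F \<subseteq> A}. \<Sum>B\<in>F. ennreal (norm (\<mu> B)))"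
  using complex_radon_sums[OF assms(1)] assms(2) by (intro emeasure_total_variation)

lemma sets_total_variation [simp]: "sets (total_variation \<mu>) = sets borel"
  unfolding total_variation_def using sets.sigma_sets_eq[of borel] by simp

lemma space_total_variation [simp]: "space (total_variation \<mu>) = UNIV"
  using sets_eq_imp_space_eq[OF sets_total_variation] by simp

lemma sets_positive_part [simp]: "sets (positive_part \<sigma>) = sets borel"
  unfolding positive_part_def using sets.sigma_sets_eq[of borel] by simp

lemma norm_le_tv:
  assumes "complex_radon_measure \<mu>" "A \<in> rc_borel"
  shows "ennreal (norm (\<mu> A)) \<le> emeasure (total_variation \<mu>) A"
proof -
  have "(\<Sum>B\<in>{A}. ennreal (norm (\<mu> B))) \<le> emeasure (total_variation \<mu>) A"
    unfolding emeasure_tv[OF assms(1) rc_borel_sets[OF assms(2)]]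
    using assms(2) by (intro SUP_upper) auto
  then show ?thesis by simp
qed

lemma total_variation_le:
  fixes \<mu> :: "'a::topological_space cmeasure"
  assumes add: "\<And>A :: nat \<Rightarrow> 'a set. range A \<subseteq> rc_borel \<Longrightarrow> disjoint_family A \<Longrightarrow>
                  (\<Union>n. A n) \<in> rc_borel \<Longrightarrow> (\<lambda>n. \<mu> (A n)) sums \<mu> (\<Union>n. A n)"
    and A: "A \<in> sets borel" and \<rho>: "sets \<rho> = sets borel"
    and le: "\<And>B. B \<in> rc_borel \<Longrightarrow> ennreal (norm (\<mu> B)) \<le> c * emeasure \<rho> B"
  shows "emeasure (total_variation \<mu>) A \<le> c * emeasure \<rho> A"
proof -
  have eq: "emeasure (total_variation \<mu>) A =
      (SUP F\<in>{F. finite F \<and> disjoint F \<and> F \<subseteq> rc_borel \<and> \<Union>F \<subseteq> A}. \<Sum>B\<in>F. ennreal (norm (\<mu> B)))"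
    using add A by (rule emeasure_total_variation)
  show ?thesis
    unfolding eq
  proof (rule SUP_least)
    fix F assume "F \<in> {F. finite F \<and> disjoint F \<and> F \<subseteq> rc_borel \<and> \<Union>F \<subseteq> A}"
    then have F: "finite F" "disjoint F" "F \<subseteq> rc_borel" "\<Union>F \<subseteq> A" by auto
    then have Fs: "F \<subseteq> sets \<rho>" using rc_borel_sets \<rho> by auto
    have "(\<Sum>B\<in>F. ennreal (norm (\<mu> B))) \<le> (\<Sum>B\<in>F. c * emeasure \<rho> B)"
      using F by (intro sum_mono le) auto
    also have "\<dots> = c * (\<Sum>B\<in>F. emeasure \<rho> B)" by (simp add: sum_distrib_left)
    also have "(\<Sum>B\<in>F. emeasure \<rho> B) = emeasure \<rho> (\<Union>F)"
      using sum_emeasure[of "\<lambda>B. B" F \<rho>] F Fs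
      by (auto simp: disjoint_family_on_def disjoint_def)
    also have "c * \<dots> \<le> c * emeasure \<rho> A"
      using F A \<rho> by (intro mult_left_mono emeasure_mono) auto
    finally show "(\<Sum>B\<in>F. ennreal (norm (\<mu> B))) \<le> c * emeasure \<rho> A" .
  qed
qed

text \<open>
  Countable additivity alone bounds the values on the subsets of a relatively compact set. If the values
  on the subsets of \<open>X\<close> are unbounded, then \<open>X\<close> splits into two pieces of values at least \<open>1\<close>, one of
  which again has subsets with unbounded values. Splitting this piece repeatedly produces infinitely many
  disjoint sets of values at least \<open>1\<close>, whose series of values cannot converge.
\<close>

lemma complex_radon_bounded:
  fixes \<mu> :: "'a::topological_space cmeasure"
  assumes \<mu>: "complex_radon_measure \<mu>" and A: "A \<in> rc_borel"
  shows "\<exists>M. \<forall>B\<in>sets borel. B \<subseteq> A \<longrightarrow> norm (\<mu> B) \<le> M"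
proof (rule ccontr)
  assume unbounded: "\<not> ?thesis"
  define bad where "bad X \<longleftrightarrow> X \<in> rc_borel \<and> \<not> (\<exists>M. \<forall>B\<in>sets borel. B \<subseteq> X \<longrightarrow> norm (\<mu> B) \<le> M)" for X
  have step: "\<exists>Y. bad Y \<and> Y \<subseteq> X \<and> norm (\<mu> (X - Y)) \<ge> 1" if X: "bad X" for X
  proof -
    from X obtain B where B: "B \<in> sets borel" "B \<subseteq> X" "norm (\<mu> B) > norm (\<mu> X) + 1"
      unfolding bad_def by (meson not_le)
    have Xrc: "X \<in> rc_borel" using X by (simp add: bad_def)
    have Brc: "B \<in> rc_borel" "X - B \<in> rc_borel"
      using B by (auto intro: rc_borel_subset[OF Xrc] rc_borel_Diff[OF Xrc])
    have "norm (\<mu> (X - B)) \<ge> norm (\<mu> B) - norm (\<mu> X)"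
      unfolding complex_radon_Diff[OF \<mu> Xrc B(1,2)] using norm_triangle_ineq2[of "\<mu> B" "\<mu> X"]
      by (simp add: norm_minus_commute)
    moreover have "X - (X - B) = B" using B(2) by blast
    moreover have "norm (\<mu> B) \<ge> 1" using B(3) norm_ge_zero[of "\<mu> X"] by linarith
    ultimately have ge: "norm (\<mu> (X - B)) \<ge> 1" "norm (\<mu> (X - (X - B))) \<ge> 1"
      using B(3) by (linarith, simp)
    have "bad B \<or> bad (X - B)"
    proof (rule ccontr)
      assume "\<not> ?thesis"
      then have nb: "\<not> bad B" "\<not> bad (X - B)" by auto
      obtain M where M: "\<And>C. C \<in> sets borel \<Longrightarrow> C \<subseteq> B \<Longrightarrow> norm (\<mu> C) \<le> M"
        using nb(1) Brc(1) unfolding bad_def by auto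
      obtain N where N: "\<And>C. C \<in> sets borel \<Longrightarrow> C \<subseteq> X - B \<Longrightarrow> norm (\<mu> C) \<le> N"
        using nb(2) Brc(2) unfolding bad_def by auto
      have "norm (\<mu> C) \<le> M + N" if C: "C \<in> sets borel" "C \<subseteq> X" for C
      proof -
        have "\<mu> (C \<inter> B \<union> (C - B)) = \<mu> (C \<inter> B) + \<mu> (C - B)"
          using C B by (intro complex_radon_Un[OF \<mu>]) (auto intro: rc_borel_subset[OF Xrc])
        moreover have "C \<inter> B \<union> (C - B) = C" by blast
        ultimately have "norm (\<mu> C) \<le> norm (\<mu> (C \<inter> B)) + norm (\<mu> (C - B))"
          using norm_triangle_ineq by metis
        also have "\<dots> \<le> M + N" using C B by (intro add_mono M N) auto
        finally show ?thesis .
      qed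
      then show False using X by (auto simp: bad_def)
    qed
    then show ?thesis
    proof
      assume "bad B" then show ?thesis using ge(1) B(2) by (intro exI[of _ B]) simp
    next
      assume "bad (X - B)" then show ?thesis using ge(2) by (intro exI[of _ "X - B"]) simp
    qed
  qed
  have "bad A" using unbounded A by (simp add: bad_def)
  have "\<exists>X. \<forall>n::nat. bad (X n) \<and> (X (Suc n) \<subseteq> X n \<and> norm (\<mu> (X n - X (Suc n))) \<ge> 1)"
  proof (rule dependent_nat_choice)
    show "\<exists>X. bad X" using \<open>bad A\<close> by blast
    show "\<exists>Y. bad Y \<and> (Y \<subseteq> X \<and> norm (\<mu> (X - Y)) \<ge> 1)" if "bad X" for X using step[OF that] .
  qed
  then obtain X where X: "\<And>n::nat. bad (X n)" "\<And>n. X (Suc n) \<subseteq> X n" "\<And>n. norm (\<mu> (X n - X (Suc n))) \<ge> 1"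
    by auto
  \<comment> \<open>The differences are disjoint subsets of \<open>A\<close> on which \<open>\<mu>\<close> does not tend to \<open>0\<close>.\<close>
  define D where "D n = X n - X (Suc n)" for n
  have Xrc: "X n \<in> rc_borel" for n using X(1) by (simp add: bad_def)
  have Drc: "D n \<in> rc_borel" for n unfolding D_def by (intro rc_borel_Diff Xrc rc_borel_sets)
  have dec: "decseq X" using X(2) by (rule decseq_SucI)
  have "disjoint_family D"
  proof -
    have "D i \<inter> D j = {}" if "i < j" for i j
      using decseqD[OF dec, of "Suc i" j] that unfolding D_def by auto
    then show ?thesis
      unfolding disjoint_family_on_def by (metis Int_commute linorder_neqE_nat)
  qed
  moreover have "(\<Union>n. D n) \<in> rc_borel"
  proof (rule rc_borel_subset[OF Xrc[of 0]])
    show "(\<Union>n. D n) \<in> sets borel" using Drc rc_borel_sets by blast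
    show "(\<Union>n. D n) \<subseteq> X 0" using decseqD[OF dec, of 0] by (auto simp: D_def)
  qed
  ultimately have "(\<lambda>n. \<mu> (D n)) sums \<mu> (\<Union>n. D n)"
    using Drc by (intro complex_radon_sums[OF \<mu>]) auto
  then have "(\<lambda>n. \<mu> (D n)) \<longlonglongrightarrow> 0" by (intro summable_LIMSEQ_zero sums_summable)
  then have "(\<lambda>n. norm (\<mu> (D n))) \<longlonglongrightarrow> 0" by (rule tendsto_norm_zero)
  then have "(1::real) \<le> 0" using X(3) by (intro LIMSEQ_le_const[of _ 0 1]) (auto simp: D_def)
  then show False by simp
qed

text \<open>
  Separate the nonnegative terms from the negative ones.
\<close>

lemma sum_abs_le_of_subsums:
  fixes h :: "'b \<Rightarrow> real"
  assumes "finite F" "\<And>G. G \<subseteq> F \<Longrightarrow> \<bar>\<Sum>x\<in>G. h x\<bar> \<le> M"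
  shows "(\<Sum>x\<in>F. \<bar>h x\<bar>) \<le> 2 * M"
proof -
  have "(\<Sum>x\<in>F. \<bar>h x\<bar>) = (\<Sum>x\<in>{x\<in>F. h x \<ge> 0}. \<bar>h x\<bar>) + (\<Sum>x\<in>F - {x\<in>F. h x \<ge> 0}. \<bar>h x\<bar>)"
    using assms(1) by (subst add.commute, intro sum.subset_diff) auto
  also have "\<dots> = (\<Sum>x\<in>{x\<in>F. h x \<ge> 0}. h x) - (\<Sum>x\<in>F - {x\<in>F. h x \<ge> 0}. h x)"
    by (auto simp: sum_negf[symmetric] intro!: sum.cong)
  also have "\<dots> \<le> M + M"
    using assms(2)[of "{x\<in>F. h x \<ge> 0}"] assms(2)[of "F - {x\<in>F. h x \<ge> 0}"] by (simp add: abs_le_iff)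
  finally show ?thesis by simp
qed

lemma tv_finite:
  assumes \<mu>: "complex_radon_measure \<mu>" and A: "A \<in> rc_borel"
  shows "emeasure (total_variation \<mu>) A < \<infinity>"
proof -
  obtain M where M: "\<And>B. B \<in> sets borel \<Longrightarrow> B \<subseteq> A \<Longrightarrow> norm (\<mu> B) \<le> M"
    using complex_radon_bounded[OF assms] by blast
  have "emeasure (total_variation \<mu>) A \<le> ennreal (4 * M)"
    unfolding emeasure_tv[OF \<mu> rc_borel_sets[OF A]]
  proof (rule SUP_least)
    fix F assume "F \<in> {F. finite F \<and> disjoint F \<and> F \<subseteq> rc_borel \<and> \<Union>F \<subseteq> A}"
    then have F: "finite F" "disjoint F" "F \<subseteq> rc_borel" "\<Union>F \<subseteq> A" by auto
    have le: "norm (\<Sum>B\<in>G. \<mu> B) \<le> M" if G: "G \<subseteq> F" for G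
    proof -
      have "finite G" "disjoint G" "G \<subseteq> rc_borel"
        using G F finite_subset[OF G F(1)] unfolding disjoint_def by (blast, meson subsetD, blast)
      then have "(\<Sum>B\<in>G. \<mu> B) = \<mu> (\<Union>G)" "\<Union>G \<in> rc_borel"
        using complex_radon_Union[OF \<mu>] rc_borel_finite_UN[of G "\<lambda>B. B"] by auto
      moreover have "\<Union>G \<subseteq> A" using G F(4) by blast
      ultimately show ?thesis using M[OF rc_borel_sets] by simp
    qed
    have "(\<Sum>B\<in>F. norm (\<mu> B)) \<le> (\<Sum>B\<in>F. \<bar>Re (\<mu> B)\<bar> + \<bar>Im (\<mu> B)\<bar>)"
      by (intro sum_mono cmod_le)
    also have "\<dots> = (\<Sum>B\<in>F. \<bar>Re (\<mu> B)\<bar>) + (\<Sum>B\<in>F. \<bar>Im (\<mu> B)\<bar>)" by (rule sum.distrib)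
    also have "\<dots> \<le> 2 * M + 2 * M"
    proof (intro add_mono sum_abs_le_of_subsums F(1))
      fix G assume G: "G \<subseteq> F"
      show "\<bar>\<Sum>B\<in>G. Re (\<mu> B)\<bar> \<le> M"
        using le[OF G] abs_Re_le_cmod[of "\<Sum>B\<in>G. \<mu> B"] by simp
      show "\<bar>\<Sum>B\<in>G. Im (\<mu> B)\<bar> \<le> M"
        using le[OF G] abs_Im_le_cmod[of "\<Sum>B\<in>G. \<mu> B"] by simp
    qed
    finally have "ennreal (\<Sum>B\<in>F. norm (\<mu> B)) \<le> ennreal (4 * M)" by (intro ennreal_leI) simp
    then show "(\<Sum>B\<in>F. ennreal (norm (\<mu> B))) \<le> ennreal (4 * M)" by simp
  qed
  then show ?thesis by (rule le_less_trans) simp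
qed

lemma tv_rc_regular:
  assumes "complex_radon_measure \<mu>" "rc_carried (total_variation \<mu>)"
  shows "rc_regular (total_variation \<mu>)"
  using assms tv_finite[OF assms(1)] unfolding rc_regular_def
  by (auto simp: complex_radon_measure_def)

text \<open>
  A finite total variation is approximated by the values on finitely many relatively compact sets, whose
  union then misses only little of it.
\<close>

lemma tv_finite_set_carried:
  assumes \<mu>: "complex_radon_measure \<mu>" and A: "A \<in> sets borel" "emeasure (total_variation \<mu>) A < \<infinity>"
  shows "\<exists>\<E>. countable \<E> \<and> \<E> \<subseteq> rc_borel \<and> \<Union>\<E> \<subseteq> A \<and> emeasure (total_variation \<mu>) (A - \<Union>\<E>) = 0"
proof -
  let ?t = "total_variation \<mu>"
  have "\<exists>B\<in>rc_borel. B \<subseteq> A \<and> emeasure ?t A \<le> emeasure ?t B + ennreal (inverse (Suc n))" for n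
  proof (cases "emeasure ?t A = 0")
    case True then show ?thesis by (intro bexI[of _ "{}"]) auto
  next
    case False
    let ?e = "ennreal (inverse (Suc n))"
    have "emeasure ?t A - ?e < emeasure ?t A"
      using False A(2) by (intro ennreal_between) (auto simp: zero_less_iff_neq_zero)
    then obtain F where F: "finite F" "disjoint F" "F \<subseteq> rc_borel" "\<Union>F \<subseteq> A"
      and less: "emeasure ?t A - ?e < (\<Sum>B\<in>F. ennreal (norm (\<mu> B)))"
      unfolding emeasure_tv[OF \<mu> A(1)] less_SUP_iff by auto
    have rc: "\<Union>F \<in> rc_borel" using rc_borel_finite_UN[OF F(1), of "\<lambda>B. B"] F(3) by auto
    have "(\<Sum>B\<in>F. ennreal (norm (\<mu> B))) \<le> emeasure ?t (\<Union>F)"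
      unfolding emeasure_tv[OF \<mu> rc_borel_sets[OF rc]] using F by (intro SUP_upper) auto
    with less have "emeasure ?t A - ?e \<le> emeasure ?t (\<Union>F)" by simp
    then have "emeasure ?t A \<le> emeasure ?t (\<Union>F) + ?e"
      by (simp add: ennreal_minus_le_iff add.commute)
    then show ?thesis using rc F(4) by blast
  qed
  then obtain B where B: "\<And>n. B n \<in> rc_borel" "\<And>n. B n \<subseteq> A"
    "\<And>n::nat. emeasure ?t A \<le> emeasure ?t (B n) + ennreal (inverse (Suc n))"
    by metis
  have U: "(\<Union>n. B n) \<in> sets borel" using B(1) rc_borel_sets by blast
  have "emeasure ?t (A - (\<Union>n. B n)) \<le> ennreal (inverse (Suc n))" for n
  proof -
    have Bn: "B n \<in> sets borel" by (rule rc_borel_sets[OF B(1)])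
    have "emeasure ?t (A - (\<Union>n. B n)) \<le> emeasure ?t (A - B n)"
      using A(1) Bn by (intro emeasure_mono) auto
    also have "\<dots> = emeasure ?t A - emeasure ?t (B n)"
      using A(1) Bn B(2) tv_finite[OF \<mu> B(1)[of n]] by (intro emeasure_Diff) auto
    also have "\<dots> \<le> ennreal (inverse (Suc n))"
      using B(3)[of n] A(2) by (auto simp: ennreal_minus_le_iff add.commute)
    finally show ?thesis .
  qed
  moreover have "(\<lambda>n. ennreal (inverse (Suc n))) \<longlonglongrightarrow> 0"
    using tendsto_ennrealI[OF LIMSEQ_inverse_real_of_nat] by simp
  ultimately have "emeasure ?t (A - (\<Union>n. B n)) \<le> 0"
    by (intro LIMSEQ_le_const[of "\<lambda>n. ennreal (inverse (Suc n))"]) auto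
  then show ?thesis using B(1,2) by (intro exI[of _ "range B"]) auto
qed

lemma tv_carried:
  assumes \<mu>: "complex_radon_measure \<mu>"
    and D: "countable \<D>" "\<And>A. A \<in> \<D> \<Longrightarrow> A \<in> sets borel" "\<And>A. A \<in> \<D> \<Longrightarrow> emeasure (total_variation \<mu>) A < \<infinity>" "\<Union>\<D> = UNIV"
  shows "rc_carried (total_variation \<mu>)"
proof -
  let ?t = "total_variation \<mu>"
  have "\<forall>A\<in>\<D>. \<exists>\<E>. countable \<E> \<and> \<E> \<subseteq> rc_borel \<and> \<Union>\<E> \<subseteq> A \<and> emeasure ?t (A - \<Union>\<E>) = 0"
    using tv_finite_set_carried[OF \<mu>] D by simp
  from bchoice[OF this] obtain E where
    "\<forall>A\<in>\<D>. countable (E A) \<and> E A \<subseteq> rc_borel \<and> \<Union>(E A) \<subseteq> A \<and> emeasure ?t (A - \<Union>(E A)) = 0" ..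
  then have E: "\<And>A. A \<in> \<D> \<Longrightarrow> countable (E A)" "\<And>A. A \<in> \<D> \<Longrightarrow> E A \<subseteq> rc_borel"
    "\<And>A. A \<in> \<D> \<Longrightarrow> emeasure ?t (A - \<Union>(E A)) = 0"
    by simp_all
  have rcb: "rc_borel \<subseteq> (sets borel :: 'a set set)" using rc_borel_sets by blast
  have meas: "A - \<Union>(E A) \<in> sets borel" if "A \<in> \<D>" for A
    using D(2)[OF that] sets.countable_Union[OF E(1)[OF that] subset_trans[OF E(2)[OF that] rcb]]
    by (rule sets.Diff)
  have rc: "(\<Union>A\<in>\<D>. E A) \<subseteq> rc_borel" using E(2) by blast
  have cn: "countable (\<Union>A\<in>\<D>. E A)" using D(1) E(1) by (rule countable_UN)
  have "A - \<Union>(E A) \<in> null_sets ?t" if "A \<in> \<D>" for A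
    using E(3)[OF that] meas[OF that] by (intro null_setsI) simp_all
  then have "(\<Union>A\<in>\<D>. A - \<Union>(E A)) \<in> null_sets ?t"
    by (intro null_sets_UN' D(1))
  moreover have "- \<Union>(\<Union>A\<in>\<D>. E A) \<in> sets ?t"
    using sets.countable_Union[OF cn subset_trans[OF rc rcb]] by simp
  moreover have "- \<Union>(\<Union>A\<in>\<D>. E A) \<subseteq> (\<Union>A\<in>\<D>. A - \<Union>(E A))"
  proof
    fix x assume x: "x \<in> - \<Union>(\<Union>A\<in>\<D>. E A)"
    have "x \<in> \<Union>\<D>" using D(4) by simp
    then obtain A where "A \<in> \<D>" "x \<in> A" by (rule UnionE)
    then show "x \<in> (\<Union>A\<in>\<D>. A - \<Union>(E A))" using x by auto
  qed
  ultimately have "- \<Union>(\<Union>A\<in>\<D>. E A) \<in> null_sets ?t"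
    by (rule null_sets_subset)
  then show ?thesis
    using rc_carried_countable[OF cn rc] by (simp add: null_setsD1)
qed

lemma emeasure_positive_part_le:
  fixes \<mu> :: "'a::topological_space cmeasure"
  assumes \<mu>: "complex_radon_measure \<mu>"
    and \<sigma>: "\<And>A :: nat \<Rightarrow> 'a set. range A \<subseteq> rc_borel \<Longrightarrow> disjoint_family A \<Longrightarrow>
                  (\<Union>n. A n) \<in> rc_borel \<Longrightarrow> (\<lambda>n. \<sigma> (A n)) sums \<sigma> (\<Union>n. A n)"
    and le: "\<And>B. B \<in> rc_borel \<Longrightarrow> \<sigma> B \<le> norm (\<mu> B)"
    and A: "A \<in> sets borel"
  shows "emeasure (positive_part \<sigma>) A \<le> emeasure (total_variation \<mu>) A"
proof -
  have "emeasure (positive_part \<sigma>) A = (SUP B\<in>{B \<in> rc_borel. B \<subseteq> A}. ennreal (\<sigma> B))"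
    using \<sigma> A by (rule emeasure_positive_part)
  also have "\<dots> \<le> emeasure (total_variation \<mu>) A"
proof (rule SUP_least)
  fix B assume "B \<in> {B \<in> rc_borel. B \<subseteq> A}"
  then have B: "B \<in> rc_borel" "B \<subseteq> A" by auto
  have "ennreal (\<sigma> B) \<le> ennreal (norm (\<mu> B))" using le[OF B(1)] by (rule ennreal_leI)
  also have "\<dots> \<le> emeasure (total_variation \<mu>) B" by (rule norm_le_tv[OF \<mu> B(1)])
  also have "\<dots> \<le> emeasure (total_variation \<mu>) A" using B(2) A by (intro emeasure_mono) auto
  finally show "ennreal (\<sigma> B) \<le> emeasure (total_variation \<mu>) A" .
qed
  finally show ?thesis .
qed

text \<open>
  The Jordan decomposition. From \<open>\<sigma> B = \<sigma> A - \<sigma> (A - B)\<close> for \<open>B \<subseteq> A\<close>, the supremum of \<open>\<sigma>\<close> over the subsets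
  of \<open>A\<close> exceeds the supremum of \<open>-\<sigma>\<close> by exactly \<open>\<sigma> A\<close>.
\<close>

lemma measure_positive_part_diff:
  fixes \<sigma> :: "'a::topological_space set \<Rightarrow> real"
  assumes \<sigma>: "\<And>A :: nat \<Rightarrow> 'a set. range A \<subseteq> rc_borel \<Longrightarrow> disjoint_family A \<Longrightarrow>
                  (\<Union>n. A n) \<in> rc_borel \<Longrightarrow> (\<lambda>n. \<sigma> (A n)) sums \<sigma> (\<Union>n. A n)"
    and diff: "\<And>B C. B \<in> rc_borel \<Longrightarrow> C \<in> sets borel \<Longrightarrow> C \<subseteq> B \<Longrightarrow> \<sigma> (B - C) = \<sigma> B - \<sigma> C"
    and A: "A \<in> rc_borel"
    and fin: "emeasure (positive_part \<sigma>) A < \<infinity>" "emeasure (positive_part (\<lambda>B. - \<sigma> B)) A < \<infinity>"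
  shows "measure (positive_part \<sigma>) A - measure (positive_part (\<lambda>B. - \<sigma> B)) A = \<sigma> A"
proof -
  have half: "measure (positive_part \<tau>) A \<le> \<tau> A + measure (positive_part (\<lambda>B. - \<tau> B)) A"
    if \<tau>: "\<And>A :: nat \<Rightarrow> 'a set. range A \<subseteq> rc_borel \<Longrightarrow> disjoint_family A \<Longrightarrow>
                  (\<Union>n. A n) \<in> rc_borel \<Longrightarrow> (\<lambda>n. \<tau> (A n)) sums \<tau> (\<Union>n. A n)"
      and d: "\<And>C. C \<in> sets borel \<Longrightarrow> C \<subseteq> A \<Longrightarrow> \<tau> (A - C) = \<tau> A - \<tau> C"
      and f: "emeasure (positive_part \<tau>) A < \<infinity>" "emeasure (positive_part (\<lambda>B. - \<tau> B)) A < \<infinity>" for \<tau>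
  proof -
    let ?p = "measure (positive_part (\<lambda>B. - \<tau> B)) A"
    have neg: "(\<lambda>n. - \<tau> (S n)) sums - \<tau> (\<Union>n. S n)"
      if "range S \<subseteq> rc_borel" "disjoint_family S" "(\<Union>n. S n) \<in> rc_borel" for S :: "nat \<Rightarrow> 'a set"
      by (rule sums_minus[OF \<tau>[OF that]])
    have pp: "emeasure (positive_part \<tau>) A = (SUP B\<in>{B \<in> rc_borel. B \<subseteq> A}. ennreal (\<tau> B))"
      "emeasure (positive_part (\<lambda>B. - \<tau> B)) A = (SUP B\<in>{B \<in> rc_borel. B \<subseteq> A}. ennreal (- \<tau> B))"
      using \<tau> neg rc_borel_sets[OF A] by (intro emeasure_positive_part; simp)+
    have le: "\<tau> B \<le> \<tau> A + ?p" if B: "B \<in> rc_borel" "B \<subseteq> A" for B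
    proof -
      have C: "A - B \<in> rc_borel" by (rule rc_borel_Diff[OF A rc_borel_sets[OF B(1)]])
      have "ennreal (- \<tau> (A - B)) \<le> emeasure (positive_part (\<lambda>B. - \<tau> B)) A"
        unfolding pp(2) using C by (intro SUP_upper) auto
      also have "\<dots> = ennreal ?p" using f(2) by (intro emeasure_eq_ennreal_measure) auto
      finally have "- \<tau> (A - B) \<le> ?p" by (simp add: ennreal_le_iff)
      then show ?thesis using d[OF rc_borel_sets[OF B(1)] B(2)] by simp
    qed
    have "emeasure (positive_part \<tau>) A \<le> ennreal (\<tau> A + ?p)"
      unfolding pp(1)
      using le by (intro SUP_least ennreal_leI) auto
    moreover have "emeasure (positive_part \<tau>) A = ennreal (measure (positive_part \<tau>) A)"
      using f(1) by (intro emeasure_eq_ennreal_measure) auto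
    moreover have "0 \<le> \<tau> A + ?p"
    proof -
      have "\<tau> {} = 0" using d[of "{}"] by simp
      then show ?thesis using le[of "{}"] by simp
    qed
    ultimately show ?thesis by (simp add: ennreal_le_iff)
  qed
  have "measure (positive_part \<sigma>) A \<le> \<sigma> A + measure (positive_part (\<lambda>B. - \<sigma> B)) A"
    by (rule half) (use fin diff[OF A] \<sigma> in auto)
  moreover have "measure (positive_part (\<lambda>B. - \<sigma> B)) A \<le> - \<sigma> A + measure (positive_part (\<lambda>B. - (- \<sigma> B))) A"
    by (rule half) (use fin diff[OF A] in \<open>auto intro!: sums_minus \<sigma>\<close>)
  ultimately show ?thesis by simp
qed

lemma L1_functional_positive_part:
  assumes "\<And>A. A \<in> sets borel \<Longrightarrow> emeasure (positive_part \<sigma>) A \<le> emeasure (total_variation \<mu>) A"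
  shows "L1_functional (total_variation \<mu>) (\<lambda>f. \<integral>x. f x \<partial>positive_part \<sigma>)"
proof (rule L1_functional_mono[OF L1_functional_integral, of _ _ 1])
  fix f :: "'a \<Rightarrow> real"
  have "positive_part \<sigma> \<le> total_variation \<mu>" using assms by (subst le_measure) auto
  then show "(\<integral>\<^sup>+x. norm (f x) \<partial>positive_part \<sigma>) \<le> ennreal 1 * (\<integral>\<^sup>+x. norm (f x) \<partial>total_variation \<mu>)"
    using nn_integral_mono_measure[of "positive_part \<sigma>" "total_variation \<mu>"] by simp
qed simp_all

context
  fixes \<mu> :: "'a::topological_space cmeasure"
  assumes \<mu>: "complex_radon_measure \<mu>"
begin

private lemma parts_sums:
  assumes "range A \<subseteq> rc_borel" "disjoint_family A" "(\<Union>n. A n) \<in> rc_borel"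
  shows "(\<lambda>n::nat. Re (\<mu> (A n))) sums Re (\<mu> (\<Union>n. A n))"
    "(\<lambda>n::nat. - Re (\<mu> (A n))) sums - Re (\<mu> (\<Union>n. A n))"
    "(\<lambda>n::nat. Im (\<mu> (A n))) sums Im (\<mu> (\<Union>n. A n))"
    "(\<lambda>n::nat. - Im (\<mu> (A n))) sums - Im (\<mu> (\<Union>n. A n))"
  using complex_radon_sums[OF \<mu> assms] by (auto intro!: sums_minus sums_Re sums_Im)

private lemma parts_le:
  assumes "A \<in> sets borel"
  shows "emeasure (positive_part (\<lambda>A. Re (\<mu> A))) A \<le> emeasure (total_variation \<mu>) A"
    "emeasure (positive_part (\<lambda>A. - Re (\<mu> A))) A \<le> emeasure (total_variation \<mu>) A"
    "emeasure (positive_part (\<lambda>A. Im (\<mu> A))) A \<le> emeasure (total_variation \<mu>) A"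
    "emeasure (positive_part (\<lambda>A. - Im (\<mu> A))) A \<le> emeasure (total_variation \<mu>) A"
proof -
  have "\<bar>Re z\<bar> \<le> norm z" "\<bar>Im z\<bar> \<le> norm z" for z by (rule abs_Re_le_cmod abs_Im_le_cmod)+
  note * = abs_le_D1[OF this(1)] abs_le_D2[OF this(1)] abs_le_D1[OF this(2)] abs_le_D2[OF this(2)]
  show "emeasure (positive_part (\<lambda>A. Re (\<mu> A))) A \<le> emeasure (total_variation \<mu>) A"
    by (rule emeasure_positive_part_le[OF \<mu> _ _ assms]) (use parts_sums(1) * in auto)
  show "emeasure (positive_part (\<lambda>A. - Re (\<mu> A))) A \<le> emeasure (total_variation \<mu>) A"
    by (rule emeasure_positive_part_le[OF \<mu> _ _ assms]) (use parts_sums(2) * in auto)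
  show "emeasure (positive_part (\<lambda>A. Im (\<mu> A))) A \<le> emeasure (total_variation \<mu>) A"
    by (rule emeasure_positive_part_le[OF \<mu> _ _ assms]) (use parts_sums(3) * in auto)
  show "emeasure (positive_part (\<lambda>A. - Im (\<mu> A))) A \<le> emeasure (total_variation \<mu>) A"
    by (rule emeasure_positive_part_le[OF \<mu> _ _ assms]) (use parts_sums(4) * in auto)
qed

lemma cintegral_L1_functional: "L1_functional (total_variation \<mu>) (cintegral \<mu>)"
proof -
  let ?L = "L1_functional (total_variation \<mu>)"
  let ?I = "\<lambda>\<sigma> f. \<integral>x. f x \<partial>positive_part \<sigma>"
  have "?L (\<lambda>f. (?I (\<lambda>A. Re (\<mu> A)) f + (- 1) * ?I (\<lambda>A. - Re (\<mu> A)) f)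
      + \<i> * (?I (\<lambda>A. Im (\<mu> A)) f + (- 1) * ?I (\<lambda>A. - Im (\<mu> A)) f))"
    by (intro L1_functional_lincomb L1_functional_positive_part parts_le)
  then show ?thesis unfolding cintegral_def by simp
qed

lemma cintegral_indicator:
  assumes A: "A \<in> rc_borel"
  shows "cintegral \<mu> (indicator A) = \<mu> A"
proof -
  have int: "(\<integral>x. indicator A x \<partial>positive_part \<sigma>) = complex_of_real (measure (positive_part \<sigma>) A)" for \<sigma>
  proof -
    have "(\<integral>x. indicator A x \<partial>positive_part \<sigma>) = (\<integral>x. complex_of_real (indicator A x) \<partial>positive_part \<sigma>)"
      by (simp add: of_real_indicator)
    also have "\<dots> = complex_of_real (\<integral>x. indicator A x \<partial>positive_part \<sigma>)" by (rule integral_complex_of_real)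
    also have "(\<integral>x. indicator A x \<partial>positive_part \<sigma>) = measure (positive_part \<sigma>) A"
      using rc_borel_sets[OF A] sets_eq_imp_space_eq[OF sets_positive_part[of \<sigma>]] by simp
    finally show ?thesis .
  qed
  note fin = le_less_trans[OF parts_le(1)[OF rc_borel_sets[OF A]] tv_finite[OF \<mu> A]]
    le_less_trans[OF parts_le(2)[OF rc_borel_sets[OF A]] tv_finite[OF \<mu> A]]
    le_less_trans[OF parts_le(3)[OF rc_borel_sets[OF A]] tv_finite[OF \<mu> A]]
    le_less_trans[OF parts_le(4)[OF rc_borel_sets[OF A]] tv_finite[OF \<mu> A]]
  have "measure (positive_part (\<lambda>A. Re (\<mu> A))) A - measure (positive_part (\<lambda>A. - Re (\<mu> A))) A = Re (\<mu> A)"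
    by (rule measure_positive_part_diff[OF _ _ A fin(1,2)])
      (use parts_sums(1) complex_radon_Diff[OF \<mu>] in simp_all)
  moreover have "measure (positive_part (\<lambda>A. Im (\<mu> A))) A - measure (positive_part (\<lambda>A. - Im (\<mu> A))) A = Im (\<mu> A)"
    by (rule measure_positive_part_diff[OF _ _ A fin(3,4)])
      (use parts_sums(3) complex_radon_Diff[OF \<mu>] in simp_all)
  ultimately show ?thesis
    unfolding cintegral_def int by (simp add: complex_eq_iff)
qed

end

text \<open>
  This is the device by which new complex measures are built and integrated. Countable additivity is
  dominated convergence; the variation and the inner regularity are inherited from \<open>\<rho>\<close> because
  \<open>|\<Phi>(1\<^sub>B)| \<le> C \<rho>(B)\<close>; and the integral agrees with \<open>\<Phi>\<close> by density of indicators.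
\<close>

theorem complex_radon_of_functional:
  fixes \<rho> :: "'a::topological_space measure"
  assumes \<rho>: "rc_regular \<rho>" and \<Phi>: "L1_functional \<rho> \<Phi>"
  defines "\<mu> \<equiv> \<lambda>A. if A \<in> rc_borel then \<Phi> (indicator A) else 0"
  shows "complex_radon_measure \<mu>"
    and "\<exists>C>0. \<forall>A\<in>sets borel. emeasure (total_variation \<mu>) A \<le> ennreal C * emeasure \<rho> A"
    and "\<And>f :: 'a \<Rightarrow> complex. integrable \<rho> f \<Longrightarrow> integrable (total_variation \<mu>) f"
    and "\<And>f. integrable \<rho> f \<Longrightarrow> cintegral \<mu> f = \<Phi> f"
proof -
  have \<rho>s: "sets \<rho> = sets borel" "space \<rho> = UNIV"
    using \<rho> sets_eq_imp_space_eq[of \<rho> borel] by (auto simp: rc_regular_def)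
  obtain C where C: "C > 0" "\<And>f. integrable \<rho> f \<Longrightarrow> norm (\<Phi> f) \<le> C * (\<integral>x. norm (f x) \<partial>\<rho>)"
    using L1_functional_bound[OF \<Phi>] by blast
  note ind = rc_regular_integrable_indicator[OF \<rho>]
  have add: "(\<lambda>n. \<mu> (A n)) sums \<mu> (\<Union>n. A n)"
    if A: "range A \<subseteq> rc_borel" "disjoint_family A" "(\<Union>n. A n) \<in> rc_borel" for A :: "nat \<Rightarrow> 'a set"
  proof -
    have Arc: "A n \<in> rc_borel" for n using A(1) by auto
    have "(\<lambda>n. \<Phi> (indicator (\<Union>i<n. A i))) \<longlonglongrightarrow> \<Phi> (indicator (\<Union>i. A i))"
    proof (rule L1_functional_tendsto[OF \<Phi>, where w = "indicator (\<Union>i. A i)"])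
      have "(\<Union>i<n. A i) \<in> rc_borel" for n using Arc by (intro rc_borel_finite_UN) auto
      then show "(indicator (\<Union>i<n. A i) :: 'a \<Rightarrow> complex) \<in> borel_measurable \<rho>" for n
        using borel_measurable_integrable[OF ind] by blast
      show "(indicator (\<Union>i. A i) :: 'a \<Rightarrow> complex) \<in> borel_measurable \<rho>"
        using borel_measurable_integrable[OF ind[OF A(3)]] .
      show "integrable \<rho> (indicator (\<Union>i. A i) :: 'a \<Rightarrow> real)"
        using A(3) \<rho> \<rho>s(1) rc_borel_sets[OF A(3)] by (intro integrable_real_indicator) (auto simp: rc_regular_def)
      show "AE x in \<rho>. (\<lambda>n. indicator (\<Union>i<n. A i) x) \<longlonglongrightarrow> (indicator (\<Union>i. A i) x :: complex)"
        by (intro AE_I2 LIMSEQ_indicator_UN)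
      show "AE x in \<rho>. norm (indicator (\<Union>i<n. A i) x :: complex) \<le> indicator (\<Union>i. A i) x" for n
        by (intro AE_I2) (auto simp: indicator_def)
    qed
    moreover have "\<Phi> (indicator (\<Union>i<n. A i)) = (\<Sum>i<n. \<mu> (A i))" for n
    proof -
      have dj: "disjoint_family_on A {..<n}" using A(2) by (rule disjoint_family_on_mono[rotated]) simp
      have "(indicator (\<Union>i<n. A i) :: 'a \<Rightarrow> complex) = (\<lambda>x. \<Sum>i<n. indicator (A i) x)"
        by (intro ext indicator_UN_disjoint[OF finite_lessThan dj])
      then have "\<Phi> (indicator (\<Union>i<n. A i)) = \<Phi> (\<lambda>x. \<Sum>i<n. indicator (A i) x)" by simp
      also have "\<dots> = (\<Sum>i<n. \<Phi> (indicator (A i)))"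
        using L1_functional_sum[OF \<Phi>, of "{..<n}" "\<lambda>i. indicator (A i)"] ind[OF Arc] by simp
      finally show ?thesis using Arc by (simp add: \<mu>_def)
    qed
    ultimately show ?thesis using A(3) by (simp add: sums_def \<mu>_def)
  qed
  have le: "ennreal (norm (\<mu> B)) \<le> ennreal C * emeasure \<rho> B" if B: "B \<in> rc_borel" for B
  proof -
    have "norm (\<mu> B) \<le> C * (\<integral>x. norm (indicator B x :: complex) \<partial>\<rho>)"
      using C(2)[OF ind[OF B]] B by (simp add: \<mu>_def)
    also have "(\<integral>x. norm (indicator B x :: complex) \<partial>\<rho>) = measure \<rho> B"
    proof -
      have "(\<integral>x. norm (indicator B x :: complex) \<partial>\<rho>) = (\<integral>x. indicator B x \<partial>\<rho>)"
        by (intro Bochner_Integration.integral_cong) (auto simp: indicator_def)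
      then show ?thesis using rc_borel_sets[OF B] \<rho>s by simp
    qed
    finally have "ennreal (norm (\<mu> B)) \<le> ennreal C * ennreal (measure \<rho> B)"
      using C(1) by (simp add: ennreal_mult[symmetric] ennreal_leI)
    also have "ennreal (measure \<rho> B) = emeasure \<rho> B"
      using \<rho> B by (intro emeasure_eq_ennreal_measure[symmetric]) (auto simp: rc_regular_def)
    finally show ?thesis .
  qed
  have tvle: "emeasure (total_variation \<mu>) A \<le> ennreal C * emeasure \<rho> A" if A: "A \<in> sets borel" for A
    by (rule total_variation_le[OF _ A \<rho>s(1) le]) (use add in auto)
  show \<mu>: "complex_radon_measure \<mu>"
    unfolding complex_radon_measure_def
  proof (intro conjI allI impI ballI)
    fix A :: "'a set" and e :: real assume A: "A \<in> rc_borel" and e: "0 < e"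
    obtain K where K: "compact K" "K \<subseteq> A" "emeasure \<rho> (A - K) < ennreal (e / C)"
      using \<rho> A e C(1) unfolding rc_regular_def by (meson divide_pos_pos)
    show "\<exists>K. compact K \<and> K \<subseteq> A \<and> emeasure (total_variation \<mu>) (A - K) < ennreal e"
    proof (cases "A - K \<in> sets borel")
      case True
      have "emeasure (total_variation \<mu>) (A - K) \<le> ennreal C * emeasure \<rho> (A - K)" by (rule tvle[OF True])
      also have "\<dots> < ennreal C * ennreal (e / C)"
        using K(3) C(1) by (intro ennreal_mult_strict_left_mono) auto
      also have "\<dots> = ennreal e" using C(1) e by (simp add: ennreal_mult[symmetric])
      finally show ?thesis using K by blast
    next
      case False
      then have "emeasure (total_variation \<mu>) (A - K) = 0" by (intro emeasure_notin_sets) simp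
      then show ?thesis using K(1,2) e by (intro exI[of _ K]) simp
    qed
  qed (use add in \<open>auto simp: \<mu>_def\<close>)
  show "\<exists>C>0. \<forall>A\<in>sets borel. emeasure (total_variation \<mu>) A \<le> ennreal C * emeasure \<rho> A"
    using C(1) tvle by blast
  have nnle: "(\<integral>\<^sup>+x. f x \<partial>total_variation \<mu>) \<le> ennreal C * (\<integral>\<^sup>+x. f x \<partial>\<rho>)" if "f \<in> borel_measurable \<rho>" for f :: "'a \<Rightarrow> ennreal"
  proof -
    have "total_variation \<mu> \<le> scale_measure (ennreal C) \<rho>"
      using \<rho>s tvle by (subst le_measure) (auto simp: emeasure_scale_measure)
    then have "(\<integral>\<^sup>+x. f x \<partial>total_variation \<mu>) \<le> (\<integral>\<^sup>+x. f x \<partial>scale_measure (ennreal C) \<rho>)"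
      using \<rho>s by (intro nn_integral_mono_measure) auto
    then show ?thesis using that by (simp add: nn_integral_scale_measure)
  qed
  have L: "L1_functional \<rho> (cintegral \<mu>)"
  proof (rule L1_functional_mono[OF cintegral_L1_functional[OF \<mu>], of _ C])
    fix f :: "'a \<Rightarrow> real" assume "f \<in> borel_measurable (total_variation \<mu>)"
    then have "f \<in> borel_measurable \<rho>"
      using measurable_cong_sets[OF trans[OF \<rho>s(1) sets_total_variation[symmetric]] refl] by blast
    then show "(\<integral>\<^sup>+x. norm (f x) \<partial>total_variation \<mu>) \<le> ennreal C * (\<integral>\<^sup>+x. norm (f x) \<partial>\<rho>)"
      by (intro nnle) auto
  qed (use \<rho>s C in auto)
  show int: "integrable (total_variation \<mu>) f" if f: "integrable \<rho> f" for f :: "'a \<Rightarrow> complex"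
  proof (rule integrableI_bounded)
    show "f \<in> borel_measurable (total_variation \<mu>)"
      using borel_measurable_integrable[OF f] measurable_cong_sets[OF trans[OF \<rho>s(1) sets_total_variation[symmetric]] refl] by blast
    have "(\<integral>\<^sup>+x. norm (f x) \<partial>\<rho>) < \<infinity>" using f by (simp add: integrable_iff_bounded)
    then have "ennreal C * (\<integral>\<^sup>+x. norm (f x) \<partial>\<rho>) < \<infinity>" by (simp add: ennreal_mult_less_top)
    moreover have "(\<lambda>x. ennreal (norm (f x))) \<in> borel_measurable \<rho>"
      using borel_measurable_integrable[OF f] by measurable
    ultimately show "(\<integral>\<^sup>+x. norm (f x) \<partial>total_variation \<mu>) < \<infinity>"
      using nnle by (meson le_less_trans)
  qed
  show "cintegral \<mu> f = \<Phi> f" if "integrable \<rho> f" for f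
  proof (rule L1_functional_eqI[OF \<rho>s(1) _ L \<Phi> _ that])
    show "rc_carried \<rho>" using \<rho> by (simp add: rc_regular_def)
    show "cintegral \<mu> (indicator A) = \<Phi> (indicator A)" if "A \<in> rc_borel" for A
      using cintegral_indicator[OF \<mu> that] that by (simp add: \<mu>_def)
  qed
qed

section \<open>Densities\<close>

lemma rc_regular_density:
  fixes g :: "'a::topological_space \<Rightarrow> complex"
  assumes \<rho>: "rc_regular \<rho>" and g: "g \<in> borel_measurable borel" and M: "\<And>x. norm (g x) \<le> M"
  shows "rc_regular (density \<rho> (\<lambda>x. ennreal (norm (g x))))"
proof -
  have \<rho>s: "sets \<rho> = sets borel" using \<rho> by (simp add: rc_regular_def)
  have gm: "(\<lambda>x. ennreal (norm (g x))) \<in> borel_measurable \<rho>"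
    using g by (simp add: measurable_cong_sets[OF \<rho>s refl])
  have "0 \<le> M" using M[of undefined] norm_ge_zero order_trans by blast
  have le: "emeasure (density \<rho> (\<lambda>x. ennreal (norm (g x)))) A \<le> ennreal (M + 1) * emeasure \<rho> A"
    if A: "A \<in> sets borel" for A
  proof -
    have "emeasure (density \<rho> (\<lambda>x. ennreal (norm (g x)))) A = (\<integral>\<^sup>+x. ennreal (norm (g x)) * indicator A x \<partial>\<rho>)"
      using A \<rho>s gm by (intro emeasure_density) auto
    also have "\<dots> \<le> (\<integral>\<^sup>+x. ennreal (M + 1) * indicator A x \<partial>\<rho>)"
    proof (intro nn_integral_mono mult_right_mono ennreal_leI)
      show "norm (g x) \<le> M + 1" for x using M[of x] by linarith
    qed simp
    also have "\<dots> = ennreal (M + 1) * emeasure \<rho> A"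
      using A \<rho>s by (intro nn_integral_cmult_indicator) auto
    finally show ?thesis .
  qed
  have M1: "M + 1 > 0" using \<open>0 \<le> M\<close> by linarith
  show ?thesis
    unfolding rc_regular_def
  proof (intro conjI ballI allI impI)
    fix A :: "'a set" assume A: "A \<in> rc_borel"
    then have fin: "emeasure \<rho> A < \<infinity>" using \<rho> by (simp add: rc_regular_def)
    then have "ennreal (M + 1) * emeasure \<rho> A < \<infinity>" by (simp add: ennreal_mult_less_top)
    with le[OF rc_borel_sets[OF A]]
    show "emeasure (density \<rho> (\<lambda>x. ennreal (norm (g x)))) A < \<infinity>" by (rule le_less_trans)
    fix e :: real assume e: "e > 0"
    have "e / (M + 1) > 0" using e M1 by simp
    then obtain K where K: "compact K" "K \<subseteq> A" "emeasure \<rho> (A - K) < ennreal (e / (M + 1))"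
      using \<rho> A unfolding rc_regular_def by blast
    show "\<exists>K. compact K \<and> K \<subseteq> A \<and> emeasure (density \<rho> (\<lambda>x. ennreal (norm (g x)))) (A - K) < ennreal e"
    proof (cases "A - K \<in> sets borel")
      case True
      have "emeasure (density \<rho> (\<lambda>x. ennreal (norm (g x)))) (A - K) \<le> ennreal (M + 1) * emeasure \<rho> (A - K)"
        by (rule le[OF True])
      also have "\<dots> < ennreal (M + 1) * ennreal (e / (M + 1))"
        using K(3) M1 by (intro ennreal_mult_strict_left_mono) auto
      also have "\<dots> = ennreal e" using M1 e by (simp add: ennreal_mult[symmetric])
      finally show ?thesis using K by blast
    next
      case False
      then have "emeasure (density \<rho> (\<lambda>x. ennreal (norm (g x)))) (A - K) = 0"
        using \<rho>s by (intro emeasure_notin_sets) simp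
      then show ?thesis using K(1,2) e by (intro exI[of _ K]) simp
    qed
  next
    obtain E :: "nat \<Rightarrow> 'a set" where E: "range E \<subseteq> rc_borel" "emeasure \<rho> (- (\<Union>n. E n)) = 0"
      using \<rho> by (auto simp: rc_regular_def rc_carried_def)
    have "(\<Union>n. E n) \<in> sets borel"
      using E(1) rc_borel_sets by (intro sets.countable_UN) blast
    then have "- (\<Union>n. E n) \<in> sets borel" by (rule borel_comp)
    from le[OF this] E(2) have "emeasure (density \<rho> (\<lambda>x. ennreal (norm (g x)))) (- (\<Union>n. E n)) = 0" by simp
    with E(1) show "rc_carried (density \<rho> (\<lambda>x. ennreal (norm (g x))))"
      unfolding rc_carried_def by blast
  qed (use \<rho>s in simp)
qed

lemma
  fixes \<mu> :: "'a::topological_space cmeasure"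
  assumes \<mu>: "complex_radon_measure \<mu>" "rc_carried (total_variation \<mu>)"
    and g: "g \<in> borel_measurable borel" and M: "\<And>x. norm (g x) \<le> M"
  shows cdensity_radon: "complex_radon_measure (cdensity g \<mu>)"
    and tv_cdensity_le: "\<exists>C>0. \<forall>A\<in>sets borel. emeasure (total_variation (cdensity g \<mu>)) A
      \<le> ennreal C * (\<integral>\<^sup>+x. ennreal (norm (g x)) * indicator A x \<partial>total_variation \<mu>)"
    and cintegral_cdensity: "\<And>f. f \<in> borel_measurable borel \<Longrightarrow> integrable (total_variation \<mu>) (\<lambda>x. g x * f x)
      \<Longrightarrow> cintegral (cdensity g \<mu>) f = cintegral \<mu> (\<lambda>x. g x * f x)"
proof -
  let ?\<rho> = "density (total_variation \<mu>) (\<lambda>x. ennreal (norm (g x)))"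
  let ?\<Phi> = "\<lambda>f. cintegral \<mu> (\<lambda>x. g x * f x)"
  have g': "g \<in> borel_measurable (total_variation \<mu>)"
    using g by (simp add: measurable_cong_sets[OF sets_total_variation refl])
  have \<rho>: "rc_regular ?\<rho>" by (rule rc_regular_density[OF tv_rc_regular[OF \<mu>] g M])
  have \<Phi>: "L1_functional ?\<rho> ?\<Phi>"
    by (rule L1_functional_density[OF cintegral_L1_functional[OF \<mu>(1)] g'])
  have eq: "cdensity g \<mu> = (\<lambda>A. if A \<in> rc_borel then ?\<Phi> (indicator A) else 0)"
    by (intro ext) (simp add: cdensity_def mult.commute)
  note * = complex_radon_of_functional[OF \<rho> \<Phi>, folded eq]
  show "complex_radon_measure (cdensity g \<mu>)" by (rule *(1))
  show "\<exists>C>0. \<forall>A\<in>sets borel. emeasure (total_variation (cdensity g \<mu>)) A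
      \<le> ennreal C * (\<integral>\<^sup>+x. ennreal (norm (g x)) * indicator A x \<partial>total_variation \<mu>)"
    using *(2) g' by (simp add: emeasure_density)
  have int: "integrable ?\<rho> f" if f: "f \<in> borel_measurable borel" "integrable (total_variation \<mu>) (\<lambda>x. g x * f x)" for f :: "'a \<Rightarrow> complex"
  proof -
    have f': "f \<in> borel_measurable (total_variation \<mu>)"
      using f(1) by (simp add: measurable_cong_sets[OF sets_total_variation refl])
    have "integrable (total_variation \<mu>) (\<lambda>x. norm (g x) *\<^sub>R f x)"
      by (rule Bochner_Integration.integrable_bound[OF f(2)]) (use f' g' in \<open>auto simp: norm_mult\<close>)
    then show ?thesis using f' g' by (subst integrable_density) auto
  qed
  show "cintegral (cdensity g \<mu>) f = ?\<Phi> f"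
    if "f \<in> borel_measurable borel" "integrable (total_variation \<mu>) (\<lambda>x. g x * f x)" for f
    by (rule *(4)[OF int[OF that]])
qed

section \<open>Convolution of a pure point measure with a finite measure\<close>

lemma borel_measurable_translation:
  fixes f :: "'a::topological_ab_group_add \<Rightarrow> 'b::topological_space"
  assumes "f \<in> borel_measurable borel"
  shows "(\<lambda>y. f (x + y)) \<in> borel_measurable borel"
proof -
  have "(\<lambda>y. x + y) \<in> borel_measurable borel"
    by (intro borel_measurable_continuous_onI continuous_intros)
  from measurable_compose[OF this assms] show ?thesis .
qed

lemma rc_borel_translation:
  fixes A :: "'a::{topological_ab_group_add, t2_space} set"
  assumes A: "A \<in> rc_borel"
  shows "{y. x + y \<in> A} \<in> rc_borel"
proof -
  have "(\<lambda>y. x + y) -` A \<inter> space borel \<in> sets borel"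
    by (intro measurable_sets[of _ borel borel] borel_measurable_continuous_onI continuous_intros rc_borel_sets[OF A])
  then have s: "{y. x + y \<in> A} \<in> sets borel" by (simp add: vimage_def)
  have "compact ((\<lambda>y. - x + y) ` closure A)"
    using A by (intro compact_continuous_image continuous_intros) (simp add: rc_borel_def)
  then have c: "compact ((\<lambda>y. - x + y) ` closure A)" "closed ((\<lambda>y. - x + y) ` closure A)"
    by (simp_all add: compact_imp_closed)
  have "{y. x + y \<in> A} \<subseteq> (\<lambda>y. - x + y) ` closure A"
  proof
    fix y assume "y \<in> {y. x + y \<in> A}"
    then have "x + y \<in> closure A" using closure_subset by auto
    then have "- x + (x + y) \<in> (\<lambda>y. - x + y) ` closure A" by (rule imageI)
    then show "y \<in> (\<lambda>y. - x + y) ` closure A" by simp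
  qed
  then have "closure {y. x + y \<in> A} \<subseteq> (\<lambda>y. - x + y) ` closure A" using c(2) by (rule closure_minimal)
  then have "(\<lambda>y. - x + y) ` closure A \<inter> closure {y. x + y \<in> A} = closure {y. x + y \<in> A}" by blast
  then have "compact (closure {y. x + y \<in> A})"
    using compact_Int_closed[OF c(1) closed_closure[of "{y. x + y \<in> A}"]] by simp
  with s show ?thesis by (simp add: rc_borel_def)
qed

text \<open>
  The positive measure \<open>\<Sum>n. |c\<^sub>n| N(\<cdot> - x\<^sub>n)\<close>, which dominates the convolution of
  \<open>\<Sum>n. c\<^sub>n \<delta>(x\<^sub>n)\<close> with a measure of variation \<open>N\<close>. As an image of a product with counting measure it
  inherits its integration theory from Tonelli's theorem.
\<close>

definition translate_sum ::
  "(nat \<Rightarrow> complex) \<Rightarrow> (nat \<Rightarrow> 'a::topological_ab_group_add) \<Rightarrow> 'a measure \<Rightarrow> 'a measure" where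
  "translate_sum c x N = distr (density (count_space UNIV \<Otimes>\<^sub>M N) (\<lambda>p. ennreal (norm (c (fst p))))) borel
     (\<lambda>p. x (fst p) + snd p)"

lemma sets_translate_sum [simp]: "sets (translate_sum c x N) = sets borel"
  by (simp add: translate_sum_def)

lemma space_translate_sum [simp]: "space (translate_sum c x N) = UNIV"
  by (simp add: translate_sum_def)

context
  fixes c :: "nat \<Rightarrow> complex" and x :: "nat \<Rightarrow> 'a::{topological_ab_group_add, t2_space}" and N :: "'a measure"
  assumes N: "sets N = sets borel" "emeasure N UNIV < \<infinity>"
begin

private lemma translate_measurable: "(\<lambda>p. x (fst p) + snd p) \<in> count_space UNIV \<Otimes>\<^sub>M N \<rightarrow>\<^sub>M borel"
proof (rule measurable_pair_measure_countable1)
  fix n :: nat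
  have "(\<lambda>y. x n + y) \<in> borel_measurable borel"
    by (intro borel_measurable_continuous_onI continuous_intros)
  then show "(\<lambda>y. x (fst (n, y)) + snd (n, y)) \<in> N \<rightarrow>\<^sub>M borel"
    by (simp add: measurable_cong_sets[OF N(1) refl])
qed auto

private lemma sigma_finite_N: "sigma_finite_measure N"
proof -
  have "space N = UNIV" using sets_eq_imp_space_eq[OF N(1)] by simp
  then interpret finite_measure N using N(2) by (intro finite_measureI) auto
  show ?thesis ..
qed

lemma nn_integral_translate_sum:
  assumes f: "f \<in> borel_measurable borel"
  shows "(\<integral>\<^sup>+z. f z \<partial>translate_sum c x N) = (\<Sum>n. ennreal (norm (c n)) * (\<integral>\<^sup>+y. f (x n + y) \<partial>N))"
proof -
  interpret sigma_finite_measure N by (rule sigma_finite_N)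
  let ?P = "count_space UNIV \<Otimes>\<^sub>M N"
  have cm: "(\<lambda>p. ennreal (norm (c (fst p)))) \<in> borel_measurable ?P" by measurable
  have fm: "(\<lambda>p. f (x (fst p) + snd p)) \<in> borel_measurable ?P"
    by (rule measurable_compose[OF translate_measurable f])
  have "(\<integral>\<^sup>+z. f z \<partial>translate_sum c x N) =
      (\<integral>\<^sup>+p. ennreal (norm (c (fst p))) * f (x (fst p) + snd p) \<partial>?P)"
    unfolding translate_sum_def using cm fm f translate_measurable
    by (subst nn_integral_distr) (auto simp: nn_integral_density)
  also have "\<dots> = (\<integral>\<^sup>+n. \<integral>\<^sup>+y. ennreal (norm (c n)) * f (x n + y) \<partial>N \<partial>count_space UNIV)"
    using cm fm by (subst nn_integral_fst[symmetric]) auto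
  also have "\<dots> = (\<Sum>n. \<integral>\<^sup>+y. ennreal (norm (c n)) * f (x n + y) \<partial>N)"
    by (rule nn_integral_count_space_nat)
  also have "\<dots> = (\<Sum>n. ennreal (norm (c n)) * (\<integral>\<^sup>+y. f (x n + y) \<partial>N))"
    using borel_measurable_translation[OF f]
    by (intro suminf_cong nn_integral_cmult) (simp add: measurable_cong_sets[OF N(1) refl])
  finally show ?thesis .
qed

lemma emeasure_translate_sum:
  assumes A: "A \<in> sets borel"
  shows "emeasure (translate_sum c x N) A = (\<Sum>n. ennreal (norm (c n)) * emeasure N {y. x n + y \<in> A})"
proof -
  have "(\<lambda>y. x n + y) -` A \<inter> space borel \<in> sets borel" for n
    by (intro measurable_sets[of _ borel borel] borel_measurable_continuous_onI continuous_intros A)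
  then have s: "{y. x n + y \<in> A} \<in> sets N" for n using N by (simp add: vimage_def)
  have "emeasure (translate_sum c x N) A = (\<integral>\<^sup>+z. indicator A z \<partial>translate_sum c x N)"
    using A by simp
  also have "\<dots> = (\<Sum>n. ennreal (norm (c n)) * (\<integral>\<^sup>+y. indicator A (x n + y) \<partial>N))"
    using A by (intro nn_integral_translate_sum) simp
  also have "\<dots> = (\<Sum>n. ennreal (norm (c n)) * (\<integral>\<^sup>+y. indicator {y. x n + y \<in> A} y \<partial>N))"
    by (simp add: indicator_def)
  finally show ?thesis using s by simp
qed

lemma integrable_translate_sum:
  fixes f :: "'a \<Rightarrow> complex"
  assumes f: "integrable (translate_sum c x N) f"
  shows "c n \<noteq> 0 \<Longrightarrow> integrable N (\<lambda>y. f (x n + y))"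
    and "(\<lambda>n. norm (c n) * (\<integral>y. norm (f (x n + y)) \<partial>N)) sums (\<integral>z. norm (f z) \<partial>translate_sum c x N)"
proof -
  have fb: "f \<in> borel_measurable borel"
    using borel_measurable_integrable[OF f] by (simp add: translate_sum_def)
  then have fm: "(\<lambda>y. f (x n + y)) \<in> borel_measurable N" for n
    using borel_measurable_translation[OF fb] by (simp add: measurable_cong_sets[OF N(1) refl])
  have "ennreal (\<integral>z. norm (f z) \<partial>translate_sum c x N) = (\<integral>\<^sup>+z. norm (f z) \<partial>translate_sum c x N)"
    using f by (intro nn_integral_eq_integral[symmetric]) auto
  also have "\<dots> = (\<Sum>n. ennreal (norm (c n)) * (\<integral>\<^sup>+y. norm (f (x n + y)) \<partial>N))"
    using fb by (intro nn_integral_translate_sum) auto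
  finally have eq: "(\<Sum>n. ennreal (norm (c n)) * (\<integral>\<^sup>+y. norm (f (x n + y)) \<partial>N))
      = ennreal (\<integral>z. norm (f z) \<partial>translate_sum c x N)" ..
  show int: "integrable N (\<lambda>y. f (x n + y))" if "c n \<noteq> 0" for n
  proof (rule integrableI_bounded[OF fm])
    define b where "b n = ennreal (norm (c n)) * (\<integral>\<^sup>+y. norm (f (x n + y)) \<partial>N)" for n
    have "b n \<le> (\<Sum>n. b n)" using sum_le_suminf[of b "{n}"] by simp
    then have "ennreal (norm (c n)) * (\<integral>\<^sup>+y. norm (f (x n + y)) \<partial>N) \<le> (\<Sum>n. ennreal (norm (c n)) * (\<integral>\<^sup>+y. norm (f (x n + y)) \<partial>N))"
      unfolding b_def .
    then have "ennreal (norm (c n)) * (\<integral>\<^sup>+y. norm (f (x n + y)) \<partial>N) < \<infinity>"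
      unfolding eq by (rule le_less_trans) simp
    then show "(\<integral>\<^sup>+y. norm (f (x n + y)) \<partial>N) < \<infinity>" using that by (auto simp: ennreal_mult_less_top)
  qed
  define a where "a = (\<lambda>n. norm (c n) * (\<integral>y. norm (f (x n + y)) \<partial>N))"
  have "ennreal (norm (c n)) * (\<integral>\<^sup>+y. norm (f (x n + y)) \<partial>N) = ennreal (a n)" for n
  proof (cases "c n = 0")
    case False
    have "(\<integral>\<^sup>+y. norm (f (x n + y)) \<partial>N) = ennreal (\<integral>y. norm (f (x n + y)) \<partial>N)"
      using int[OF False] by (intro nn_integral_eq_integral) auto
    then show ?thesis by (simp add: ennreal_mult a_def)
  qed (simp add: a_def)
  then have a: "(\<Sum>n. ennreal (a n)) = ennreal (\<integral>z. norm (f z) \<partial>translate_sum c x N)"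
    using eq by (simp only:)
  have nn: "0 \<le> a n" for n by (simp add: a_def)
  have sm: "summable a" using a by (intro summable_suminf_not_top nn) simp
  have "ennreal (\<Sum>n. a n) = ennreal (\<integral>z. norm (f z) \<partial>translate_sum c x N)"
    using a by (subst suminf_ennreal2[of a, symmetric]) (simp_all add: nn sm)
  then have "(\<Sum>n. a n) = (\<integral>z. norm (f z) \<partial>translate_sum c x N)"
    by (subst (asm) ennreal_inj) (simp_all add: suminf_nonneg[OF sm nn])
  then have "a sums (\<integral>z. norm (f z) \<partial>translate_sum c x N)" using sm by (simp add: sums_iff)
  then show "(\<lambda>n. norm (c n) * (\<integral>y. norm (f (x n + y)) \<partial>N)) sums (\<integral>z. norm (f z) \<partial>translate_sum c x N)"
    by (simp only: a_def)
qed

end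

text \<open>
  The hypothesis says that \<open>\<Sum>n. |c\<^sub>n| \<delta>(x\<^sub>n)\<close> is translation bounded; integrated against the finite
  measure \<open>N\<close> it gives finiteness on relatively compact sets. For inner regularity, the tail of the series
  is negligible on \<open>A\<close>, and each of the remaining translates of \<open>A\<close> is approximated by a compact set.
\<close>

lemma rc_regular_translate_sum:
  fixes c :: "nat \<Rightarrow> complex" and x :: "nat \<Rightarrow> 'a::{topological_ab_group_add, t2_space}"
  assumes N: "rc_regular N" "emeasure N UNIV < \<infinity>"
    and bd: "\<And>A. A \<in> rc_borel \<Longrightarrow> \<exists>M. \<forall>y. (\<Sum>n. ennreal (norm (c n)) * indicator A (x n + y)) \<le> ennreal M"
  shows "rc_regular (translate_sum c x N)"
proof -
  have Ns: "sets N = sets borel" using N(1) by (simp add: rc_regular_def)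
  have Nsp: "space N = UNIV" using sets_eq_imp_space_eq[OF Ns] by simp
  interpret finite_measure N using N(2) Nsp by (intro finite_measureI) auto
  note em = emeasure_translate_sum[OF Ns N(2)] and nn = nn_integral_translate_sum[OF Ns N(2)]
  have fin: "emeasure (translate_sum c x N) A < \<infinity>" if A: "A \<in> rc_borel" for A
  proof -
    obtain M where M: "\<And>y. (\<Sum>n. ennreal (norm (c n)) * indicator A (x n + y)) \<le> ennreal M"
      using bd[OF A] by blast
    have im: "(\<lambda>y. indicator A (x n + y) :: ennreal) \<in> borel_measurable N" for n
      using borel_measurable_translation[of "indicator A :: 'a \<Rightarrow> ennreal"] rc_borel_sets[OF A]
      by (simp add: measurable_cong_sets[OF Ns refl])
    have "emeasure (translate_sum c x N) A = (\<integral>\<^sup>+z. indicator A z \<partial>translate_sum c x N)"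
      using rc_borel_sets[OF A] by simp
    also have "\<dots> = (\<Sum>n. ennreal (norm (c n)) * (\<integral>\<^sup>+y. indicator A (x n + y) \<partial>N))"
      using rc_borel_sets[OF A] by (intro nn) simp
    also have "\<dots> = (\<Sum>n. \<integral>\<^sup>+y. ennreal (norm (c n)) * indicator A (x n + y) \<partial>N)"
      using im by (simp add: nn_integral_cmult)
    also have "\<dots> = (\<integral>\<^sup>+y. (\<Sum>n. ennreal (norm (c n)) * indicator A (x n + y)) \<partial>N)"
      using im by (intro nn_integral_suminf[symmetric]) auto
    also have "\<dots> \<le> (\<integral>\<^sup>+y. ennreal M \<partial>N)" by (intro nn_integral_mono M)
    also have "\<dots> < \<infinity>" using N(2) Nsp by (simp add: ennreal_mult_less_top)
    finally show ?thesis .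
  qed
  show ?thesis
    unfolding rc_regular_def
  proof (intro conjI ballI allI impI)
    fix A :: "'a set" and e :: real assume A: "A \<in> rc_borel" and e: "e > 0"
    define T where "T B n = {y. x n + y \<in> B}" for B n
    have Trc: "T B n \<in> rc_borel" if "B \<in> rc_borel" for B n
      unfolding T_def by (rule rc_borel_translation[OF that])
    have em': "emeasure (translate_sum c x N) B = (\<Sum>n. ennreal (norm (c n) * measure N (T B n)))"
      if "B \<in> rc_borel" for B
      using em[OF rc_borel_sets[OF that]] by (simp add: T_def emeasure_eq_measure ennreal_mult)
    define a where "a n = norm (c n) * measure N (T A n)" for n
    have a0: "0 \<le> a n" for n by (simp add: a_def)
    have "summable a"
    proof (rule summable_suminf_not_top[OF a0])
      show "(\<Sum>n. ennreal (a n)) \<noteq> top" using em'[OF A] fin[OF A] by (simp add: a_def)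
    qed
    from suminf_exist_split[OF half_gt_zero[OF e] this]
    obtain k where k: "norm (\<Sum>i. a (i + k)) < e / 2" by blast
    \<comment> \<open>With this choice the first \<open>k\<close> terms contribute less than \<open>e / 2\<close>; the summand \<open>1\<close> avoids a division by \<open>0\<close>.\<close>
    define d where "d n = e / (2 * (real k + 1) * (norm (c n) + 1))" for n
    have d0: "d n > 0" for n unfolding d_def by (intro divide_pos_pos mult_pos_pos add_nonneg_pos e) simp_all
    have reg: "\<forall>A\<in>rc_borel. \<forall>e>0. \<exists>K. compact K \<and> K \<subseteq> A \<and> emeasure N (A - K) < ennreal e"
      using N(1) by (simp add: rc_regular_def)
    have "\<forall>n. \<exists>K. compact K \<and> K \<subseteq> T A n \<and> emeasure N (T A n - K) < ennreal (d n)"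
      by (intro allI mp[OF spec[OF bspec[OF reg Trc[OF A]]]] d0)
    from choice[OF this] obtain K where "\<forall>n. compact (K n) \<and> K n \<subseteq> T A n \<and> emeasure N (T A n - K n) < ennreal (d n)" ..
    then have K: "compact (K n)" "K n \<subseteq> T A n" "emeasure N (T A n - K n) < ennreal (d n)" for n by auto
    define L where "L = (\<Union>n<k. (\<lambda>y. x n + y) ` K n)"
    have "compact ((\<lambda>y. x n + y) ` K n)" for n
      using K(1) by (intro compact_continuous_image continuous_intros)
    then have L: "compact L" unfolding L_def by (intro compact_UN) auto
    have LA: "L \<subseteq> A" using K(2) by (auto simp: L_def T_def)
    have rc: "A - L \<in> rc_borel" by (intro rc_borel_Diff A rc_borel_sets compact_rc_borel L)
    define b where "b n = norm (c n) * measure N (T (A - L) n)" for n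
    have b0: "0 \<le> b n" for n by (simp add: b_def)
    have Ts: "T B n \<in> sets N" if "B \<in> rc_borel" for B n using rc_borel_sets[OF Trc[OF that]] Ns by simp
    have ba: "b n \<le> a n" for n
      unfolding a_def b_def
      using Ts[OF A] by (intro mult_left_mono finite_measure_mono) (auto simp: T_def)
    have sb: "summable b" by (rule summable_comparison_test'[OF \<open>summable a\<close>, of 0]) (use b0 ba in auto)
    have bk: "b n \<le> e / (2 * (real k + 1))" if "n < k" for n
    proof -
      have Kb: "K n \<in> sets N" using rc_borel_sets[OF compact_rc_borel[OF K(1)]] Ns by simp
      have "T (A - L) n \<subseteq> T A n - K n" using that by (auto simp: T_def L_def)
      then have "measure N (T (A - L) n) \<le> measure N (T A n - K n)"
        using Ts[OF A] Kb by (intro finite_measure_mono) auto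
      also have "\<dots> < d n" using K(3)[of n] d0[of n] by (simp add: emeasure_eq_measure ennreal_less_iff)
      finally have "b n \<le> norm (c n) * d n" unfolding b_def by (intro mult_left_mono) auto
      also have "\<dots> \<le> (norm (c n) + 1) * d n" using d0[of n] by (intro mult_right_mono) auto
      also have "\<dots> = e / (2 * (real k + 1))"
      proof -
        have "norm (c n) + 1 \<noteq> 0" using norm_ge_zero[of "c n"] by linarith
        then show ?thesis by (simp add: d_def)
      qed
      finally show ?thesis .
    qed
    have "(\<Sum>n. b n) = (\<Sum>n. b (n + k)) + (\<Sum>n<k. b n)" by (rule suminf_split_initial_segment[OF sb])
    moreover have "(\<Sum>n. b (n + k)) \<le> (\<Sum>n. a (n + k))"
      by (intro suminf_le ba summable_ignore_initial_segment sb \<open>summable a\<close>)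
    moreover have "(\<Sum>n. a (n + k)) < e / 2" using k by simp
    moreover have "(\<Sum>n<k. b n) \<le> e / 2"
    proof -
      have "(\<Sum>n<k. b n) \<le> (\<Sum>n<k. e / (2 * (real k + 1)))" using bk by (intro sum_mono) auto
      also have "\<dots> = real k / (real k + 1) * (e / 2)" by simp
      also have "\<dots> \<le> 1 * (e / 2)" using e by (intro mult_right_mono) auto
      finally show ?thesis by simp
    qed
    ultimately have "(\<Sum>n. b n) < e" by linarith
    then have "ennreal (\<Sum>n. b n) < ennreal e" by (rule ennreal_lessI[OF e])
    moreover have "(\<Sum>n. ennreal (b n)) = ennreal (\<Sum>n. b n)"
      by (intro suminf_ennreal2 b0 sb)
    moreover have "emeasure (translate_sum c x N) (A - L) = (\<Sum>n. ennreal (b n))"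
      unfolding b_def by (rule em'[OF rc])
    ultimately have "emeasure (translate_sum c x N) (A - L) < ennreal e" by simp
    then show "\<exists>K. compact K \<and> K \<subseteq> A \<and> emeasure (translate_sum c x N) (A - K) < ennreal e"
      using L LA by blast
  next
    obtain E :: "nat \<Rightarrow> 'a set" where E: "range E \<subseteq> rc_borel" "emeasure N (- (\<Union>n. E n)) = 0"
      using N(1) by (auto simp: rc_regular_def rc_carried_def)
    define F where "F p = (\<lambda>(n, k). {z. - x n + z \<in> E k}) p" for p
    have Frc: "F p \<in> rc_borel" for p
    proof -
      have "E (snd p) \<in> rc_borel" using E(1) by auto
      from rc_borel_translation[OF this] show ?thesis by (simp only: F_def case_prod_unfold)
    qed
    have UE: "(\<Union>n. E n) \<in> sets borel" using E(1) rc_borel_sets by (intro sets.countable_UN) blast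
    have UF: "(\<Union>p. F p) \<in> sets borel" by (intro sets.countable_UN'[OF countableI_type] image_subsetI rc_borel_sets Frc)
    have "emeasure N {y. x n + y \<in> - (\<Union>p. F p)} = 0" for n
    proof -
      have "{y. x n + y \<in> - (\<Union>p. F p)} \<subseteq> - (\<Union>n. E n)"
      proof (intro subsetI ComplI, elim UN_E)
        fix y k assume y: "y \<in> {y. x n + y \<in> - (\<Union>p. F p)}" and "y \<in> E k"
        then have "x n + y \<in> F (n, k)" by (simp add: F_def)
        then show False using y by blast
      qed
      then have "emeasure N {y. x n + y \<in> - (\<Union>p. F p)} \<le> emeasure N (- (\<Union>n. E n))"
        using borel_comp[OF UE] Ns by (intro emeasure_mono) simp_all
      then show ?thesis using E(2) by simp
    qed
    then have "emeasure (translate_sum c x N) (- (\<Union>p. F p)) = 0"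
      using em[OF borel_comp[OF UF]] by simp
    then show "rc_carried (translate_sum c x N)"
      using Frc by (intro rc_carried_countable[of "range F"]) auto
  qed (use fin in simp_all)
qed

lemma norm_suminf_le_sums:
  fixes f :: "nat \<Rightarrow> 'a::banach"
  assumes "\<And>n. norm (f n) \<le> g n" "g sums s"
  shows "norm (suminf f) \<le> s"
proof -
  have sn: "summable (\<lambda>n. norm (f n))"
    by (rule summable_comparison_test'[OF sums_summable[OF assms(2)], of 0]) (use assms(1) in auto)
  have "norm (suminf f) \<le> (\<Sum>n. norm (f n))" by (rule summable_norm[OF sn])
  also have "\<dots> \<le> suminf g" by (rule suminf_le[OF assms(1) sn sums_summable[OF assms(2)]])
  finally show ?thesis using assms(2) by (simp add: sums_iff)
qed

lemma L1_functional_translate_sum: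
  fixes c :: "nat \<Rightarrow> complex" and x :: "nat \<Rightarrow> 'a::{topological_ab_group_add, t2_space}"
  assumes N: "sets N = sets borel" "emeasure N UNIV < \<infinity>" and \<Phi>: "L1_functional N \<Phi>"
  shows "L1_functional (translate_sum c x N) (\<lambda>f. \<Sum>n. c n * \<Phi> (\<lambda>y. f (x n + y)))"
    and "\<And>f. integrable (translate_sum c x N) f \<Longrightarrow> summable (\<lambda>n. c n * \<Phi> (\<lambda>y. f (x n + y)))"
proof -
  obtain C where C: "C > 0" "\<And>f. integrable N f \<Longrightarrow> norm (\<Phi> f) \<le> C * (\<integral>x. norm (f x) \<partial>N)"
    using L1_functional_bound[OF \<Phi>] by blast
  note int = integrable_translate_sum[OF N]
  \<comment> \<open>If \<open>c n = 0\<close>, then \<open>f\<close> need not be integrable along the translate by \<open>x n\<close>.\<close>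
  have bd: "norm (c n * \<Phi> (\<lambda>y. f (x n + y))) \<le> C * (norm (c n) * (\<integral>y. norm (f (x n + y)) \<partial>N))"
    if "integrable (translate_sum c x N) f" for f :: "'a \<Rightarrow> complex" and n
  proof (cases "c n = 0")
    case False
    then show ?thesis
      using mult_left_mono[OF C(2)[OF int(1)[OF that False]], of "norm (c n)"] by (simp add: norm_mult mult_ac)
  qed simp
  have sums: "(\<lambda>n. C * (norm (c n) * (\<integral>y. norm (f (x n + y)) \<partial>N))) sums (C * (\<integral>z. norm (f z) \<partial>translate_sum c x N))"
    if "integrable (translate_sum c x N) f" for f :: "'a \<Rightarrow> complex"
    by (rule sums_mult[OF int(2)[OF that]])
  show sm: "summable (\<lambda>n. c n * \<Phi> (\<lambda>y. f (x n + y)))" if "integrable (translate_sum c x N) f" for f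
    by (rule summable_comparison_test'[OF sums_summable[OF sums[OF that]] bd[OF that]])
  show "L1_functional (translate_sum c x N) (\<lambda>f. \<Sum>n. c n * \<Phi> (\<lambda>y. f (x n + y)))"
    unfolding L1_functional_def
  proof (intro conjI allI impI exI[of _ C])
    fix f g :: "'a \<Rightarrow> complex" and s :: complex
    assume f: "integrable (translate_sum c x N) f"
    have *: "c n * \<Phi> (\<lambda>y. s * f (x n + y)) = s * (c n * \<Phi> (\<lambda>y. f (x n + y)))" for n
      using L1_functional_cmult[OF \<Phi> int(1)[OF f], of n s] by (cases "c n = 0") auto
    show "(\<Sum>n. c n * \<Phi> (\<lambda>y. s * f (x n + y))) = s * (\<Sum>n. c n * \<Phi> (\<lambda>y. f (x n + y)))"
      unfolding * by (rule suminf_mult[OF sm[OF f]])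
    show "norm (\<Sum>n. c n * \<Phi> (\<lambda>y. f (x n + y))) \<le> C * (\<integral>z. norm (f z) \<partial>translate_sum c x N)"
      by (rule norm_suminf_le_sums[OF bd[OF f] sums[OF f]])
    assume g: "integrable (translate_sum c x N) g"
    have *: "c n * \<Phi> (\<lambda>y. f (x n + y) + g (x n + y)) = c n * \<Phi> (\<lambda>y. f (x n + y)) + c n * \<Phi> (\<lambda>y. g (x n + y))" for n
      using L1_functional_add[OF \<Phi> int(1)[OF f] int(1)[OF g], of n n] by (cases "c n = 0") (simp_all add: distrib_left)
    show "(\<Sum>n. c n * \<Phi> (\<lambda>y. f (x n + y) + g (x n + y)))
      = (\<Sum>n. c n * \<Phi> (\<lambda>y. f (x n + y))) + (\<Sum>n. c n * \<Phi> (\<lambda>y. g (x n + y)))"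
      unfolding * by (rule suminf_add[OF sm[OF f] sm[OF g], symmetric])
  qed (use C(1) in simp)
qed

text \<open>
  Since \<open>\<mu>\<close> is the sum of the point masses \<open>c\<^sub>n\<close> at \<open>x\<^sub>n\<close>, the inner integral in the definition of the
  convolution is a series in the outer variable. The partial sums of this series are uniformly bounded
  by translation boundedness, so it may be integrated term by term. Pure pointness also yields the
  measurability of the inner integral, for which a product \<open>\<sigma>\<close>-algebra could be too small.
\<close>

lemma
  fixes \<mu> \<nu> :: "'a::{topological_ab_group_add, t2_space} cmeasure"
  assumes \<mu>: "complex_radon_measure \<mu>" and \<nu>: "finite_complex_measure \<nu>"
    and pp: "\<And>A. A \<in> rc_borel \<Longrightarrow> (\<lambda>n. c n * indicator A (x n)) sums \<mu> A"
    and bd: "\<And>A. A \<in> rc_borel \<Longrightarrow> \<exists>M. \<forall>y. (\<Sum>n. ennreal (norm (c n)) * indicator A (x n + y)) \<le> ennreal M"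
  shows cconvolution_radon: "complex_radon_measure (cconvolution \<mu> \<nu>)"
    and cconvolution_integrable: "\<And>f :: 'a \<Rightarrow> complex. integrable (translate_sum c x (total_variation \<nu>)) f \<Longrightarrow>
      integrable (total_variation (cconvolution \<mu> \<nu>)) f"
    and cconvolution_cintegral: "\<And>f. integrable (translate_sum c x (total_variation \<nu>)) f \<Longrightarrow>
      (\<lambda>n. c n * cintegral \<nu> (\<lambda>y. f (x n + y))) sums cintegral (cconvolution \<mu> \<nu>) f"
proof -
  let ?N = "total_variation \<nu>"
  let ?\<rho> = "translate_sum c x ?N"
  let ?\<Phi> = "\<lambda>f. \<Sum>n. c n * cintegral \<nu> (\<lambda>y. f (x n + y))"
  have \<nu>r: "complex_radon_measure \<nu>" and fin: "emeasure ?N UNIV < \<infinity>"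
    using \<nu> by (auto simp: finite_complex_measure_def)
  have "rc_carried ?N" using fin by (intro tv_carried[OF \<nu>r, of "{UNIV}"]) auto
  then have N: "rc_regular ?N" by (rule tv_rc_regular[OF \<nu>r])
  have \<rho>: "rc_regular ?\<rho>" using N fin bd by (rule rc_regular_translate_sum)
  note L\<nu> = cintegral_L1_functional[OF \<nu>r]
  note \<Phi> = L1_functional_translate_sum[OF sets_total_variation fin L\<nu>, of c x]
  have eq: "cconvolution \<mu> \<nu> = (\<lambda>A. if A \<in> rc_borel then ?\<Phi> (indicator A) else 0)"
  proof
    fix A
    show "cconvolution \<mu> \<nu> A = (if A \<in> rc_borel then ?\<Phi> (indicator A) else 0)"
    proof (cases "A \<in> rc_borel")
      case A: True
      define g where "g n y = (c n * indicator A (x n + y) :: complex)" for n y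
      have ind: "(\<lambda>z. indicator A (z + y) :: complex) = indicator {z. y + z \<in> A}" for y
        by (simp add: indicator_def fun_eq_iff add.commute)
      have inner: "(\<lambda>n. g n y) sums cintegral \<mu> (\<lambda>z. indicator A (z + y))" for y
      proof -
        have "(\<lambda>n. c n * indicator {z. y + z \<in> A} (x n)) sums \<mu> {z. y + z \<in> A}"
          by (rule pp[OF rc_borel_translation[OF A]])
        then show ?thesis
          unfolding ind cintegral_indicator[OF \<mu> rc_borel_translation[OF A]]
          by (simp add: indicator_def add.commute g_def)
      qed
      obtain M where M: "\<And>y. (\<Sum>n. ennreal (norm (c n)) * indicator A (x n + y)) \<le> ennreal M"
        using bd[OF A] by blast
      have partial: "norm (\<Sum>i<n. g i y) \<le> max 0 M" for n y
      proof -
        have t: "ennreal (norm (g i y)) = ennreal (norm (c i)) * indicator A (x i + y)" for i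
          by (simp add: g_def norm_mult indicator_def)
        have "ennreal (\<Sum>i<n. norm (g i y)) = (\<Sum>i<n. ennreal (norm (g i y)))" by simp
        also have "\<dots> \<le> (\<Sum>n. ennreal (norm (c n)) * indicator A (x n + y))"
          unfolding t by (intro sum_le_suminf) auto
        also have "\<dots> \<le> ennreal (max 0 M)" using order_trans[OF M ennreal_leI] by simp
        finally have "(\<Sum>i<n. norm (g i y)) \<le> max 0 M" by (subst (asm) ennreal_le_iff) auto
        with norm_sum show ?thesis by (rule order_trans)
      qed
      have gm: "g n \<in> borel_measurable ?N" for n
        using borel_measurable_translation[of "indicator A :: 'a \<Rightarrow> complex" "x n"] rc_borel_sets[OF A]
        unfolding g_def by (simp add: measurable_cong_sets[OF sets_total_variation refl])
      have gi: "integrable ?N (\<lambda>y. indicator A (x n + y) :: complex)" for n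
      proof (rule integrableI_bounded_set[of UNIV _ _ 1])
        show "(\<lambda>y. indicator A (x n + y) :: complex) \<in> borel_measurable ?N"
          using borel_measurable_translation[of "indicator A :: 'a \<Rightarrow> complex" "x n"] rc_borel_sets[OF A]
          by (simp add: measurable_cong_sets[OF sets_total_variation refl])
      qed (use fin in \<open>auto simp: indicator_def\<close>)
      have "(\<lambda>n. cintegral \<nu> (\<lambda>y. \<Sum>i<n. g i y)) \<longlonglongrightarrow> cintegral \<nu> (\<lambda>y. cintegral \<mu> (\<lambda>z. indicator A (z + y)))"
      proof (rule L1_functional_tendsto[OF L\<nu>, where w = "\<lambda>_. max 0 M"])
        show "(\<lambda>y. cintegral \<mu> (\<lambda>z. indicator A (z + y))) \<in> borel_measurable ?N"
          by (rule borel_measurable_LIMSEQ_metric[of "\<lambda>n y. \<Sum>i<n. g i y"])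
            (use gm inner in \<open>auto simp: sums_def\<close>)
        have "finite_measure ?N" using fin by (intro finite_measureI) auto
        then show "integrable ?N (\<lambda>_. max 0 M)" by (rule finite_measure.integrable_const)
      qed (use gm inner partial in \<open>auto simp: sums_def\<close>)
      moreover have "cintegral \<nu> (\<lambda>y. \<Sum>i<n. g i y) = (\<Sum>i<n. c i * cintegral \<nu> (\<lambda>y. indicator A (x i + y)))" for n
        unfolding g_def using gi
        by (subst L1_functional_sum[OF L\<nu>]) (auto simp: L1_functional_cmult[OF L\<nu>])
      ultimately have "(\<lambda>n. c n * cintegral \<nu> (\<lambda>y. indicator A (x n + y))) sums
          cintegral \<nu> (\<lambda>y. cintegral \<mu> (\<lambda>z. indicator A (z + y)))"
        by (simp add: sums_def)
      then show ?thesis using A by (simp add: cconvolution_def sums_iff)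
    qed (simp add: cconvolution_def)
  qed
  note * = complex_radon_of_functional[OF \<rho> \<Phi>(1), folded eq]
  show "complex_radon_measure (cconvolution \<mu> \<nu>)" by (rule *(1))
  show "integrable (total_variation (cconvolution \<mu> \<nu>)) f"
    "(\<lambda>n. c n * cintegral \<nu> (\<lambda>y. f (x n + y))) sums cintegral (cconvolution \<mu> \<nu>) f"
    if "integrable ?\<rho> f" for f :: "'a \<Rightarrow> complex"
    using *(3,4)[OF that] \<Phi>(2)[OF that] by (auto simp: sums_iff)
qed

section \<open>Functions of compact support and their convolutions\<close>

lemma C_cI:
  fixes \<phi> :: "'a::t2_space \<Rightarrow> complex"
  assumes "continuous_on UNIV \<phi>" "compact K" "\<And>x. x \<notin> K \<Longrightarrow> \<phi> x = 0"
  shows "\<phi> \<in> C_c"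
proof -
  have "fsupp \<phi> \<subseteq> K"
    unfolding fsupp_def using assms(2,3) by (intro closure_minimal compact_imp_closed) auto
  then have "K \<inter> fsupp \<phi> = fsupp \<phi>" by blast
  moreover have "compact (K \<inter> fsupp \<phi>)"
    using assms(2) by (intro compact_Int_closed) (simp_all add: fsupp_def)
  ultimately show ?thesis using assms(1) by (simp add: C_c_def)
qed

lemma C_c_continuous: "\<phi> \<in> C_c \<Longrightarrow> continuous_on UNIV \<phi>"
  by (simp add: C_c_def)

lemma C_c_compact: "\<phi> \<in> C_c \<Longrightarrow> compact (fsupp \<phi>)"
  by (simp add: C_c_def)

lemma notin_fsupp: "x \<notin> fsupp \<phi> \<Longrightarrow> \<phi> x = 0"
  unfolding fsupp_def using closure_subset by force

lemma C_c_borel: "\<phi> \<in> C_c \<Longrightarrow> \<phi> \<in> borel_measurable borel"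
  by (intro borel_measurable_continuous_onI C_c_continuous)

lemma C_c_bounded:
  assumes "\<phi> \<in> C_c"
  shows "\<exists>M\<ge>0. \<forall>x. norm (\<phi> x) \<le> M"
proof -
  have "compact (\<phi> ` fsupp \<phi>)"
    using continuous_on_subset[OF C_c_continuous[OF assms]] C_c_compact[OF assms]
    by (intro compact_continuous_image) auto
  then obtain M where M: "\<And>x. x \<in> fsupp \<phi> \<Longrightarrow> norm (\<phi> x) \<le> M"
    using compact_imp_bounded bounded_iff by (metis imageI)
  have "norm (\<phi> x) \<le> max 0 M" for x
    using M[of x] notin_fsupp[of x \<phi>] by (cases "x \<in> fsupp \<phi>") auto
  then show ?thesis by (intro exI[of _ "max 0 M"]) auto
qed

lemma C_c_integrable:
  fixes \<phi> :: "'a::t2_space \<Rightarrow> complex"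
  assumes "\<phi> \<in> C_c" "sets N = sets borel" "\<And>K. compact K \<Longrightarrow> emeasure N K < \<infinity>"
  shows "integrable N \<phi>"
proof -
  obtain M where M: "\<And>x. norm (\<phi> x) \<le> M" using C_c_bounded[OF assms(1)] by blast
  show ?thesis
  proof (rule integrableI_bounded_set[of "fsupp \<phi>" _ _ M])
    show "fsupp \<phi> \<in> sets N" using assms(2) by (simp add: fsupp_def)
    show "\<phi> \<in> borel_measurable N"
      using C_c_borel[OF assms(1)] by (simp add: measurable_cong_sets[OF assms(2) refl])
    show "emeasure N (fsupp \<phi>) < \<infinity>" by (rule assms(3)[OF C_c_compact[OF assms(1)]])
    show "AE x in N. x \<in> fsupp \<phi> \<longrightarrow> norm (\<phi> x) \<le> M" using M by simp
    show "AE x in N. x \<notin> fsupp \<phi> \<longrightarrow> \<phi> x = 0" by (simp add: notin_fsupp)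
  qed
qed

lemma C_c_integrable_tv:
  fixes \<phi> :: "'a::t2_space \<Rightarrow> complex"
  assumes "\<phi> \<in> C_c" "complex_radon_measure \<mu>"
  shows "integrable (total_variation \<mu>) \<phi>"
  by (rule C_c_integrable[OF assms(1) sets_total_variation tv_finite[OF assms(2) compact_rc_borel]])

lemma C_c_mult:
  fixes \<phi> :: "'a::t2_space \<Rightarrow> complex"
  assumes "\<phi> \<in> C_c" "continuous_on UNIV f"
  shows "(\<lambda>x. f x * \<phi> x) \<in> C_c"
proof (rule C_cI[OF _ C_c_compact[OF assms(1)]])
  show "continuous_on UNIV (\<lambda>x. f x * \<phi> x)"
    by (rule continuous_on_mult[OF assms(2) C_c_continuous[OF assms(1)]])
  show "f x * \<phi> x = 0" if "x \<notin> fsupp \<phi>" for x using notin_fsupp[OF that] by simp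
qed

lemma C_c_add:
  fixes \<phi> :: "'a::t2_space \<Rightarrow> complex"
  assumes "\<phi> \<in> C_c" "\<psi> \<in> C_c"
  shows "(\<lambda>x. \<phi> x + \<psi> x) \<in> C_c"
proof (rule C_cI[OF _ compact_Un[OF C_c_compact[OF assms(1)] C_c_compact[OF assms(2)]]])
  show "continuous_on UNIV (\<lambda>x. \<phi> x + \<psi> x)"
    by (rule continuous_on_add[OF C_c_continuous[OF assms(1)] C_c_continuous[OF assms(2)]])
  show "\<phi> x + \<psi> x = 0" if "x \<notin> fsupp \<phi> \<union> fsupp \<psi>" for x
    using that notin_fsupp[of x \<phi>] notin_fsupp[of x \<psi>] by simp
qed

lemma C_c_cmult: "\<phi> \<in> C_c \<Longrightarrow> (\<lambda>x. c * \<phi> x) \<in> C_c" for \<phi> :: "'a::t2_space \<Rightarrow> complex"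
  by (rule C_c_mult) simp_all

lemma C_c_translate:
  fixes \<phi> :: "'a::{topological_ab_group_add, t2_space} \<Rightarrow> complex"
  assumes "\<phi> \<in> C_c"
  shows "(\<lambda>x. \<phi> (x - a)) \<in> C_c"
proof (rule C_cI)
  show "continuous_on UNIV (\<lambda>x. \<phi> (x - a))"
    by (rule continuous_on_compose2[OF C_c_continuous[OF assms]]) (auto intro: continuous_intros)
  show "compact ((\<lambda>x. x + a) ` fsupp \<phi>)"
    by (intro compact_continuous_image C_c_compact assms continuous_intros)
  show "\<phi> (x - a) = 0" if "x \<notin> (\<lambda>x. x + a) ` fsupp \<phi>" for x
  proof -
    have "x - a \<notin> fsupp \<phi>"
    proof
      assume "x - a \<in> fsupp \<phi>"
      then have "x - a + a \<in> (\<lambda>x. x + a) ` fsupp \<phi>" by (rule imageI)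
      then show False using that by simp
    qed
    then show ?thesis by (rule notin_fsupp)
  qed
qed

lemma haar_sets: "haar_measure m \<Longrightarrow> sets m = sets borel"
  by (simp add: haar_measure_def)

lemma haar_compact: "haar_measure m \<Longrightarrow> compact K \<Longrightarrow> emeasure m K < \<infinity>"
  by (simp add: haar_measure_def)

lemma C_c_integrable_haar: "\<phi> \<in> C_c \<Longrightarrow> haar_measure m \<Longrightarrow> integrable m \<phi>"
  for \<phi> :: "'a::{topological_ab_group_add, t2_space} \<Rightarrow> complex"
  by (rule C_c_integrable[OF _ haar_sets haar_compact])

lemma haar_integral_translate:
  fixes f :: "'a::topological_ab_group_add \<Rightarrow> complex"
  assumes m: "haar_measure m" and f: "f \<in> borel_measurable borel"
  shows "(\<integral>y. f (a + y) \<partial>m) = (\<integral>y. f y \<partial>m)"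
proof -
  note s = haar_sets[OF m]
  have "(\<lambda>y. a + y) \<in> borel_measurable borel"
    by (intro borel_measurable_continuous_onI continuous_intros)
  then have am: "(\<lambda>y. a + y) \<in> m \<rightarrow>\<^sub>M borel" by (simp add: measurable_cong_sets[OF s refl])
  have sp: "space m = UNIV" using sets_eq_imp_space_eq[OF s] by simp
  have "distr m borel (\<lambda>y. a + y) = m"
  proof (rule measure_eqI)
    fix A assume "A \<in> sets (distr m borel (\<lambda>y. a + y))"
    then have A: "A \<in> sets borel" by simp
    have "(\<lambda>y. a + y) -` A = (+) (- a) ` A"
    proof
      show "(\<lambda>y. a + y) -` A \<subseteq> (+) (- a) ` A"
      proof
        fix y assume "y \<in> (\<lambda>y. a + y) -` A"
        then have "- a + (a + y) \<in> (+) (- a) ` A" by (intro imageI) simp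
        then show "y \<in> (+) (- a) ` A" by simp
      qed
    qed auto
    then have "emeasure (distr m borel (\<lambda>y. a + y)) A = emeasure m ((+) (- a) ` A)"
      using A am sp by (simp add: emeasure_distr)
    also have "\<dots> = emeasure m A" using m A unfolding haar_measure_def by blast
    finally show "emeasure (distr m borel (\<lambda>y. a + y)) A = emeasure m A" .
  qed (use s in simp)
  then show ?thesis using integral_distr[OF am f] by simp
qed

lemma char_apply_zero [simp]: "char_apply \<xi> 0 = 1"
proof -
  have "char_apply \<xi> 0 * char_apply \<xi> 0 = char_apply \<xi> 0 * 1"
    using char_apply_add[of \<xi> 0 0] by simp
  then show ?thesis by (subst (asm) mult_cancel_left) simp
qed

lemma cnj_char_apply: "cnj (char_apply \<xi> x) = char_apply \<xi> (- x)"
proof -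
  have "char_apply \<xi> x * char_apply \<xi> (- x) = 1"
    using char_apply_add[of \<xi> x "- x"] by simp
  moreover have "char_apply \<xi> x * cnj (char_apply \<xi> x) = 1"
    using complex_norm_square[of "char_apply \<xi> x"] by simp
  ultimately have "char_apply \<xi> x * cnj (char_apply \<xi> x) = char_apply \<xi> x * char_apply \<xi> (- x)" by simp
  then show ?thesis by (subst (asm) mult_cancel_left) simp
qed

text \<open>
  \<open>correlation m \<phi> \<psi>\<close> is \<open>\<phi> * \<psi>~\<close>. It is linear in \<open>\<phi>\<close> and conjugate linear in \<open>\<psi>\<close>.
\<close>

abbreviation correlation ::
  "'a::ab_group_add measure \<Rightarrow> ('a \<Rightarrow> complex) \<Rightarrow> ('a \<Rightarrow> complex) \<Rightarrow> 'a \<Rightarrow> complex" where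
  "correlation m \<phi> \<psi> \<equiv> fconvolution m \<phi> (tilde \<psi>)"

lemma correlation_eq: "correlation m \<phi> \<psi> x = (\<integral>y. \<phi> y * cnj (\<psi> (y - x)) \<partial>m)"
  by (simp add: fconvolution_def tilde_def)

lemma correlation_integrand:
  fixes \<phi> \<psi> :: "'a::{topological_ab_group_add, t2_space} \<Rightarrow> complex"
  assumes "\<phi> \<in> C_c" "\<psi> \<in> C_c"
  shows "(\<lambda>y. \<phi> y * cnj (\<psi> (y - x))) \<in> C_c"
proof -
  have "continuous_on UNIV (\<lambda>y. cnj (\<psi> (y - x)))"
    by (intro continuous_on_cnj C_c_continuous C_c_translate assms)
  from C_c_mult[OF assms(1) this] show ?thesis by (simp add: mult.commute)
qed

text \<open>
  Continuity follows by dominated convergence along sequences, which suffices in a first countable group.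
\<close>

lemma correlation_C_c:
  fixes \<phi> \<psi> :: "'a::{topological_ab_group_add, t2_space, first_countable_topology} \<Rightarrow> complex"
  assumes m: "haar_measure m" and \<phi>: "\<phi> \<in> C_c" and \<psi>: "\<psi> \<in> C_c"
  shows "correlation m \<phi> \<psi> \<in> C_c"
proof (rule C_cI)
  obtain M where M: "M \<ge> 0" "\<And>x. norm (\<psi> x) \<le> M" using C_c_bounded[OF \<psi>] by blast
  show "continuous_on UNIV (correlation m \<phi> \<psi>)"
  proof (rule continuous_on_sequentiallyI)
    fix u :: "nat \<Rightarrow> 'a" and a assume u: "u \<longlonglongrightarrow> a"
    show "(\<lambda>n. correlation m \<phi> \<psi> (u n)) \<longlonglongrightarrow> correlation m \<phi> \<psi> a"
      unfolding correlation_eq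
    proof (rule integral_dominated_convergence[where w = "\<lambda>y. M * norm (\<phi> y)"])
      have "integrable m (\<lambda>y. \<phi> y * cnj (\<psi> (y - x)))" for x
        by (intro C_c_integrable_haar m correlation_integrand \<phi> \<psi>)
      then show "(\<lambda>y. \<phi> y * cnj (\<psi> (y - a))) \<in> borel_measurable m"
        "(\<lambda>y. \<phi> y * cnj (\<psi> (y - u n))) \<in> borel_measurable m" for n by auto
      show "integrable m (\<lambda>y. M * norm (\<phi> y))" using C_c_integrable_haar[OF \<phi> m] by simp
      show "AE y in m. norm (\<phi> y * cnj (\<psi> (y - u n))) \<le> M * norm (\<phi> y)" for n
        using mult_right_mono[OF M(2) norm_ge_zero] by (intro AE_I2) (simp add: norm_mult mult.commute)
      have "(\<lambda>n. \<psi> (y - u n)) \<longlonglongrightarrow> \<psi> (y - a)" for y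
      proof -
        have "isCont \<psi> (y - a)"
          using C_c_continuous[OF \<psi>] by (simp add: continuous_on_eq_continuous_at)
        moreover have "(\<lambda>n. y - u n) \<longlonglongrightarrow> y - a" by (intro tendsto_intros u)
        ultimately show ?thesis by (rule isCont_tendsto_compose)
      qed
      then show "AE y in m. (\<lambda>n. \<phi> y * cnj (\<psi> (y - u n))) \<longlonglongrightarrow> \<phi> y * cnj (\<psi> (y - a))"
        by (intro AE_I2 tendsto_intros)
    qed
  qed
  have "compact (fsupp \<phi> \<times> fsupp \<psi>)" by (intro compact_Times C_c_compact \<phi> \<psi>)
  then show "compact ((\<lambda>p. fst p - snd p) ` (fsupp \<phi> \<times> fsupp \<psi>))"
    by (intro compact_continuous_image continuous_intros)
  fix x assume x: "x \<notin> (\<lambda>p. fst p - snd p) ` (fsupp \<phi> \<times> fsupp \<psi>)"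
  have 0: "\<phi> y * cnj (\<psi> (y - x)) = 0" for y
  proof (rule ccontr)
    assume "\<not> ?thesis"
    then have "(y, y - x) \<in> fsupp \<phi> \<times> fsupp \<psi>" using notin_fsupp by fastforce
    then have "fst (y, y - x) - snd (y, y - x) \<in> (\<lambda>p. fst p - snd p) ` (fsupp \<phi> \<times> fsupp \<psi>)" by (rule imageI)
    then show False using x by simp
  qed
  show "correlation m \<phi> \<psi> x = 0" unfolding correlation_eq 0 by simp
qed

lemma correlation_add_left:
  fixes x :: "'a::{topological_ab_group_add, t2_space}"
  assumes "haar_measure m" "\<phi> \<in> C_c" "\<phi>' \<in> C_c" "\<psi> \<in> C_c"
  shows "correlation m (\<lambda>x. \<phi> x + \<phi>' x) \<psi> x = correlation m \<phi> \<psi> x + correlation m \<phi>' \<psi> x"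
  unfolding correlation_eq distrib_right
  by (intro Bochner_Integration.integral_add C_c_integrable_haar correlation_integrand assms)

lemma correlation_add_right:
  fixes x :: "'a::{topological_ab_group_add, t2_space}"
  assumes "haar_measure m" "\<phi> \<in> C_c" "\<psi> \<in> C_c" "\<psi>' \<in> C_c"
  shows "correlation m \<phi> (\<lambda>x. \<psi> x + \<psi>' x) x = correlation m \<phi> \<psi> x + correlation m \<phi> \<psi>' x"
  unfolding correlation_eq complex_cnj_add distrib_left
  by (intro Bochner_Integration.integral_add C_c_integrable_haar correlation_integrand assms)

lemma correlation_cmult:
  "correlation m (\<lambda>x. c * \<phi> x) \<psi> x = c * correlation m \<phi> \<psi> x"
  "correlation m \<phi> (\<lambda>x. c * \<psi> x) x = cnj c * correlation m \<phi> \<psi> x"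
  by (simp_all add: correlation_eq mult.assoc mult.left_commute[of _ "cnj c"])

lemma correlation_character:
  "correlation m (\<lambda>x. char_apply \<eta> x * \<phi> x) (\<lambda>x. char_apply \<eta> x * \<psi> x) x
    = char_apply \<eta> x * correlation m \<phi> \<psi> x"
proof -
  have "char_apply \<eta> y * cnj (char_apply \<eta> (y - x)) = char_apply \<eta> x" for y
    by (simp add: cnj_char_apply char_apply_add[symmetric])
  then have *: "char_apply \<eta> y * \<phi> y * cnj (char_apply \<eta> (y - x) * \<psi> (y - x))
      = char_apply \<eta> x * (\<phi> y * cnj (\<psi> (y - x)))" for y
    by (simp add: mult_ac)
  show ?thesis unfolding correlation_eq * by simp
qed

lemma correlation_translate:
  fixes \<phi> \<psi> :: "'a::{topological_ab_group_add, t2_space} \<Rightarrow> complex"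
  assumes m: "haar_measure m" and "\<phi> \<in> C_c" "\<psi> \<in> C_c"
  shows "correlation m (\<lambda>x. \<phi> (x - a)) \<psi> x = correlation m \<phi> \<psi> (x - a)"
proof -
  have "(\<integral>y. \<phi> (y - a) * cnj (\<psi> (y - x)) \<partial>m) = (\<integral>y. \<phi> (a + y - a) * cnj (\<psi> (a + y - x)) \<partial>m)"
    by (rule haar_integral_translate[OF m, symmetric])
      (intro C_c_borel correlation_integrand C_c_translate assms)
  then show ?thesis by (simp add: correlation_eq algebra_simps)
qed

section \<open>The Fourier transform of functions\<close>

lemma fcheck_integrand:
  fixes \<phi> :: "'a::{topological_ab_group_add, t2_space} \<Rightarrow> complex"
  assumes "\<phi> \<in> C_c" "haar_measure m"
  shows "integrable m (\<lambda>x. char_apply \<xi> x * \<phi> x)"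
  by (intro C_c_integrable_haar C_c_mult assms char_apply_continuous)

lemma fcheck_add:
  fixes \<phi> \<psi> :: "'a::{topological_ab_group_add, t2_space} \<Rightarrow> complex"
  assumes "\<phi> \<in> C_c" "\<psi> \<in> C_c" "haar_measure m"
  shows "fcheck m (\<lambda>x. \<phi> x + \<psi> x) \<xi> = fcheck m \<phi> \<xi> + fcheck m \<psi> \<xi>"
  unfolding fcheck_def distrib_left by (intro Bochner_Integration.integral_add fcheck_integrand assms)

lemma fcheck_cmult: "fcheck m (\<lambda>x. c * \<phi> x) \<xi> = c * fcheck m \<phi> \<xi>"
  by (simp add: fcheck_def mult.left_commute[of _ c])

lemma fcheck_character: "fcheck m (\<lambda>x. char_apply \<eta> x * \<phi> x) \<xi> = fcheck m \<phi> (\<eta> + \<xi>)"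
  by (simp add: fcheck_def plus_character.rep_eq mult_ac)

lemma fcheck_translate:
  fixes \<phi> :: "'a::{topological_ab_group_add, t2_space} \<Rightarrow> complex"
  assumes "\<phi> \<in> C_c" "haar_measure m"
  shows "fcheck m (\<lambda>x. \<phi> (x - a)) \<xi> = char_apply \<xi> a * fcheck m \<phi> \<xi>"
proof -
  have "fcheck m (\<lambda>x. \<phi> (x - a)) \<xi> = (\<integral>x. char_apply \<xi> (a + x) * \<phi> (a + x - a) \<partial>m)"
    unfolding fcheck_def
    by (rule haar_integral_translate[OF assms(2), symmetric])
      (intro C_c_borel C_c_mult C_c_translate assms char_apply_continuous)
  then show ?thesis by (simp add: fcheck_def char_apply_add mult.assoc)
qed

lemma norm_fcheck_le:
  fixes \<phi> :: "'a::{topological_ab_group_add, t2_space} \<Rightarrow> complex"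
  shows "norm (fcheck m \<phi> \<xi>) \<le> (\<integral>x. norm (\<phi> x) \<partial>m)"
  unfolding fcheck_def by (rule order_trans[OF integral_norm_bound]) (simp add: norm_mult)

lemma fcheck_continuous:
  fixes \<phi> :: "'a::{topological_ab_group_add, t2_space} \<Rightarrow> complex"
  assumes \<phi>: "\<phi> \<in> C_c" and m: "haar_measure m"
  shows "continuous_on UNIV (fcheck m \<phi>)"
  unfolding continuous_on_def
proof (intro ballI)
  fix \<xi> :: "'a character"
  have int: "integrable m (\<lambda>x. norm (\<phi> x))" using C_c_integrable_haar[OF \<phi> m] by simp
  define I where "I = (\<integral>x. norm (\<phi> x) \<partial>m)"
  have I: "I \<ge> 0" by (simp add: I_def)
  show "(fcheck m \<phi> \<longlongrightarrow> fcheck m \<phi> \<xi>) (at \<xi> within UNIV)"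
  proof (rule tendstoI)
    fix e :: real assume e: "e > 0"
    have d: "e / (I + 1) > 0" using e I by simp
    have "\<forall>\<^sub>F \<psi> in nhds \<xi>. \<psi> \<in> char_nbhd \<xi> (fsupp \<phi>) (e / (I + 1))"
      by (rule eventually_nhds_char_nbhd[OF C_c_compact[OF \<phi>] d])
    then have "\<forall>\<^sub>F \<psi> in at \<xi>. \<psi> \<in> char_nbhd \<xi> (fsupp \<phi>) (e / (I + 1))"
      unfolding eventually_at_filter by (rule eventually_mono) simp
    then show "\<forall>\<^sub>F \<psi> in at \<xi>. dist (fcheck m \<phi> \<psi>) (fcheck m \<phi> \<xi>) < e"
    proof eventually_elim
      case (elim \<psi>)
      have le: "norm (char_apply \<psi> x * \<phi> x - char_apply \<xi> x * \<phi> x) \<le> e / (I + 1) * norm (\<phi> x)" for x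
      proof (cases "x \<in> fsupp \<phi>")
        case True
        then have "norm (char_apply \<psi> x - char_apply \<xi> x) \<le> e / (I + 1)"
          using elim by (auto simp: char_nbhd_def dist_norm intro: less_imp_le)
        then show ?thesis
          by (metis left_diff_distrib mult_right_mono norm_ge_zero norm_mult)
      qed (simp add: notin_fsupp)
      have "dist (fcheck m \<phi> \<psi>) (fcheck m \<phi> \<xi>) = norm (\<integral>x. char_apply \<psi> x * \<phi> x - char_apply \<xi> x * \<phi> x \<partial>m)"
        unfolding dist_norm fcheck_def
        by (subst Bochner_Integration.integral_diff) (auto intro: fcheck_integrand \<phi> m)
      also have "\<dots> \<le> (\<integral>x. e / (I + 1) * norm (\<phi> x) \<partial>m)"
      proof (rule order_trans[OF integral_norm_bound integral_mono])
        show "integrable m (\<lambda>x. norm (char_apply \<psi> x * \<phi> x - char_apply \<xi> x * \<phi> x))"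
          by (intro integrable_norm Bochner_Integration.integrable_diff fcheck_integrand \<phi> m)
        show "integrable m (\<lambda>x. e / (I + 1) * norm (\<phi> x))" using int by simp
      qed (rule le)
      also have "\<dots> = e / (I + 1) * I" by (simp add: I_def)
      also have "\<dots> < e" using e I by (simp add: field_simps)
      finally show ?case .
    qed
  qed
qed

section \<open>Fourier transforms of measures\<close>

text \<open>
  Translates of a null open set cover the group, and by second countability countably many of them do.
\<close>

lemma haar_open_pos:
  fixes m :: "'a::{topological_ab_group_add, t2_space, second_countable_topology} measure"
  assumes m: "haar_measure m" and U: "open U" "U \<noteq> {}"
  shows "emeasure m U \<noteq> 0"
proof
  assume 0: "emeasure m U = 0"
  obtain u where u: "u \<in> U" using U(2) by blast
  define V where "V a = (\<lambda>x. x - a) -` U" for a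
  have V: "open (V a)" for a
    unfolding V_def by (intro open_vimage U(1) continuous_intros)
  have V0: "emeasure m (V a) = 0" for a
  proof -
    have "V a = (+) a ` U"
    proof
      show "V a \<subseteq> (+) a ` U"
      proof
        fix x assume "x \<in> V a"
        then have "a + (x - a) \<in> (+) a ` U" by (intro imageI) (simp add: V_def)
        then show "x \<in> (+) a ` U" by simp
      qed
    qed (auto simp: V_def)
    moreover have "emeasure m ((+) a ` U) = emeasure m U"
      using m borel_open[OF U(1)] unfolding haar_measure_def by blast
    ultimately show ?thesis using 0 by simp
  qed
  have cover: "(\<Union>a. V a) = UNIV"
  proof -
    have "x \<in> V (x - u)" for x using u by (simp add: V_def)
    then show ?thesis by blast
  qed
  obtain \<F> where F: "\<F> \<subseteq> range V" "countable \<F>" "\<Union>\<F> = \<Union>(range V)"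
    using Lindelof[of "range V"] V by blast
  have "\<Union>\<F> \<in> null_sets m"
  proof (rule null_sets_UN'[of \<F> "\<lambda>A. A", simplified])
    show "countable \<F>" by (rule F(2))
    show "A \<in> null_sets m" if "A \<in> \<F>" for A
      using that F(1) V V0 haar_sets[OF m] by (intro null_setsI) auto
  qed
  then have "emeasure m UNIV = 0" using F(3) cover by (simp add: null_setsD1)
  then show False using m by (simp add: haar_measure_def)
qed

lemma C_c_bump:
  fixes U :: "'a::{topological_ab_group_add, t2_space} set"
  assumes lc: "locally_compact_space (euclidean :: 'a topology)" and U: "open U" "0 \<in> U"
  shows "\<exists>f :: 'a \<Rightarrow> real. continuous_on UNIV f \<and> (\<forall>x. 0 \<le> f x) \<and> f 0 > 0 \<and>
    (\<lambda>x. complex_of_real (f x)) \<in> C_c \<and> (\<forall>x. x \<notin> U \<longrightarrow> f x = 0)"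
proof -
  have cr: "completely_regular_space (euclidean :: 'a topology)"
  proof (rule locally_compact_regular_imp_completely_regular_space[OF lc disjI1])
    show "Hausdorff_space (euclidean :: 'a topology)"
      unfolding Hausdorff_space_def disjnt_def using hausdorff by (metis open_openin)
  qed
  obtain V K :: "'a set" where V: "open V" "compact K" "0 \<in> V" "V \<subseteq> K"
  proof -
    have "\<forall>x::'a. \<exists>V K. open V \<and> compact K \<and> x \<in> V \<and> V \<subseteq> K"
      using lc unfolding locally_compact_space_def by simp
    then show thesis using that by blast
  qed
  let ?W = "U \<inter> V"
  have "closedin euclidean (- ?W)" "0 \<in> topspace euclidean - (- ?W)"
    using U V by (auto intro: open_Int)
  then obtain f :: "'a \<Rightarrow> real" where f: "continuous_map euclidean (top_of_set {0..1}) f" "f 0 = 0" "f ` (- ?W) \<subseteq> {1}"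
    using cr unfolding completely_regular_space_def by blast
  have fc: "continuous_on UNIV f" and f01: "f x \<in> {0..1}" for x
    using f(1) by (auto simp: continuous_map_in_subtopology)
  have out: "1 - f x = 0" if "x \<notin> ?W" for x using f(3) that by auto
  have "(\<lambda>x. complex_of_real (1 - f x)) \<in> C_c"
  proof (rule C_cI[OF _ V(2)])
    show "continuous_on UNIV (\<lambda>x. complex_of_real (1 - f x))"
      by (intro continuous_intros fc)
    show "complex_of_real (1 - f x) = 0" if "x \<notin> K" for x using out[of x] that V(4) by auto
  qed
  then show ?thesis
    using fc f01 f(2) out by (intro exI[of _ "\<lambda>x. 1 - f x"]) (auto intro!: continuous_intros)
qed

lemma fcheck_bump_nonzero:
  fixes m :: "'a::{topological_ab_group_add, t2_space, second_countable_topology} measure"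
  assumes m: "haar_measure m" and f: "continuous_on UNIV f" "\<And>x. 0 \<le> f x" "f 0 > 0"
    "(\<lambda>x. complex_of_real (f x)) \<in> C_c"
    and \<xi>: "\<And>x. f x \<noteq> 0 \<Longrightarrow> Re (char_apply \<xi> x) > 1 / 2"
  shows "fcheck m (\<lambda>x. complex_of_real (f x)) \<xi> \<noteq> 0"
proof
  assume 0: "fcheck m (\<lambda>x. complex_of_real (f x)) \<xi> = 0"
  have "integrable m (\<lambda>x. Re (complex_of_real (f x)))"
    by (rule integrable_Re[OF C_c_integrable_haar[OF f(4) m]])
  then have fi: "integrable m f" by simp
  have int: "integrable m (\<lambda>x. char_apply \<xi> x * complex_of_real (f x))"
    by (rule fcheck_integrand[OF f(4) m])
  have "(\<integral>x. f x / 2 \<partial>m) \<le> (\<integral>x. Re (char_apply \<xi> x * complex_of_real (f x)) \<partial>m)"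
  proof (rule integral_mono)
    show "integrable m (\<lambda>x. Re (char_apply \<xi> x * complex_of_real (f x)))" by (rule integrable_Re[OF int])
    show "f x / 2 \<le> Re (char_apply \<xi> x * complex_of_real (f x))" for x
    proof (cases "f x = 0")
      case False
      then have "1 / 2 * f x \<le> Re (char_apply \<xi> x) * f x"
        using \<xi>[OF False] f(2)[of x] by (intro mult_right_mono) auto
      then show ?thesis by simp
    qed simp
  qed (use fi in simp)
  also have "\<dots> = Re (fcheck m (\<lambda>x. complex_of_real (f x)) \<xi>)"
    unfolding fcheck_def by (rule integral_Re[OF int])
  finally have le: "(\<integral>x. f x \<partial>m) \<le> 0" using 0 by simp
  then have "(\<integral>x. f x \<partial>m) = 0" using f(2) by (intro antisym Bochner_Integration.integral_nonneg) auto
  then have "AE x in m. f x = 0"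
    using integral_nonneg_eq_0_iff_AE[OF fi] f(2) by simp
  moreover have "{x. f x \<noteq> 0} \<in> sets m"
  proof -
    have "open {x. f x \<noteq> 0}" using f(1) by (intro open_Collect_neq) auto
    then show ?thesis using haar_sets[OF m] by simp
  qed
  moreover have "space m = UNIV" using sets_eq_imp_space_eq[OF haar_sets[OF m]] by simp
  ultimately have "emeasure m {x. f x \<noteq> 0} = 0" by (subst (asm) AE_iff_measurable) auto
  moreover have "open {x. f x \<noteq> 0}" using f(1) by (intro open_Collect_neq) auto
  moreover have "0 \<in> {x. f x \<noteq> 0}" using f(3) by simp
  ultimately show False using haar_open_pos[OF m] by blast
qed

text \<open>
  Bump functions supported in smaller and smaller neighbourhoods of \<open>0\<close>: a given character has real part
  above \<open>1/2\<close> on one of these neighbourhoods, and there the integral of the character against the bump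
  function has positive real part.
\<close>

lemma fcheck_nonvanishing:
  fixes m :: "'a::{topological_ab_group_add, t2_space, second_countable_topology} measure"
  assumes lc: "locally_compact_space (euclidean :: 'a topology)" and m: "haar_measure m"
  shows "\<exists>\<phi> :: nat \<Rightarrow> 'a \<Rightarrow> complex. (\<forall>n. \<phi> n \<in> C_c) \<and> (\<forall>\<xi>. \<exists>n. fcheck m (\<phi> n) \<xi> \<noteq> 0)"
proof -
  obtain A :: "nat \<Rightarrow> 'a set" where A: "\<And>i. open (A i)" "\<And>i. 0 \<in> A i"
    "\<And>S. open S \<Longrightarrow> 0 \<in> S \<Longrightarrow> eventually (\<lambda>i. A i \<subseteq> S) sequentially"
    using countable_basis_at_decseq[of "0::'a"] by blast
  have "\<forall>n. \<exists>f :: 'a \<Rightarrow> real. continuous_on UNIV f \<and> (\<forall>x. 0 \<le> f x) \<and> f 0 > 0 \<and>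
    (\<lambda>x. complex_of_real (f x)) \<in> C_c \<and> (\<forall>x. x \<notin> A n \<longrightarrow> f x = 0)"
    by (intro allI C_c_bump[OF lc A(1,2)])
  from choice[OF this] obtain f :: "nat \<Rightarrow> 'a \<Rightarrow> real" where
    "\<forall>n. continuous_on UNIV (f n) \<and> (\<forall>x. 0 \<le> f n x) \<and> f n 0 > 0 \<and>
    (\<lambda>x. complex_of_real (f n x)) \<in> C_c \<and> (\<forall>x. x \<notin> A n \<longrightarrow> f n x = 0)" ..
  then have f: "continuous_on UNIV (f n)" "0 \<le> f n x" "f n 0 > 0" "(\<lambda>x. complex_of_real (f n x)) \<in> C_c"
    "x \<notin> A n \<Longrightarrow> f n x = 0" for n x
    by auto
  have "\<exists>n. fcheck m (\<lambda>x. complex_of_real (f n x)) \<xi> \<noteq> 0" for \<xi>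
  proof -
    let ?S = "{x. Re (char_apply \<xi> x) > 1 / 2}"
    have "open ?S" by (intro open_Collect_less continuous_intros char_apply_continuous)
    moreover have "0 \<in> ?S" by simp
    ultimately obtain n where n: "A n \<subseteq> ?S"
      using A(3)[of ?S] unfolding eventually_sequentially by blast
    have "fcheck m (\<lambda>x. complex_of_real (f n x)) \<xi> \<noteq> 0"
      by (rule fcheck_bump_nonzero[OF m f(1,2,3,4)]) (use f(5)[of _ n] n in blast)
    then show ?thesis ..
  qed
  with f(4) show ?thesis by (intro exI[of _ "\<lambda>n x. complex_of_real (f n x)"]) blast
qed

lemma has_fourier_transformD:
  assumes "has_fourier_transform m \<gamma> \<gamma>h"
  shows "complex_radon_measure \<gamma>" "complex_radon_measure \<gamma>h"
    "\<And>\<phi>. \<phi> \<in> C_c \<Longrightarrow> square_integrable (total_variation \<gamma>h) (fcheck m \<phi>)"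
    "\<And>\<phi>. \<phi> \<in> C_c \<Longrightarrow> cintegral \<gamma> (correlation m \<phi> \<phi>) =
        cintegral \<gamma>h (\<lambda>\<xi>. complex_of_real ((norm (fcheck m \<phi> \<xi>))\<^sup>2))"
  using assms by (auto simp: has_fourier_transform_def)

lemma fcheck_borel:
  fixes \<phi> :: "'a::{topological_ab_group_add, t2_space} \<Rightarrow> complex"
  assumes "\<phi> \<in> C_c" "haar_measure m"
  shows "fcheck m \<phi> \<in> borel_measurable borel"
  by (rule borel_measurable_continuous_onI[OF fcheck_continuous[OF assms]])

text \<open>
  The dual group is covered by the countably many sets \<open>{|\<phi>\<^sub>n\<^sup>\<and>|\<^sup>2 \<ge> 1/k}\<close> for a sequence of transforms
  \<open>\<phi>\<^sub>n\<^sup>\<and>\<close> without common zero, and each of them has finite variation since \<open>\<phi>\<^sub>n\<^sup>\<and>\<close> is square integrable.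
\<close>

lemma fourier_transform_carried:
  fixes m :: "'a::{topological_ab_group_add, t2_space, second_countable_topology} measure"
  assumes lc: "locally_compact_space (euclidean :: 'a topology)" and m: "haar_measure m"
    and ft: "has_fourier_transform m \<gamma> \<gamma>h"
  shows "rc_carried (total_variation \<gamma>h)"
proof -
  let ?t = "total_variation \<gamma>h"
  note ft = has_fourier_transformD[OF ft]
  obtain \<phi> :: "nat \<Rightarrow> 'a \<Rightarrow> complex" where \<phi>: "\<And>n. \<phi> n \<in> C_c" "\<And>\<xi>. \<exists>n. fcheck m (\<phi> n) \<xi> \<noteq> 0"
    using fcheck_nonvanishing[OF lc m] by blast
  define D where "D p = {\<xi>. inverse (real (Suc (snd p))) \<le> (norm (fcheck m (\<phi> (fst p)) \<xi>))\<^sup>2}" for p :: "nat \<times> nat"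
  have cont: "continuous_on UNIV (\<lambda>\<xi>. (norm (fcheck m (\<phi> n) \<xi>))\<^sup>2)" for n
    by (intro continuous_intros fcheck_continuous \<phi> m)
  have Dm: "D p \<in> sets borel" for p
    unfolding D_def by (intro borel_closed closed_Collect_le cont continuous_intros)
  have Dfin: "emeasure ?t (D p) < \<infinity>" for p
  proof -
    let ?f = "\<lambda>\<xi>. (norm (fcheck m (\<phi> (fst p)) \<xi>))\<^sup>2"
    have int: "integrable ?t ?f" using ft(3)[OF \<phi>(1)] by (simp add: square_integrable_def)
    have "emeasure ?t {\<xi> \<in> space ?t. inverse (real (Suc (snd p))) \<le> ?f \<xi>} < \<infinity>"
    proof -
      have c: "0 < inverse (real (Suc (snd p)))" by simp
      have "(\<integral>\<^sup>+\<xi>. ennreal (?f \<xi>) \<partial>?t) < \<infinity>" using int by (simp add: integrable_iff_bounded)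
      moreover have "ennreal (inverse (real (Suc (snd p)))) * emeasure ?t (D p) \<le> (\<integral>\<^sup>+\<xi>. ennreal (?f \<xi>) \<partial>?t)"
      proof -
        have "ennreal (inverse (real (Suc (snd p)))) * emeasure ?t (D p)
            = (\<integral>\<^sup>+\<xi>. ennreal (inverse (real (Suc (snd p)))) * indicator (D p) \<xi> \<partial>?t)"
          using Dm by (intro nn_integral_cmult_indicator[symmetric]) simp
        also have "\<dots> \<le> (\<integral>\<^sup>+\<xi>. ennreal (?f \<xi>) \<partial>?t)"
          by (intro nn_integral_mono) (auto simp: indicator_def D_def intro!: ennreal_leI)
        finally show ?thesis .
      qed
      ultimately have "ennreal (inverse (real (Suc (snd p)))) * emeasure ?t (D p) < \<infinity>" by (rule le_less_trans[rotated])
      moreover have "E < \<infinity>" if "ennreal c * E < \<infinity>" "0 < c" for c E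
        using that by (auto simp: ennreal_mult_less_top)
      ultimately have "emeasure ?t (D p) < \<infinity>" using c by blast
      then show ?thesis by (simp add: D_def)
    qed
    then show ?thesis by (simp add: D_def)
  qed
  have "\<Union>(range D) = UNIV"
  proof -
    have "\<exists>p. \<xi> \<in> D p" for \<xi>
    proof -
      obtain n where "fcheck m (\<phi> n) \<xi> \<noteq> 0" using \<phi>(2) by blast
      then have "(norm (fcheck m (\<phi> n) \<xi>))\<^sup>2 > 0" by simp
      from reals_Archimedean[OF this] obtain k where "inverse (real (Suc k)) < (norm (fcheck m (\<phi> n) \<xi>))\<^sup>2" ..
      then have "\<xi> \<in> D (n, k)" by (simp add: D_def)
      then show ?thesis ..
    qed
    then show ?thesis by blast
  qed
  then show ?thesis
    using Dm Dfin by (intro tv_carried[OF ft(2), of "range D"]) auto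
qed

lemma fcheck_product_integrable:
  fixes \<phi> \<psi> :: "'a::{topological_ab_group_add, t2_space} \<Rightarrow> complex"
  assumes "square_integrable N (fcheck m \<phi>)" "square_integrable N (fcheck m \<psi>)"
  shows "integrable N (\<lambda>\<xi>. fcheck m \<phi> \<xi> * cnj (fcheck m \<psi> \<xi>))"
proof (rule Bochner_Integration.integrable_bound)
  show "integrable N (\<lambda>\<xi>. (norm (fcheck m \<phi> \<xi>))\<^sup>2 + (norm (fcheck m \<psi> \<xi>))\<^sup>2)"
    using assms by (simp add: square_integrable_def)
  have [measurable]: "fcheck m \<phi> \<in> borel_measurable N" "fcheck m \<psi> \<in> borel_measurable N"
    using assms by (auto simp: square_integrable_def)
  have "cnj \<in> borel_measurable borel"
    by (intro borel_measurable_continuous_onI continuous_intros)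
  from measurable_compose[OF \<open>fcheck m \<psi> \<in> borel_measurable N\<close> this]
  have [measurable]: "(\<lambda>\<xi>. cnj (fcheck m \<psi> \<xi>)) \<in> borel_measurable N" .
  show "(\<lambda>\<xi>. fcheck m \<phi> \<xi> * cnj (fcheck m \<psi> \<xi>)) \<in> borel_measurable N" by measurable
  have "a * b \<le> a\<^sup>2 + b\<^sup>2" if "0 \<le> a" "0 \<le> b" for a b :: real
    using that sum_squares_bound[of a b] mult_nonneg_nonneg[OF that] by linarith
  then show "AE \<xi> in N. norm (fcheck m \<phi> \<xi> * cnj (fcheck m \<psi> \<xi>))
      \<le> norm ((norm (fcheck m \<phi> \<xi>))\<^sup>2 + (norm (fcheck m \<psi> \<xi>))\<^sup>2)"
    by (simp add: norm_mult)
qed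

text \<open>
  Polarisation: the diagonal values at \<open>f + g\<close> and \<open>f + \<i> g\<close> determine the value at \<open>(f, g)\<close>.
\<close>

lemma sesquilinear_eq_zero:
  fixes D :: "('a \<Rightarrow> complex) \<Rightarrow> ('a \<Rightarrow> complex) \<Rightarrow> complex"
  assumes add: "\<And>f g. f \<in> V \<Longrightarrow> g \<in> V \<Longrightarrow> (\<lambda>x. f x + g x) \<in> V"
    and cm: "\<And>c f. f \<in> V \<Longrightarrow> (\<lambda>x. c * f x) \<in> V"
    and addl: "\<And>f g h. f \<in> V \<Longrightarrow> g \<in> V \<Longrightarrow> h \<in> V \<Longrightarrow> D (\<lambda>x. f x + g x) h = D f h + D g h"
    and addr: "\<And>f g h. f \<in> V \<Longrightarrow> g \<in> V \<Longrightarrow> h \<in> V \<Longrightarrow> D h (\<lambda>x. f x + g x) = D h f + D h g"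
    and cl: "\<And>c f h. f \<in> V \<Longrightarrow> h \<in> V \<Longrightarrow> D (\<lambda>x. c * f x) h = c * D f h"
    and cr: "\<And>c f h. f \<in> V \<Longrightarrow> h \<in> V \<Longrightarrow> D h (\<lambda>x. c * f x) = cnj c * D h f"
    and diag: "\<And>f. f \<in> V \<Longrightarrow> D f f = 0"
    and f: "f \<in> V" and g: "g \<in> V"
  shows "D f g = 0"
proof -
  have sym: "D f h + D h f = 0" if h: "h \<in> V" for h
  proof -
    have "D (\<lambda>x. f x + h x) (\<lambda>x. f x + h x) = (D f f + D f h) + (D h f + D h h)"
      using f h by (simp add: addl addr add)
    moreover have "(\<lambda>x. f x + h x) \<in> V" using add[of f h] f h by simp
    ultimately show ?thesis using diag[of "\<lambda>x. f x + h x"] diag[OF f] diag[OF h] by simp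
  qed
  have "(\<lambda>x. \<i> * g x) \<in> V" using cm[of g "\<i>"] g by simp
  then have "D f (\<lambda>x. \<i> * g x) + D (\<lambda>x. \<i> * g x) f = 0" using sym[of "\<lambda>x. \<i> * g x"] by simp
  moreover have "D (\<lambda>x. \<i> * g x) f = \<i> * D g f" using cl[of g f "\<i>"] g f by simp
  moreover have "D f (\<lambda>x. \<i> * g x) = cnj \<i> * D f g" using cr[of g f "\<i>"] g f by simp
  ultimately have "cnj \<i> * D f g + \<i> * D g f = 0" by simp
  then have "\<i> * (D g f - D f g) = 0" by (simp add: algebra_simps)
  then have "D g f = D f g" by simp
  then show ?thesis using sym[OF g] by simp
qed

lemma fourier_transform_polarized:
  fixes m :: "'a::{topological_ab_group_add, t2_space, first_countable_topology} measure"
  assumes m: "haar_measure m" and ft: "has_fourier_transform m \<gamma> \<gamma>h"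
    and \<phi>: "\<phi> \<in> C_c" and \<psi>: "\<psi> \<in> C_c"
  shows "cintegral \<gamma> (correlation m \<phi> \<psi>) = cintegral \<gamma>h (\<lambda>\<xi>. fcheck m \<phi> \<xi> * cnj (fcheck m \<psi> \<xi>))"
proof -
  note ft = has_fourier_transformD[OF ft]
  note L = cintegral_L1_functional[OF ft(1)] and R = cintegral_L1_functional[OF ft(2)]
  have iL: "integrable (total_variation \<gamma>) (correlation m f g)" if "f \<in> C_c" "g \<in> C_c" for f g
    by (rule C_c_integrable_tv[OF correlation_C_c[OF m that] ft(1)])
  have iR: "integrable (total_variation \<gamma>h) (\<lambda>\<xi>. fcheck m f \<xi> * cnj (fcheck m g \<xi>))" if "f \<in> C_c" "g \<in> C_c" for f g
    by (rule fcheck_product_integrable[OF ft(3)[OF that(1)] ft(3)[OF that(2)]])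
  define D where "D f g = cintegral \<gamma> (correlation m f g) - cintegral \<gamma>h (\<lambda>\<xi>. fcheck m f \<xi> * cnj (fcheck m g \<xi>))" for f g
  have "D \<phi> \<psi> = 0"
  proof (rule sesquilinear_eq_zero[where V = C_c and D = D])
    fix f g h :: "'a \<Rightarrow> complex" and c :: complex assume f: "f \<in> C_c"
    show "(\<lambda>x. c * f x) \<in> C_c" by (rule C_c_cmult[OF f])
    show "D f f = 0"
      unfolding D_def ft(4)[OF f] by (simp only: complex_norm_square diff_self)
    assume h: "h \<in> C_c"
    show "D (\<lambda>x. c * f x) h = c * D f h"
    proof -
      have "correlation m (\<lambda>x. c * f x) h = (\<lambda>x. c * correlation m f h x)" by (intro ext correlation_cmult)
      then show ?thesis
        using L1_functional_cmult[OF L iL[OF f h], of c] L1_functional_cmult[OF R iR[OF f h], of c]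
        by (simp add: D_def fcheck_cmult mult.assoc right_diff_distrib)
    qed
    show "D h (\<lambda>x. c * f x) = cnj c * D h f"
    proof -
      have "correlation m h (\<lambda>x. c * f x) = (\<lambda>x. cnj c * correlation m h f x)" by (intro ext correlation_cmult)
      then show ?thesis
        using L1_functional_cmult[OF L iL[OF h f], of "cnj c"] L1_functional_cmult[OF R iR[OF h f], of "cnj c"]
        by (simp add: D_def fcheck_cmult mult.left_commute[of _ "cnj c"] right_diff_distrib)
    qed
    assume g: "g \<in> C_c"
    show "D (\<lambda>x. f x + g x) h = D f h + D g h"
    proof -
      have "correlation m (\<lambda>x. f x + g x) h = (\<lambda>x. correlation m f h x + correlation m g h x)"
        by (intro ext correlation_add_left m f g h)
      then show ?thesis
        using L1_functional_add[OF L iL[OF f h] iL[OF g h]] L1_functional_add[OF R iR[OF f h] iR[OF g h]]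
        by (simp add: D_def fcheck_add[OF f g m] distrib_right)
    qed
    show "D h (\<lambda>x. f x + g x) = D h f + D h g"
    proof -
      have "correlation m h (\<lambda>x. f x + g x) = (\<lambda>x. correlation m h f x + correlation m h g x)"
        by (intro ext correlation_add_right m f g h)
      then show ?thesis
        using L1_functional_add[OF L iL[OF h f] iL[OF h g]] L1_functional_add[OF R iR[OF h f] iR[OF h g]]
        by (simp add: D_def fcheck_add[OF f g m] distrib_left)
    qed
  qed (use C_c_add \<phi> \<psi> in simp_all)
  then show ?thesis by (simp add: D_def)
qed

section \<open>Translation boundedness\<close>

lemma complete_bcontfun: "complete (UNIV :: ('a::topological_space \<Rightarrow>\<^sub>C 'b::complete_space) set)"
  unfolding complete_def
proof (intro allI impI, elim conjE)
  fix f :: "nat \<Rightarrow> ('a \<Rightarrow>\<^sub>C 'b)" assume f: "Cauchy f"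
  have "\<exists>l. \<forall>e>0. \<exists>N. \<forall>n x. N \<le> n \<and> True \<longrightarrow> dist (f n x) (l x) < e"
  proof (rule uniformly_convergent_eq_cauchy[THEN iffD2], intro allI impI)
    fix e :: real assume "e > 0"
    then obtain N where N: "\<And>k n. N \<le> k \<Longrightarrow> N \<le> n \<Longrightarrow> dist (f k) (f n) < e"
      using f unfolding Cauchy_def by meson
    then show "\<exists>N. \<forall>k n x. N \<le> k \<and> N \<le> n \<and> True \<longrightarrow> dist (f k x) (f n x) < e"
      by (intro exI[of _ N]) (blast intro: dist_fun_lt_imp_dist_val_lt)
  qed
  then obtain l where "uniform_limit UNIV (\<lambda>n. apply_bcontfun (f n)) l sequentially"
    unfolding uniform_limit_sequentially_iff by auto
  then obtain l' :: "'a \<Rightarrow>\<^sub>C 'b" where "f \<longlonglongrightarrow> l'"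
    using uniform_limit_bcontfunE[OF _ sequentially_bot] by blast
  then show "\<exists>l\<in>UNIV. f \<longlonglongrightarrow> l" by blast
qed

text \<open>
  One of countably many closed sets that cover the Banach space of bounded continuous functions has an
  interior point.
\<close>

lemma bcontfun_Baire:
  fixes A :: "nat \<Rightarrow> ('a::topological_space \<Rightarrow>\<^sub>C complex) set"
  assumes cl: "\<And>n. closed (A n)" and un: "(\<Union>n. A n) = UNIV"
  shows "\<exists>n f r. r > 0 \<and> ball f r \<subseteq> A n"
proof -
  have "\<exists>n. interior (A n) \<noteq> {}"
  proof (rule ccontr)
    assume *: "\<not> ?thesis"
    have "Met_TC.mtopology interior_of \<Union>(range A) = {}"
    proof (rule Met_TC.metric_Baire_category_alt)
      show "Met_TC.mcomplete TYPE('a \<Rightarrow>\<^sub>C complex)" by (simp only: mcomplete_iff_complete complete_bcontfun)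
      show "closedin Met_TC.mtopology T \<and> Met_TC.mtopology interior_of T = {}" if "T \<in> range A" for T
        using that cl * by auto
    qed simp
    then show False using un by simp
  qed
  then obtain n f where "f \<in> interior (A n)" by blast
  then obtain r where "r > 0" "ball f r \<subseteq> A n" by (auto simp: mem_interior)
  then show ?thesis by blast
qed

lemma norm_sq_diff_le: "(norm (a - b))\<^sup>2 \<le> 2 * (norm a)\<^sup>2 + 2 * (norm b)\<^sup>2" for a b :: complex
proof -
  have "(norm (a - b))\<^sup>2 \<le> (norm a + norm b)\<^sup>2"
    by (intro power_mono norm_triangle_ineq4) simp
  also have "\<dots> \<le> 2 * (norm a)\<^sup>2 + 2 * (norm b)\<^sup>2"
    using sum_squares_bound[of "norm a" "norm b"] by (simp add: power2_sum)
  finally show ?thesis .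
qed

text \<open>
  The uniform boundedness principle for the seminorms \<open>f \<mapsto> (\<integral> |(f\<phi>)\<^sup>\<and>|\<^sup>2 dN)\<^sup>1\<^sup>/\<^sup>2\<close> on bounded continuous functions.
  They are finite everywhere, since \<open>f\<phi>\<close> has compact support, and lower semicontinuous by Fatou's lemma.
  By Baire's theorem one sublevel set contains a ball, which bounds the seminorm on the unit ball.
  Characters lie in the unit ball, and \<open>(\<eta>\<phi>)\<^sup>\<and>(\<xi>) = \<phi>\<^sup>\<and>(\<eta> + \<xi>)\<close>.
\<close>

lemma fcheck_square_translation_bounded:
  fixes m :: "'a::{topological_ab_group_add, t2_space} measure"
  assumes m: "haar_measure m" and N: "sets N = sets borel"
    and sq: "\<And>\<phi>. \<phi> \<in> C_c \<Longrightarrow> square_integrable N (fcheck m \<phi>)" and \<phi>: "\<phi> \<in> C_c"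
  shows "\<exists>B. \<forall>\<eta>. (\<integral>\<^sup>+\<xi>. ennreal ((norm (fcheck m \<phi> (\<eta> + \<xi>)))\<^sup>2) \<partial>N) \<le> ennreal B"
proof -
  define F where "F f \<xi> = fcheck m (\<lambda>x. apply_bcontfun f x * \<phi> x) \<xi>" for f :: "'a \<Rightarrow>\<^sub>C complex" and \<xi>
  have fC: "(\<lambda>x. apply_bcontfun f x * \<phi> x) \<in> C_c" for f :: "'a \<Rightarrow>\<^sub>C complex"
    by (intro C_c_mult \<phi> continuous_on_apply_bcontfun)
  have Fm: "F f \<in> borel_measurable N" for f
    using sq[OF fC] unfolding F_def square_integrable_def by blast
  define p where "p f = (\<integral>\<^sup>+\<xi>. ennreal ((norm (F f \<xi>))\<^sup>2) \<partial>N)" for f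
  have pfin: "p f < \<infinity>" for f
    using sq[OF fC[of f]] by (simp add: p_def F_def square_integrable_def integrable_iff_bounded)
  have lin: "F (f + c *\<^sub>R g) \<xi> = F f \<xi> + of_real c * F g \<xi>" for f g c \<xi>
  proof -
    have "F (f + c *\<^sub>R g) \<xi> = fcheck m (\<lambda>x. apply_bcontfun f x * \<phi> x + of_real c * (apply_bcontfun g x * \<phi> x)) \<xi>"
      by (simp add: F_def distrib_right scaleR_conv_of_real mult.assoc)
    then show ?thesis
      by (simp add: fcheck_add[OF fC C_c_cmult[OF fC] m] fcheck_cmult F_def)
  qed
  define I where "I = (\<integral>x. norm (\<phi> x) \<partial>m)"
  have Fle: "norm (F f \<xi>) \<le> norm f * I" for f \<xi>
  proof -
    have "norm (F f \<xi>) \<le> (\<integral>x. norm (apply_bcontfun f x * \<phi> x) \<partial>m)"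
      unfolding F_def by (rule norm_fcheck_le)
    also have "\<dots> \<le> (\<integral>x. norm f * norm (\<phi> x) \<partial>m)"
    proof (rule integral_mono)
      show "integrable m (\<lambda>x. norm (apply_bcontfun f x * \<phi> x))"
        by (intro integrable_norm C_c_integrable_haar fC m)
      show "integrable m (\<lambda>x. norm f * norm (\<phi> x))" using C_c_integrable_haar[OF \<phi> m] by simp
      show "norm (apply_bcontfun f x * \<phi> x) \<le> norm f * norm (\<phi> x)" for x
        unfolding norm_mult by (intro mult_right_mono norm_bounded) simp
    qed
    finally show ?thesis by (simp add: I_def)
  qed
  define A where "A n = {f. p f \<le> of_nat n}" for n :: nat
  have "closed (A n)" for n
    unfolding closed_sequential_limits
  proof (intro allI impI, elim conjE)
    fix f :: "nat \<Rightarrow> ('a \<Rightarrow>\<^sub>C complex)" and g assume f: "\<forall>k. f k \<in> A n" and lim: "f \<longlonglongrightarrow> g"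
    have "(\<lambda>k. F (f k) \<xi>) \<longlonglongrightarrow> F g \<xi>" for \<xi>
    proof -
      have z: "(\<lambda>k. norm (f k - g) * I) \<longlonglongrightarrow> 0"
        using lim by (intro tendsto_mult_left_zero tendsto_norm_zero LIM_zero)
      have b: "norm (F (f k) \<xi> - F g \<xi>) \<le> norm (f k - g) * I" for k
        using Fle[of "f k - g" \<xi>] lin[of "f k" "- 1" g \<xi>] by simp
      have "(\<lambda>k. F (f k) \<xi> - F g \<xi>) \<longlonglongrightarrow> 0"
        by (intro Lim_null_comparison[OF always_eventually z] allI b)
      then show ?thesis by (rule LIM_zero_cancel)
    qed
    then have "(\<lambda>k. ennreal ((norm (F (f k) \<xi>))\<^sup>2)) \<longlonglongrightarrow> ennreal ((norm (F g \<xi>))\<^sup>2)" for \<xi>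
      by (intro tendsto_intros)
    from lim_imp_Liminf[OF sequentially_bot this]
    have "p g = (\<integral>\<^sup>+\<xi>. liminf (\<lambda>k. ennreal ((norm (F (f k) \<xi>))\<^sup>2)) \<partial>N)"
      by (simp add: p_def)
    also have "\<dots> \<le> liminf (\<lambda>k. p (f k))"
      unfolding p_def using Fm by (intro nn_integral_liminf) auto
    also have "\<dots> \<le> of_nat n" using f by (intro Liminf_le) (auto simp: A_def)
    finally show "g \<in> A n" by (simp add: A_def)
  qed
  moreover have "(\<Union>n. A n) = UNIV"
  proof -
    have "\<exists>n. f \<in> A n" for f
    proof -
      obtain s where s: "0 \<le> s" "p f = ennreal s" using pfin[of f] by (cases "p f") auto
      obtain n :: nat where "s \<le> real n" using real_arch_simple by blast
      then have "p f \<le> of_nat n" using s by (simp add: ennreal_of_nat_eq_real_of_nat ennreal_leI)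
      then show ?thesis by (auto simp: A_def)
    qed
    then show ?thesis by blast
  qed
  ultimately obtain n f r where r: "r > 0" "ball f r \<subseteq> A n" using bcontfun_Baire by blast
  \<comment> \<open>If the seminorm squared is at most \<open>n\<close> on the ball, then at \<open>e = (2 / r) ((f + (r / 2) e) - f)\<close> its
    square is at most \<open>(4 / r\<^sup>2) (2 n + 2 n)\<close>.\<close>
  have "p e \<le> ennreal (16 * real n / r\<^sup>2)" if e: "norm e \<le> 1" for e
  proof -
    have "f \<in> ball f r" "f + (r / 2) *\<^sub>R e \<in> ball f r"
      using r(1) e mult_left_mono[OF e, of "r / 2"] by (auto simp: dist_norm)
    then have "f \<in> A n" "f + (r / 2) *\<^sub>R e \<in> A n" using r(2) by blast+
    then have pn: "p f \<le> of_nat n" "p (f + (r / 2) *\<^sub>R e) \<le> of_nat n" by (simp_all add: A_def)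
    let ?g = "f + (r / 2) *\<^sub>R e"
    have pt: "(norm (F e \<xi>))\<^sup>2 \<le> 8 / r\<^sup>2 * (norm (F ?g \<xi>))\<^sup>2 + 8 / r\<^sup>2 * (norm (F f \<xi>))\<^sup>2" for \<xi>
    proof -
      have eq: "norm (F ?g \<xi> - F f \<xi>) = r / 2 * norm (F e \<xi>)"
        using r(1) by (simp add: lin norm_mult)
      have "r\<^sup>2 / 4 * (norm (F e \<xi>))\<^sup>2 = (norm (F ?g \<xi> - F f \<xi>))\<^sup>2"
        unfolding eq by (simp add: power_mult_distrib power_divide)
      also have "\<dots> \<le> 2 * (norm (F ?g \<xi>))\<^sup>2 + 2 * (norm (F f \<xi>))\<^sup>2" by (rule norm_sq_diff_le)
      finally show ?thesis using r(1) by (simp add: field_simps)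
    qed
    have r8: "0 \<le> 8 / r\<^sup>2" by simp
    have "p e \<le> (\<integral>\<^sup>+\<xi>. ennreal (8 / r\<^sup>2) * ennreal ((norm (F ?g \<xi>))\<^sup>2) + ennreal (8 / r\<^sup>2) * ennreal ((norm (F f \<xi>))\<^sup>2) \<partial>N)"
      unfolding p_def
    proof (rule nn_integral_mono)
      fix \<xi>
      let ?a = "(norm (F ?g \<xi>))\<^sup>2" and ?b = "(norm (F f \<xi>))\<^sup>2"
      have "ennreal ((norm (F e \<xi>))\<^sup>2) \<le> ennreal (8 / r\<^sup>2 * ?a + 8 / r\<^sup>2 * ?b)" by (rule ennreal_leI[OF pt])
      also have "\<dots> = ennreal (8 / r\<^sup>2 * ?a) + ennreal (8 / r\<^sup>2 * ?b)" by (intro ennreal_plus) auto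
      also have "\<dots> = ennreal (8 / r\<^sup>2) * ennreal ?a + ennreal (8 / r\<^sup>2) * ennreal ?b"
        by (simp only: ennreal_mult[OF r8 zero_le_power2])
      finally show "ennreal ((norm (F e \<xi>))\<^sup>2) \<le> ennreal (8 / r\<^sup>2) * ennreal ?a + ennreal (8 / r\<^sup>2) * ennreal ?b" .
    qed
    also have "\<dots> = ennreal (8 / r\<^sup>2) * p ?g + ennreal (8 / r\<^sup>2) * p f"
      unfolding p_def using Fm by (simp add: nn_integral_add nn_integral_cmult)
    also have "\<dots> \<le> ennreal (8 / r\<^sup>2) * of_nat n + ennreal (8 / r\<^sup>2) * of_nat n"
      using pn by (intro add_mono mult_left_mono) auto
    also have "\<dots> = ennreal (16 * real n / r\<^sup>2)"
      by (simp add: ennreal_of_nat_eq_real_of_nat ennreal_mult[symmetric] ennreal_plus[symmetric] del: ennreal_plus)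
    finally show ?thesis .
  qed
  note bound = this
  have "(\<integral>\<^sup>+\<xi>. ennreal ((norm (fcheck m \<phi> (\<eta> + \<xi>)))\<^sup>2) \<partial>N) \<le> ennreal (16 * real n / r\<^sup>2)" for \<eta>
  proof -
    have b: "char_apply \<eta> \<in> bcontfun"
      by (rule bcontfun_normI[of _ 1]) (simp_all add: char_apply_continuous)
    have ap: "apply_bcontfun (Bcontfun (char_apply \<eta>)) = char_apply \<eta>"
      using b by (simp add: Bcontfun_inverse)
    have "norm (Bcontfun (char_apply \<eta>)) \<le> 1" by (rule norm_bound) (simp add: ap)
    from bound[OF this] show ?thesis by (simp add: p_def F_def ap fcheck_character)
  qed
  then show ?thesis by blast
qed

section \<open>Pure point measures\<close>

text \<open>
  The set of point masses is countable, because it is so in each relatively compact set and the variation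
  is carried by countably many of these. The second part says that the sum of the absolute point masses
  does not exceed the variation.
\<close>

lemma pure_point_sequence:
  fixes \<mu> :: "'a::t2_space cmeasure"
  assumes \<mu>: "complex_radon_measure \<mu>" "rc_carried (total_variation \<mu>)" and pp: "pure_point \<mu>"
  shows "\<exists>c x. (\<forall>A\<in>rc_borel. (\<lambda>n. c n * indicator A (x n)) sums \<mu> A) \<and>
    (\<forall>f. (\<Sum>n. ennreal (norm (c n)) * f (x n)) \<le> (\<integral>\<^sup>+y. f y \<partial>total_variation \<mu>))"
proof -
  let ?t = "total_variation \<mu>"
  define S where "S = {x. \<mu> {x} \<noteq> 0}"
  obtain E :: "nat \<Rightarrow> 'a set" where E: "range E \<subseteq> rc_borel" "emeasure ?t (- (\<Union>n. E n)) = 0"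
    using \<mu>(2) by (auto simp: rc_carried_def)
  have UE: "(\<Union>n. E n) \<in> sets borel" using E(1) rc_borel_sets by (intro sets.countable_UN) blast
  have "S \<subseteq> (\<Union>n. {x\<in>E n. \<mu> {x} \<noteq> 0})"
  proof
    fix x assume x: "x \<in> S"
    have "x \<in> (\<Union>n. E n)"
    proof (rule ccontr)
      assume "x \<notin> (\<Union>n. E n)"
      then have "emeasure ?t {x} \<le> emeasure ?t (- (\<Union>n. E n))"
        using borel_comp[OF UE] by (intro emeasure_mono) auto
      then have "ennreal (norm (\<mu> {x})) \<le> 0"
        using norm_le_tv[OF \<mu>(1) rc_borel_singleton] E(2) by (metis order_trans)
      then show False using x by (simp add: S_def)
    qed
    then show "x \<in> (\<Union>n. {x\<in>E n. \<mu> {x} \<noteq> 0})" using x by (simp add: S_def)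
  qed
  moreover have "countable {x\<in>E n. \<mu> {x} \<noteq> 0}" for n
  proof -
    have "((\<lambda>x. \<mu> {x}) has_sum \<mu> (E n)) (E n)" using pp E(1) by (auto simp: pure_point_def)
    then have "(\<lambda>x. \<mu> {x}) summable_on (E n)" by (rule has_sum_imp_summable)
    from abs_summable_countable[OF summable_on_iff_abs_summable_on_complex[THEN iffD1, OF this]]
    show ?thesis .
  qed
  ultimately have S: "countable S" by (meson countable_UN countable_subset countableI_type)
  define J where "J = to_nat_on S ` S"
  define x where "x = from_nat_into S"
  \<comment> \<open>Indices outside \<open>J\<close> occur only if there are finitely many points; they get mass \<open>0\<close>.\<close>
  define c where "c n = (if n \<in> J then \<mu> {x n} else 0)" for n
  have bij: "bij_betw x J S"
    unfolding x_def J_def using S by (intro bij_betw_byWitness[where f' = "to_nat_on S"]) auto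
  have "(\<lambda>n. c n * indicator A (x n)) sums \<mu> A" if A: "A \<in> rc_borel" for A
  proof -
    have "((\<lambda>y. \<mu> {y}) has_sum \<mu> A) A" using pp A by (auto simp: pure_point_def)
    then have "((\<lambda>y. \<mu> {y} * indicator A y) has_sum \<mu> A) S"
      by (subst has_sum_cong_neutral[where T = A and g = "\<lambda>y. \<mu> {y}"]) (auto simp: S_def)
    then have "((\<lambda>n. \<mu> {x n} * indicator A (x n)) has_sum \<mu> A) J"
      using has_sum_reindex_bij_betw[OF bij, of "\<lambda>y. \<mu> {y} * indicator A y"] by simp
    then have "((\<lambda>n. c n * indicator A (x n)) has_sum \<mu> A) UNIV"
      by (subst has_sum_cong_neutral[where T = J and g = "\<lambda>n. \<mu> {x n} * indicator A (x n)"]) (auto simp: c_def)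
    then show ?thesis by (rule has_sum_imp_sums)
  qed
  moreover have "(\<Sum>n. ennreal (norm (c n)) * f (x n)) \<le> (\<integral>\<^sup>+y. f y \<partial>?t)" for f
  proof (rule suminf_le_const)
    show "summable (\<lambda>n. ennreal (norm (c n)) * f (x n))" by simp
    fix N :: nat
    let ?J = "{..<N} \<inter> J"
    have inj: "inj_on x ?J" using bij by (auto simp: bij_betw_def intro: inj_on_subset)
    have "(\<Sum>n<N. ennreal (norm (c n)) * f (x n)) = (\<Sum>n\<in>?J. ennreal (norm (\<mu> {x n})) * f (x n))"
      by (intro sum.mono_neutral_cong_right) (auto simp: c_def)
    also have "\<dots> = (\<Sum>y\<in>x ` ?J. ennreal (norm (\<mu> {y})) * f y)"
      by (simp add: sum.reindex[OF inj])
    also have "\<dots> \<le> (\<Sum>y\<in>x ` ?J. f y * emeasure ?t {y})"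
    proof (rule sum_mono)
      fix y
      show "ennreal (norm (\<mu> {y})) * f y \<le> f y * emeasure ?t {y}"
        unfolding mult.commute[of _ "f y"] by (intro mult_left_mono norm_le_tv[OF \<mu>(1)]) auto
    qed
    also have "\<dots> = (\<integral>\<^sup>+y. f y * indicator (x ` ?J) y \<partial>?t)"
      by (rule nn_integral_indicator_finite[symmetric]) auto
    also have "\<dots> \<le> (\<integral>\<^sup>+y. f y \<partial>?t)"
      by (intro nn_integral_mono) (auto simp: indicator_def)
    finally show "(\<Sum>n<N. ennreal (norm (c n)) * f (x n)) \<le> (\<integral>\<^sup>+y. f y \<partial>?t)" .
  qed
  ultimately show ?thesis by blast
qed

section \<open>Measures supported on uniformly discrete sets\<close>

text \<open>
  Each translate of the negative of the separating neighbourhood meets \<open>S\<close> in at most one point, and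
  finitely many translates cover \<open>K\<close>.
\<close>

lemma uniformly_discrete_finite_Int:
  fixes S K :: "'a::{topological_ab_group_add, t2_space} set"
  assumes S: "uniformly_discrete S" and K: "compact K"
  shows "finite (S \<inter> K)"
proof -
  obtain V where V: "0 \<in> interior V" "uniformly_discrete_wrt V S"
    using S by (auto simp: uniformly_discrete_def)
  \<comment> \<open>If \<open>a\<close> and \<open>b\<close> both lie in \<open>U z\<close>, then \<open>z\<close> lies in both \<open>a + V\<close> and \<open>b + V\<close>.\<close>
  define U where "U z = {y. z - y \<in> interior V}" for z
  have oU: "open (U z)" for z
  proof -
    have "open ((\<lambda>y. z - y) -` interior V)"
      by (intro open_vimage open_interior continuous_intros)
    then show ?thesis by (simp add: U_def vimage_def)
  qed
  have one: "a = b" if "a \<in> S \<inter> U z" "b \<in> S \<inter> U z" for a b z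
  proof (rule ccontr)
    assume "a \<noteq> b"
    then have "(+) a ` V \<inter> (+) b ` V = {}" using V(2) that by (auto simp: uniformly_discrete_wrt_def)
    moreover have "z - a \<in> V" "z - b \<in> V"
      using that interior_subset[of V] by (auto simp: U_def)
    from imageI[OF this(1), of "(+) a"] imageI[OF this(2), of "(+) b"]
    have "z \<in> (+) a ` V" "z \<in> (+) b ` V" by simp_all
    ultimately show False by auto
  qed
  have "K \<subseteq> (\<Union>z\<in>K. U z)" using V(1) by (auto simp: U_def)
  from compactE_image[OF K oU this] obtain C where C: "C \<subseteq> K" "finite C" "K \<subseteq> (\<Union>z\<in>C. U z)" by blast
  have "finite (S \<inter> U z)" for z
  proof (cases "S \<inter> U z = {}")
    case False
    then obtain a where "a \<in> S \<inter> U z" by blast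
    then have "S \<inter> U z \<subseteq> {a}" using one by blast
    then show ?thesis by (rule finite_subset) simp
  qed simp
  then have "finite (\<Union>z\<in>C. S \<inter> U z)" using C(2) by blast
  then show ?thesis by (rule finite_subset[rotated]) (use C(3) in blast)
qed

text \<open>
  By second countability the complement of the support is a countable union of null open sets.
\<close>

lemma msupp_null:
  fixes \<mu> :: "'a::second_countable_topology cmeasure"
  shows "emeasure (total_variation \<mu>) (- msupp \<mu>) = 0" "- msupp \<mu> \<in> sets borel"
proof -
  let ?F = "{U. open U \<and> emeasure (total_variation \<mu>) U = 0}"
  obtain \<F> where F: "\<F> \<subseteq> ?F" "countable \<F>" "\<Union>\<F> = \<Union>?F"
    using Lindelof[of ?F] by blast
  have "\<Union>\<F> \<in> null_sets (total_variation \<mu>)"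
  proof (rule null_sets_UN'[of \<F> "\<lambda>A. A", simplified])
    show "countable \<F>" by (rule F(2))
    show "A \<in> null_sets (total_variation \<mu>)" if "A \<in> \<F>" for A
      using that F(1) by (intro null_setsI) auto
  qed
  then show "emeasure (total_variation \<mu>) (- msupp \<mu>) = 0" "- msupp \<mu> \<in> sets borel"
    using F(3) by (auto simp: msupp_def null_setsD1 dest: null_setsD2)
qed

lemma singleton_in_msupp:
  fixes \<mu> :: "'a::t1_space cmeasure"
  assumes \<mu>: "complex_radon_measure \<mu>" and x: "\<mu> {x} \<noteq> 0"
  shows "x \<in> msupp \<mu>"
proof (rule ccontr)
  assume "x \<notin> msupp \<mu>"
  then obtain U where U: "open U" "emeasure (total_variation \<mu>) U = 0" "x \<in> U" by (auto simp: msupp_def)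
  have "ennreal (norm (\<mu> {x})) \<le> emeasure (total_variation \<mu>) {x}" by (rule norm_le_tv[OF \<mu> rc_borel_singleton])
  also have "\<dots> \<le> emeasure (total_variation \<mu>) U" using U by (intro emeasure_mono) auto
  finally show False using U(2) x by simp
qed

text \<open>
  Almost everywhere, \<open>f\<close> equals a finite combination of indicators of points of \<open>S \<inter> K\<close>.
\<close>

lemma cintegral_uniformly_discrete:
  fixes \<mu> :: "'a::{topological_ab_group_add, t2_space, second_countable_topology} cmeasure"
  assumes \<mu>: "complex_radon_measure \<mu>" and S: "msupp \<mu> \<subseteq> S" "uniformly_discrete S"
    and K: "compact K" and f: "f \<in> borel_measurable borel" "\<And>x. x \<notin> K \<Longrightarrow> f x = 0"
  shows "integrable (total_variation \<mu>) f" "cintegral \<mu> f = (\<Sum>x\<in>S \<inter> K. \<mu> {x} * f x)"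
proof -
  let ?t = "total_variation \<mu>"
  have fin: "finite (S \<inter> K)" by (rule uniformly_discrete_finite_Int[OF S(2) K])
  define g where "g y = (\<Sum>x\<in>S \<inter> K. f x * indicator {x} y)" for y
  have ig: "integrable ?t (\<lambda>y. f x * indicator {x} y)" for x
    by (intro integrable_mult_right integrable_complex_indicator tv_finite[OF \<mu>]) simp_all
  then have g: "integrable ?t g" unfolding g_def by (intro Bochner_Integration.integrable_sum)
  have ae: "AE y in ?t. f y = g y"
  proof (rule AE_I[where N = "- msupp \<mu>"])
    show "emeasure ?t (- msupp \<mu>) = 0" "- msupp \<mu> \<in> sets ?t" using msupp_null[of \<mu>] by auto
    have "f y = g y" if "y \<in> msupp \<mu>" for y
    proof (cases "y \<in> K")
      case True
      then have "g y = (\<Sum>x\<in>{y}. f x * indicator {x} y)"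
        unfolding g_def using that S(1) fin by (intro sum.mono_neutral_right) (auto simp: indicator_def)
      then show ?thesis by simp
    next
      case False
      then have "g y = 0" unfolding g_def by (intro sum.neutral) (auto simp: indicator_def)
      then show ?thesis using f(2)[OF False] by simp
    qed
    then show "{y \<in> space ?t. f y \<noteq> g y} \<subseteq> - msupp \<mu>" by auto
  qed
  have fm: "f \<in> borel_measurable ?t" using f(1) by (simp add: measurable_cong_sets[OF sets_total_variation refl])
  show fi: "integrable ?t f"
    using integrable_cong_AE[OF fm borel_measurable_integrable[OF g] ae] g by simp
  note L = cintegral_L1_functional[OF \<mu>]
  have "cintegral \<mu> f = cintegral \<mu> g" by (rule L1_functional_cong_AE[OF L fi g ae])
  also have "\<dots> = (\<Sum>x\<in>S \<inter> K. cintegral \<mu> (\<lambda>y. f x * indicator {x} y))"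
    unfolding g_def by (rule L1_functional_sum[OF L ig])
  also have "\<dots> = (\<Sum>x\<in>S \<inter> K. \<mu> {x} * f x)"
  proof (rule sum.cong[OF refl])
    fix x
    have "integrable ?t (indicator {x} :: 'a \<Rightarrow> complex)"
      by (intro integrable_complex_indicator tv_finite[OF \<mu>]) simp_all
    from L1_functional_cmult[OF L this, of "f x"]
    show "cintegral \<mu> (\<lambda>y. f x * indicator {x} y) = \<mu> {x} * f x"
      by (simp add: cintegral_indicator[OF \<mu>] mult.commute)
  qed
  finally show "cintegral \<mu> f = (\<Sum>x\<in>S \<inter> K. \<mu> {x} * f x)" .
qed

section \<open>Uniqueness of the Fourier transform\<close>

text \<open>
  Trigonometric polynomials: the span of the points of the group, acting as characters on its dual.
\<close>

inductive_set trig_poly :: "('a::topological_ab_group_add character \<Rightarrow> complex) set" where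
  point: "(\<lambda>\<xi>. char_apply \<xi> x) \<in> trig_poly"
| add: "p \<in> trig_poly \<Longrightarrow> q \<in> trig_poly \<Longrightarrow> (\<lambda>\<xi>. p \<xi> + q \<xi>) \<in> trig_poly"
| scale: "p \<in> trig_poly \<Longrightarrow> (\<lambda>\<xi>. c * p \<xi>) \<in> trig_poly"

lemma trig_poly_const: "(\<lambda>\<xi>. c) \<in> trig_poly"
  using trig_poly.scale[OF trig_poly.point[of 0], of c] by simp

lemma trig_poly_mult:
  assumes p: "p \<in> trig_poly" and q: "q \<in> trig_poly"
  shows "(\<lambda>\<xi>. p \<xi> * q \<xi>) \<in> trig_poly"
  using p
proof induction
  case (point x)
  show ?case
    using q
  proof induction
    case (point y)
    show ?case using trig_poly.point[of "x + y"] by (simp add: char_apply_add)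
  next
    case (add r s)
    then show ?case using trig_poly.add[OF add.IH] by (simp add: distrib_left)
  next
    case (scale r c)
    then show ?case using trig_poly.scale[OF scale.IH, of c] by (simp add: mult.left_commute[of _ c])
  qed
next
  case (add r s)
  then show ?case using trig_poly.add[OF add.IH] by (simp add: distrib_right)
next
  case (scale r c)
  then show ?case using trig_poly.scale[OF scale.IH, of c] by (simp add: mult.assoc)
qed

lemma char_eval_continuous: "continuous_on UNIV (\<lambda>\<xi>. char_apply \<xi> x)"
  unfolding continuous_on_def
proof (intro ballI tendstoI)
  fix \<xi> :: "'a character" and e :: real assume "e > 0"
  have "\<forall>\<^sub>F \<psi> in nhds \<xi>. \<psi> \<in> char_nbhd \<xi> {x} e"
    by (rule eventually_nhds_char_nbhd) (simp_all add: \<open>e > 0\<close>)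
  then show "\<forall>\<^sub>F \<psi> in at \<xi>. dist (char_apply \<psi> x) (char_apply \<xi> x) < e"
    unfolding eventually_at_filter by (rule eventually_mono) (simp add: char_nbhd_def)
qed

lemma trig_poly_continuous: "p \<in> trig_poly \<Longrightarrow> continuous_on UNIV p"
  by (induction rule: trig_poly.induct) (intro continuous_intros char_eval_continuous; assumption)+

lemma trig_poly_bounded: "p \<in> trig_poly \<Longrightarrow> \<exists>M. \<forall>\<xi>. norm (p \<xi>) \<le> M"
proof (induction rule: trig_poly.induct)
  case (point x)
  then show ?case by (intro exI[of _ 1]) simp
next
  case (add p q)
  then obtain M N where "\<And>\<xi>. norm (p \<xi>) \<le> M" "\<And>\<xi>. norm (q \<xi>) \<le> N" by blast
  then show ?case by (intro exI[of _ "M + N"] allI norm_triangle_le add_mono)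
next
  case (scale p c)
  then obtain M where "\<And>\<xi>. norm (p \<xi>) \<le> M" by blast
  then show ?case by (intro exI[of _ "norm c * M"]) (simp add: norm_mult mult_left_mono)
qed

lemma trig_poly_real_polynomial:
  fixes P :: "real \<Rightarrow> real"
  assumes "real_polynomial_function P" and p: "(\<lambda>\<xi>. complex_of_real (p \<xi>)) \<in> trig_poly"
  shows "(\<lambda>\<xi>. complex_of_real (P (p \<xi>))) \<in> trig_poly"
  using assms(1)
proof induction
  case (linear f)
  then obtain c where c: "f = (\<lambda>x. x * c)" using real_bounded_linear by blast
  show ?case using trig_poly.scale[OF p, of "of_real c"] by (simp add: c mult.commute)
next
  case (const c)
  show ?case by (rule trig_poly_const)
next
  case (add f g)
  then show ?case using trig_poly.add[OF add.IH] by simp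
next
  case (mult f g)
  then show ?case using trig_poly_mult[OF mult.IH] by simp
qed

text \<open>
  Two distinct characters differ at some point, hence in the real or the imaginary part of their value
  there. Both parts are real trigonometric polynomials since the conjugate of a value at \<open>x\<close> is the
  value at \<open>-x\<close>.
\<close>

lemma trig_poly_function_ring:
  assumes K: "compact K"
  shows "function_ring_on {p. (\<lambda>\<xi>. complex_of_real (p \<xi>)) \<in> trig_poly} (K :: 'a::topological_ab_group_add character set)"
proof
  show "compact K" by (rule K)
  show "continuous_on K p" if "p \<in> {p. (\<lambda>\<xi>. complex_of_real (p \<xi>)) \<in> trig_poly}" for p
  proof -
    have "continuous_on UNIV (\<lambda>\<xi>. Re (complex_of_real (p \<xi>)))"
      using that by (intro continuous_on_Re trig_poly_continuous) simp
    then show ?thesis by (simp add: continuous_on_subset[of UNIV])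
  qed
  show "(\<lambda>x. p x + q x) \<in> {p. (\<lambda>\<xi>. complex_of_real (p \<xi>)) \<in> trig_poly}"
    if "p \<in> {p. (\<lambda>\<xi>. complex_of_real (p \<xi>)) \<in> trig_poly}" "q \<in> {p. (\<lambda>\<xi>. complex_of_real (p \<xi>)) \<in> trig_poly}"
    for p q :: "'a character \<Rightarrow> real"
    using trig_poly.add[of "\<lambda>\<xi>. complex_of_real (p \<xi>)" "\<lambda>\<xi>. complex_of_real (q \<xi>)"] that by simp
  show "(\<lambda>x. p x * q x) \<in> {p. (\<lambda>\<xi>. complex_of_real (p \<xi>)) \<in> trig_poly}"
    if "p \<in> {p. (\<lambda>\<xi>. complex_of_real (p \<xi>)) \<in> trig_poly}" "q \<in> {p. (\<lambda>\<xi>. complex_of_real (p \<xi>)) \<in> trig_poly}"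
    for p q :: "'a character \<Rightarrow> real"
    using trig_poly_mult[of "\<lambda>\<xi>. complex_of_real (p \<xi>)" "\<lambda>\<xi>. complex_of_real (q \<xi>)"] that by simp
  show "(\<lambda>_. c) \<in> {p. (\<lambda>\<xi>. complex_of_real (p \<xi>)) \<in> trig_poly}" for c
    by (simp add: trig_poly_const)
  fix \<xi> \<psi> :: "'a character" assume "\<xi> \<noteq> \<psi>"
  then obtain x where x: "char_apply \<xi> x \<noteq> char_apply \<psi> x"
    using char_apply_inject[of \<xi> \<psi>] by (auto simp: fun_eq_iff)
  have re: "(\<lambda>\<xi>. complex_of_real (Re (char_apply \<xi> x))) \<in> trig_poly"
  proof -
    have "(\<lambda>\<xi>. 1 / 2 * (char_apply \<xi> x + char_apply \<xi> (- x))) \<in> trig_poly"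
      by (intro trig_poly.scale trig_poly.add trig_poly.point)
    moreover have "1 / 2 * (char_apply \<xi> x + char_apply \<xi> (- x)) = complex_of_real (Re (char_apply \<xi> x))" for \<xi> :: "'a character"
      by (simp add: cnj_char_apply[symmetric] complex_add_cnj)
    ultimately show ?thesis by simp
  qed
  have im: "(\<lambda>\<xi>. complex_of_real (Im (char_apply \<xi> x))) \<in> trig_poly"
  proof -
    have "(\<lambda>\<xi>. - \<i> / 2 * (char_apply \<xi> x + - 1 * char_apply \<xi> (- x))) \<in> trig_poly"
      by (intro trig_poly.scale trig_poly.add trig_poly.point)
    moreover have "- \<i> / 2 * (char_apply \<xi> x + - 1 * char_apply \<xi> (- x)) = complex_of_real (Im (char_apply \<xi> x))" for \<xi> :: "'a character"
      by (simp add: cnj_char_apply[symmetric] complex_eq_iff)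
    ultimately show ?thesis by simp
  qed
  show "\<exists>p\<in>{p. (\<lambda>\<xi>. complex_of_real (p \<xi>)) \<in> trig_poly}. p \<xi> \<noteq> p \<psi>"
  proof (cases "Re (char_apply \<xi> x) = Re (char_apply \<psi> x)")
    case True
    then have "Im (char_apply \<xi> x) \<noteq> Im (char_apply \<psi> x)" using x by (simp add: complex_eq_iff)
    then show ?thesis using im by (intro bexI[of _ "\<lambda>\<xi>. Im (char_apply \<xi> x)"]) auto
  next
    case False
    then show ?thesis using re by (intro bexI[of _ "\<lambda>\<xi>. Re (char_apply \<xi> x)"]) auto
  qed
qed

text \<open>
  The theorem of Stone and Weierstrass gives an approximation \<open>p\<close> on \<open>K0 \<union> K1\<close>, without any control
  elsewhere except that \<open>p\<close> is bounded. Composition with a polynomial close to the truncation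
  \<open>t \<mapsto> max 0 (min 1 t)\<close> on the range of \<open>p\<close> yields a trigonometric polynomial that is also globally bounded
  by a constant independent of \<open>K0\<close> and \<open>K1\<close>.
\<close>

lemma trig_poly_Urysohn:
  fixes K0 K1 :: "'a::topological_ab_group_add character set"
  assumes K: "compact K0" "compact K1" "K0 \<inter> K1 = {}" and e: "e > 0"
  shows "\<exists>q\<in>trig_poly. (\<forall>\<xi>. norm (q \<xi>) \<le> 1 + e) \<and> (\<forall>\<xi>\<in>K0. norm (q \<xi> - 1) \<le> e) \<and> (\<forall>\<xi>\<in>K1. norm (q \<xi>) \<le> e)"
proof -
  interpret function_ring_on "{p. (\<lambda>\<xi>. complex_of_real (p \<xi>)) \<in> trig_poly}" "K0 \<union> K1"
    by (rule trig_poly_function_ring[OF compact_Un[OF K(1,2)]])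
  define h :: "'a character \<Rightarrow> real" where "h \<xi> = (if \<xi> \<in> K0 then 1 else 0)" for \<xi>
  have e2: "e / 2 > 0" using e by simp
  have "continuous_on (K0 \<union> K1) h"
    unfolding h_def
  proof (rule continuous_on_cases)
    show "closed K0" "closed K1" using K by (simp_all add: compact_imp_closed)
  qed (use K(3) in auto)
  from Stone_Weierstrass_basic[OF this e2]
  obtain p where p: "(\<lambda>\<xi>. complex_of_real (p \<xi>)) \<in> trig_poly" "\<And>\<xi>. \<xi> \<in> K0 \<union> K1 \<Longrightarrow> \<bar>h \<xi> - p \<xi>\<bar> < e / 2"
    by auto
  obtain M where M: "\<And>\<xi>. \<bar>p \<xi>\<bar> \<le> M" using trig_poly_bounded[OF p(1)] by auto
  define clamp :: "real \<Rightarrow> real" where "clamp t = max 0 (min 1 t)" for t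
  have "continuous_on {- M..M} clamp"
    unfolding clamp_def by (intro continuous_intros)
  from Stone_Weierstrass_real_polynomial_function[OF compact_Icc this e2]
  obtain P where P: "real_polynomial_function P" "\<And>t. t \<in> {- M..M} \<Longrightarrow> \<bar>clamp t - P t\<bar> < e / 2" by blast
  have P': "\<bar>clamp (p \<xi>) - P (p \<xi>)\<bar> < e / 2" for \<xi>
    using M[of \<xi>] by (intro P(2)) (auto simp: abs_le_iff)
  have q: "(\<lambda>\<xi>. complex_of_real (P (p \<xi>))) \<in> trig_poly" by (rule trig_poly_real_polynomial[OF P(1) p(1)])
  have c01: "0 \<le> clamp t" "clamp t \<le> 1" for t by (simp_all add: clamp_def)
  have c1: "\<bar>clamp t - 1\<bar> \<le> \<bar>t - 1\<bar>" and c0: "\<bar>clamp t\<bar> \<le> \<bar>t\<bar>" for t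
    by (auto simp: clamp_def max_def min_def)
  have "\<bar>P (p \<xi>)\<bar> \<le> 1 + e" for \<xi>
    using P'[of \<xi>] e c01[of "p \<xi>"] by linarith
  moreover have "\<bar>P (p \<xi>) - 1\<bar> \<le> e" if "\<xi> \<in> K0" for \<xi>
  proof -
    have "\<bar>1 - p \<xi>\<bar> < e / 2" using p(2)[of \<xi>] that by (simp add: h_def)
    then show ?thesis using P'[of \<xi>] c1[of "p \<xi>"] by linarith
  qed
  moreover have "\<bar>P (p \<xi>)\<bar> \<le> e" if "\<xi> \<in> K1" for \<xi>
  proof -
    have "\<xi> \<notin> K0" using K(3) that by blast
    then have "\<bar>p \<xi>\<bar> < e / 2" using p(2)[of \<xi>] that by (simp add: h_def)
    then show ?thesis using P'[of \<xi>] c0[of "p \<xi>"] by linarith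
  qed
  ultimately show ?thesis
  proof (intro bexI[OF _ q] conjI allI ballI)
    fix \<xi> assume a: "\<And>\<xi>. \<xi> \<in> K0 \<Longrightarrow> \<bar>P (p \<xi>) - 1\<bar> \<le> e" "\<xi> \<in> K0"
    have "norm (complex_of_real (P (p \<xi>) - 1)) \<le> e" unfolding norm_of_real by (rule a(1)[OF a(2)])
    then show "norm (complex_of_real (P (p \<xi>)) - 1) \<le> e" by simp
  qed simp_all
qed

lemma rc_regular_finite_compact:
  fixes N :: "'a::t2_space measure"
  assumes N: "rc_regular N" "emeasure N UNIV < \<infinity>" and e: "e > 0"
  shows "\<exists>L. compact L \<and> emeasure N (- L) < ennreal e"
proof -
  have Ns: "sets N = sets borel" using N(1) by (simp add: rc_regular_def)
  have sp: "space N = UNIV" using sets_eq_imp_space_eq[OF Ns] by simp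
  interpret finite_measure N using N(2) sp by (intro finite_measureI) auto
  obtain E where E: "incseq E" "\<And>n. E n \<in> rc_borel" "emeasure N (- (\<Union>n. E n)) = 0"
    using rc_carried_incseq[of N] N(1) by (auto simp: rc_regular_def)
  have Es: "E n \<in> sets N" for n using rc_borel_sets[OF E(2)] Ns by simp
  have Ec: "- E n \<in> sets N" for n using borel_comp[OF rc_borel_sets[OF E(2)]] Ns by simp
  have "(\<lambda>n. measure N (- E n)) \<longlonglongrightarrow> measure N (\<Inter>n. - E n)"
    using Ec E(1) by (intro finite_Lim_measure_decseq) (auto simp: decseq_def incseq_def)
  moreover have "(\<Inter>n. - E n) = - (\<Union>n. E n)" by blast
  moreover have "measure N (- (\<Union>n. E n)) = 0" unfolding measure_def E(3) by simp
  ultimately have "(\<lambda>n. measure N (- E n)) \<longlonglongrightarrow> 0" by (simp only:)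
  then have "\<forall>\<^sub>F n in sequentially. measure N (- E n) < e / 2"
    by (rule order_tendstoD) (use e in simp)
  then obtain n where n: "measure N (- E n) < e / 2" by (meson eventually_happens' sequentially_bot)
  have "e / 2 > 0" using e by simp
  then obtain L where L: "compact L" "L \<subseteq> E n" "emeasure N (E n - L) < ennreal (e / 2)"
    using N(1) E(2)[of n] unfolding rc_regular_def by blast
  have Ls: "L \<in> sets N" using L(1) Ns by (simp add: compact_imp_closed)
  have "- L = (- E n) \<union> (E n - L)" using L(2) by blast
  then have "emeasure N (- L) \<le> emeasure N (- E n) + emeasure N (E n - L)"
    using emeasure_subadditive[OF Ec[of n], of "E n - L"] Es Ls by simp
  also have "\<dots> < ennreal (e / 2) + ennreal (e / 2)"
    using n e L(3) by (intro add_strict_mono) (simp_all add: emeasure_eq_measure ennreal_lessI)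
  also have "\<dots> = ennreal e" using e by (simp add: ennreal_plus[symmetric] del: ennreal_plus)
  finally show ?thesis using L(1) by blast
qed

lemma zero_if_norm_le_eps: "(\<And>e::real. 0 < e \<Longrightarrow> e \<le> 1 \<Longrightarrow> norm z \<le> B * e) \<Longrightarrow> z = 0"
  for z :: "'a::real_normed_vector"
proof (rule ccontr)
  assume *: "\<And>e::real. 0 < e \<Longrightarrow> e \<le> 1 \<Longrightarrow> norm z \<le> B * e" and z: "z \<noteq> 0"
  have "norm z > 0" using z by simp
  then have B: "B > 0" using *[of 1] by linarith
  define e where "e = min 1 (norm z / (2 * B))"
  have "0 < e" "e \<le> 1" using B z by (auto simp: e_def)
  then have "norm z \<le> B * e" by (rule *)
  also have "\<dots> \<le> B * (norm z / (2 * B))" using B by (intro mult_left_mono) (auto simp: e_def)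
  also have "\<dots> = norm z / 2" using B by simp
  finally show False using z by simp
qed

text \<open>
  A finite measure on the dual group is determined by its integrals of characters. For a compact set \<open>K0\<close>
  almost all of the mass outside \<open>K0\<close> lies on a compact set \<open>K1\<close>, and a trigonometric polynomial that is
  bounded everywhere, close to \<open>1\<close> on \<open>K0\<close> and close to \<open>0\<close> on \<open>K1\<close> approximates the indicator of \<open>K0\<close>.
\<close>

lemma L1_functional_zero_on_trig_poly:
  fixes N :: "'a::topological_ab_group_add character measure"
  assumes N: "rc_regular N" "emeasure N UNIV < \<infinity>" and \<Phi>: "L1_functional N \<Phi>"
    and zero: "\<And>x. \<Phi> (\<lambda>\<xi>. char_apply \<xi> x) = 0" and f: "integrable N f"
  shows "\<Phi> f = 0"
proof -
  have Ns: "sets N = sets borel" using N(1) by (simp add: rc_regular_def)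
  have sp: "space N = UNIV" using sets_eq_imp_space_eq[OF Ns] by simp
  interpret finite_measure N using N(2) sp by (intro finite_measureI) auto
  obtain C where C: "C > 0" "\<And>f. integrable N f \<Longrightarrow> norm (\<Phi> f) \<le> C * (\<integral>x. norm (f x) \<partial>N)"
    using L1_functional_bound[OF \<Phi>] by blast
  have int: "integrable N p" if p: "p \<in> trig_poly" for p
  proof -
    obtain M where M: "\<And>\<xi>. norm (p \<xi>) \<le> M" using trig_poly_bounded[OF p] by blast
    have "p \<in> borel_measurable N"
      using borel_measurable_continuous_onI[OF trig_poly_continuous[OF p]]
      by (simp add: measurable_cong_sets[OF Ns refl])
    then show ?thesis using M by (intro integrable_const_bound[of _ M]) auto
  qed
  have trig0: "\<Phi> p = 0" if "p \<in> trig_poly" for p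
    using that
  proof induction
    case (add p q) then show ?case using L1_functional_add[OF \<Phi> int int] by simp
  next
    case (scale p c) then show ?case using L1_functional_cmult[OF \<Phi> int] by simp
  qed (rule zero)
  have indint: "integrable N (indicator A :: _ \<Rightarrow> complex)" if "A \<in> rc_borel" for A
    by (rule rc_regular_integrable_indicator[OF N(1) that])
  have cmp: "\<Phi> (indicator K0) = 0" if K0: "compact K0" for K0
  proof (rule zero_if_norm_le_eps)
    fix e :: real assume e: "0 < e" "e \<le> 1"
    obtain L where L: "compact L" "emeasure N (- L) < ennreal e"
      using rc_regular_finite_compact[OF N e(1)] by blast
    have LK: "L - K0 \<in> rc_borel"
      by (intro rc_borel_Diff compact_rc_borel L(1)) (simp add: K0 compact_imp_closed)
    then obtain K1 where K1: "compact K1" "K1 \<subseteq> L - K0" "emeasure N (L - K0 - K1) < ennreal e"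
      using N(1) e(1) unfolding rc_regular_def by blast
    obtain q where q: "q \<in> trig_poly" "\<And>\<xi>. norm (q \<xi>) \<le> 1 + e" "\<And>\<xi>. \<xi> \<in> K0 \<Longrightarrow> norm (q \<xi> - 1) \<le> e"
      "\<And>\<xi>. \<xi> \<in> K1 \<Longrightarrow> norm (q \<xi>) \<le> e"
      using trig_poly_Urysohn[OF K0 K1(1) _ e(1)] K1(2) by blast
    \<comment> \<open>Off \<open>?R\<close> the polynomial is within \<open>e\<close> of the indicator, and on \<open>?R\<close> within \<open>1 + e\<close>, but \<open>?R\<close> is small.\<close>
    let ?R = "- L \<union> (L - K0 - K1)"
    have cl: "L \<in> sets N" "K0 \<in> sets N" "K1 \<in> sets N"
      using Ns L(1) K0 K1(1) by (simp_all add: compact_imp_closed)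
    have Lc: "- L \<in> sets N" using Ns L(1) by (simp add: compact_imp_closed borel_comp)
    have R: "?R \<in> sets N" using cl Lc by (intro sets.Un sets.Diff)
    have mR: "measure N ?R \<le> 2 * e"
    proof -
      have "measure N ?R \<le> measure N (- L) + measure N (L - K0 - K1)"
        using cl Lc by (intro measure_subadditive) (auto simp: emeasure_eq_measure)
      also have "\<dots> \<le> e + e"
        using L(2) K1(3) e(1) by (intro add_mono) (auto simp: emeasure_eq_measure ennreal_less_iff)
      finally show ?thesis by simp
    qed
    have pt: "norm (q \<xi> - indicator K0 \<xi>) \<le> e + 2 * indicator ?R \<xi>" for \<xi>
    proof (cases "\<xi> \<in> K0")
      case True
      then have "norm (q \<xi> - indicator K0 \<xi>) \<le> e" using q(3) by simp
      also have "\<dots> \<le> e + 2 * indicator ?R \<xi>" by (simp add: indicator_def)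
      finally show ?thesis .
    next
      case nK0: False
      show ?thesis
      proof (cases "\<xi> \<in> K1")
        case True
        then have "norm (q \<xi> - indicator K0 \<xi>) \<le> e" using q(4) nK0 by simp
        also have "\<dots> \<le> e + 2 * indicator ?R \<xi>" by (simp add: indicator_def)
        finally show ?thesis .
      next
        case False
        then show ?thesis using nK0 q(2)[of \<xi>] by (auto simp: indicator_def)
      qed
    qed
    have iq: "integrable N (\<lambda>\<xi>. q \<xi> - indicator K0 \<xi>)"
      by (intro Bochner_Integration.integrable_diff int q(1) indint compact_rc_borel K0)
    have "(\<integral>\<xi>. norm (q \<xi> - indicator K0 \<xi>) \<partial>N) \<le> (\<integral>\<xi>. e + 2 * indicator ?R \<xi> \<partial>N)"
    proof (rule integral_mono[OF integrable_norm[OF iq]])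
      show "integrable N (\<lambda>\<xi>. e + 2 * indicator ?R \<xi>)" using R by (simp add: less_top[symmetric])
    qed (rule pt)
    also have "\<dots> = e * measure N UNIV + 2 * measure N ?R"
      using R sp by (subst Bochner_Integration.integral_add) (auto simp: less_top[symmetric])
    also have "\<dots> \<le> e * measure N UNIV + 2 * (2 * e)" using mR by simp
    also have "\<dots> = (measure N UNIV + 4) * e" by (simp add: algebra_simps)
    finally have le: "(\<integral>\<xi>. norm (q \<xi> - indicator K0 \<xi>) \<partial>N) \<le> (measure N UNIV + 4) * e" .
    have "norm (\<Phi> (indicator K0)) = norm (\<Phi> (\<lambda>\<xi>. q \<xi> - indicator K0 \<xi>))"
      using L1_functional_diff[OF \<Phi> int[OF q(1)] indint[OF compact_rc_borel[OF K0]]] trig0[OF q(1)] by simp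
    also have "\<dots> \<le> C * ((measure N UNIV + 4) * e)"
      using C(2)[OF iq] mult_left_mono[OF le, of C] C(1) by linarith
    finally show "norm (\<Phi> (indicator K0)) \<le> (C * (measure N UNIV + 4)) * e" by (simp add: mult.assoc)
  qed
  have "\<Phi> (indicator A) = 0" if A: "A \<in> rc_borel" for A
  proof (rule zero_if_norm_le_eps)
    fix e :: real assume e: "0 < e" "e \<le> 1"
    obtain K where K: "compact K" "K \<subseteq> A" "emeasure N (A - K) < ennreal e"
      using N(1) A e(1) unfolding rc_regular_def by blast
    have As: "A \<in> sets N" "K \<in> sets N" using Ns rc_borel_sets[OF A] K(1) by (simp_all add: compact_imp_closed)
    have d: "indicator A \<xi> - indicator K \<xi> = (indicator (A - K) \<xi> :: complex)" for \<xi>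
      using K(2) by (auto simp: indicator_def)
    have i: "integrable N (\<lambda>\<xi>. indicator A \<xi> - indicator K \<xi> :: complex)"
      by (intro Bochner_Integration.integrable_diff indint A compact_rc_borel K(1))
    have "norm (\<Phi> (indicator A)) = norm (\<Phi> (\<lambda>\<xi>. indicator A \<xi> - indicator K \<xi>))"
      using L1_functional_diff[OF \<Phi> indint[OF A] indint[OF compact_rc_borel[OF K(1)]]] cmp[OF K(1)] by simp
    also have "\<dots> \<le> C * (\<integral>\<xi>. norm (indicator A \<xi> - indicator K \<xi> :: complex) \<partial>N)" by (rule C(2)[OF i])
    also have "(\<integral>\<xi>. norm (indicator A \<xi> - indicator K \<xi> :: complex) \<partial>N) = (\<integral>\<xi>. indicator (A - K) \<xi> \<partial>N)"
      unfolding d by (intro Bochner_Integration.integral_cong) (auto simp: indicator_def)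
    also have "\<dots> = measure N (A - K)" using As sp by simp
    also have "C * \<dots> \<le> C * e"
      using K(3) e(1) C(1) by (intro mult_left_mono) (auto simp: emeasure_eq_measure ennreal_less_iff)
    finally show "norm (\<Phi> (indicator A)) \<le> C * e" .
  qed
  then show ?thesis
  proof -
    assume *: "\<And>A. A \<in> rc_borel \<Longrightarrow> \<Phi> (indicator A) = 0"
    have z: "L1_functional N (\<lambda>f. 0)" by (auto simp: L1_functional_def)
    have "rc_carried N" using N(1) by (simp add: rc_regular_def)
    from L1_functional_eqI[OF Ns this \<Phi> z * f] show ?thesis by simp
  qed
qed

text \<open>
  The sum of two positive measures, as a common domain for the functionals of two complex measures.
\<close>

definition borel_plus :: "'a::topological_space measure \<Rightarrow> 'a measure \<Rightarrow> 'a measure" where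
  "borel_plus M N = measure_of UNIV (sets borel) (\<lambda>A. emeasure M A + emeasure N A)"

lemma sets_borel_plus [simp]: "sets (borel_plus M N) = sets borel"
  unfolding borel_plus_def using sets.sigma_sets_eq[of borel] by simp

lemma emeasure_borel_plus:
  assumes M: "sets M = sets borel" and N: "sets N = sets borel" and A: "A \<in> sets borel"
  shows "emeasure (borel_plus M N) A = emeasure M A + emeasure N A"
  unfolding borel_plus_def
proof (rule emeasure_measure_of_sigma[OF _ _ _ A])
  show "sigma_algebra UNIV (sets (borel :: 'a measure))"
    using sets.sigma_algebra_axioms[of borel] by simp
  show "positive (sets borel) (\<lambda>A. emeasure M A + emeasure N A)" by (simp add: positive_def)
  show "countably_additive (sets borel) (\<lambda>A. emeasure M A + emeasure N A)"
  proof (rule countably_additiveI)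
    fix S :: "nat \<Rightarrow> 'a set" assume S: "range S \<subseteq> sets borel" "disjoint_family S"
    have "(\<Sum>i. emeasure M (S i) + emeasure N (S i)) = (\<Sum>i. emeasure M (S i)) + (\<Sum>i. emeasure N (S i))"
      by (rule suminf_add[symmetric]) simp_all
    also have "(\<Sum>i. emeasure M (S i)) = emeasure M (\<Union>i. S i)"
      using S M by (intro suminf_emeasure) auto
    also have "(\<Sum>i. emeasure N (S i)) = emeasure N (\<Union>i. S i)"
      using S N by (intro suminf_emeasure) auto
    finally show "(\<Sum>i. emeasure M (S i) + emeasure N (S i)) = emeasure M (\<Union>i. S i) + emeasure N (\<Union>i. S i)" .
  qed
qed

lemma rc_regular_borel_plus:
  fixes M N :: "'a::t2_space measure"
  assumes M: "rc_regular M" and N: "rc_regular N"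
  shows "rc_regular (borel_plus M N)"
proof -
  have Ms: "sets M = sets borel" and Ns: "sets N = sets borel" using M N by (simp_all add: rc_regular_def)
  note em = emeasure_borel_plus[OF Ms Ns]
  show ?thesis
    unfolding rc_regular_def
  proof (intro conjI ballI allI impI)
    fix A :: "'a set" assume A: "A \<in> rc_borel"
    show "emeasure (borel_plus M N) A < \<infinity>"
      using M N A by (simp add: em[OF rc_borel_sets[OF A]] rc_regular_def)
    fix e :: real assume e: "e > 0"
    then have e2: "e / 2 > 0" by simp
    obtain K where K: "compact K" "K \<subseteq> A" "emeasure M (A - K) < ennreal (e / 2)"
      using M A e2 unfolding rc_regular_def by meson
    obtain L where L: "compact L" "L \<subseteq> A" "emeasure N (A - L) < ennreal (e / 2)"
      using N A e2 unfolding rc_regular_def by meson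
    have s: "A \<in> sets borel" "K \<in> sets borel" "L \<in> sets borel"
      using rc_borel_sets[OF A] K(1) L(1) by (simp_all add: compact_imp_closed)
    have "emeasure (borel_plus M N) (A - (K \<union> L)) = emeasure M (A - (K \<union> L)) + emeasure N (A - (K \<union> L))"
      using s by (intro em) auto
    also have "\<dots> \<le> emeasure M (A - K) + emeasure N (A - L)"
      using s Ms Ns by (intro add_mono emeasure_mono) auto
    also have "\<dots> < ennreal (e / 2) + ennreal (e / 2)" by (rule add_strict_mono[OF K(3) L(3)])
    also have "\<dots> = ennreal e" using e by (simp add: ennreal_plus[symmetric] del: ennreal_plus)
    finally have "emeasure (borel_plus M N) (A - (K \<union> L)) < ennreal e" .
    then show "\<exists>K. compact K \<and> K \<subseteq> A \<and> emeasure (borel_plus M N) (A - K) < ennreal e"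
      using compact_Un[OF K(1) L(1)] K(2) L(2) by (intro exI[of _ "K \<union> L"]) simp
  next
    have cM: "rc_carried M" and cN: "rc_carried N" using M N by (simp_all add: rc_regular_def)
    obtain E :: "nat \<Rightarrow> 'a set" where E: "range E \<subseteq> rc_borel" "emeasure M (- (\<Union>n. E n)) = 0"
      using cM by (auto simp: rc_carried_def)
    obtain F :: "nat \<Rightarrow> 'a set" where F: "range F \<subseteq> rc_borel" "emeasure N (- (\<Union>n. F n)) = 0"
      using cN by (auto simp: rc_carried_def)
    have sE: "(\<Union>n. E n) \<in> sets borel" using E(1) rc_borel_sets by (intro sets.countable_UN) blast
    have sF: "(\<Union>n. F n) \<in> sets borel" using F(1) rc_borel_sets by (intro sets.countable_UN) blast
    have U: "\<Union>(range E \<union> range F) = (\<Union>n. E n) \<union> (\<Union>n. F n)" by blast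
    have "emeasure M (- ((\<Union>n. E n) \<union> (\<Union>n. F n))) \<le> emeasure M (- (\<Union>n. E n))"
      by (rule emeasure_mono) (use borel_comp[OF sE] Ms in auto)
    moreover have "emeasure N (- ((\<Union>n. E n) \<union> (\<Union>n. F n))) \<le> emeasure N (- (\<Union>n. F n))"
      by (rule emeasure_mono) (use borel_comp[OF sF] Ns in auto)
    ultimately have "emeasure (borel_plus M N) (- ((\<Union>n. E n) \<union> (\<Union>n. F n))) = 0"
      using E(2) F(2) em[OF borel_comp[OF sets.Un[OF sE sF]]] by simp
    then show "rc_carried (borel_plus M N)"
      using E(1) F(1) unfolding U[symmetric] by (intro rc_carried_countable[of "range E \<union> range F"]) auto
  qed simp
qed

lemma L1_functional_borel_plus:
  assumes M: "sets M = sets borel" and N: "sets N = sets borel"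
  shows "L1_functional M \<Phi> \<Longrightarrow> L1_functional (borel_plus M N) \<Phi>"
    and "L1_functional N \<Phi> \<Longrightarrow> L1_functional (borel_plus M N) \<Phi>"
proof -
  have "M \<le> borel_plus M N" "N \<le> borel_plus M N"
    using M N by (subst le_measure; simp add: emeasure_borel_plus)+
  note le = nn_integral_mono_measure[OF _ this(1)] nn_integral_mono_measure[OF _ this(2)]
  show "L1_functional M \<Phi> \<Longrightarrow> L1_functional (borel_plus M N) \<Phi>"
    by (erule L1_functional_mono[where C = 1]) (use M le in auto)
  show "L1_functional N \<Phi> \<Longrightarrow> L1_functional (borel_plus M N) \<Phi>"
    by (erule L1_functional_mono[where C = 1]) (use N le in auto)
qed

abbreviation fcheck_sq :: "'g::topological_ab_group_add measure \<Rightarrow> ('g \<Rightarrow> complex) \<Rightarrow> 'g character \<Rightarrow> complex" where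
  "fcheck_sq m \<phi> \<xi> \<equiv> complex_of_real ((norm (fcheck m \<phi> \<xi>))\<^sup>2)"

lemma fcheck_sq_borel:
  fixes \<phi> :: "'a::{topological_ab_group_add, t2_space} \<Rightarrow> complex"
  assumes "\<phi> \<in> C_c" "haar_measure m"
  shows "fcheck_sq m \<phi> \<in> borel_measurable borel"
  by (intro borel_measurable_continuous_onI continuous_intros fcheck_continuous assms)

lemma fcheck_sq_bound:
  fixes \<phi> :: "'a::{topological_ab_group_add, t2_space} \<Rightarrow> complex"
  shows "norm (fcheck_sq m \<phi> \<xi>) \<le> (\<integral>x. norm (\<phi> x) \<partial>m)\<^sup>2"
  unfolding norm_of_real abs_power2 by (intro power_mono norm_fcheck_le) simp

lemma fcheck_sq_integrable:
  assumes "square_integrable M (fcheck m \<phi>)"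
  shows "integrable M (fcheck_sq m \<phi>)"
  using assms by (intro integrable_of_real) (simp add: square_integrable_def)

lemma integrable_mult_bounded:
  fixes g h :: "'a \<Rightarrow> complex"
  assumes g: "integrable M g" and h: "h \<in> borel_measurable M" "\<And>x. norm (h x) \<le> B"
  shows "integrable M (\<lambda>x. g x * h x)"
proof (rule Bochner_Integration.integrable_bound)
  show "integrable M (\<lambda>x. B * norm (g x))" using g by simp
  show "(\<lambda>x. g x * h x) \<in> borel_measurable M" using g h(1) by measurable
  have "norm (g x * h x) \<le> norm (B * norm (g x))" for x
  proof -
    have "norm (h x) * norm (g x) \<le> B * norm (g x)" by (intro mult_right_mono h(2)) simp
    then show ?thesis by (simp add: norm_mult mult.commute)
  qed
  then show "AE x in M. norm (g x * h x) \<le> norm (B * norm (g x))" by simp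
qed

text \<open>
  The open sets where the transforms do not vanish cover \<open>K\<close>; finitely many suffice, and the corresponding
  sum of squares is continuous and positive on \<open>K\<close>.
\<close>

lemma compact_fcheck_lower_bound:
  fixes m :: "'a::{topological_ab_group_add, t2_space} measure" and K :: "'a character set"
  assumes m: "haar_measure m" and \<phi>: "\<And>n::nat. \<phi> n \<in> C_c" "\<And>\<xi>. \<exists>n. fcheck m (\<phi> n) \<xi> \<noteq> 0" and K: "compact K"
  shows "\<exists>I c. finite I \<and> c > 0 \<and> (\<forall>\<xi>\<in>K. c \<le> (\<Sum>n\<in>I. (norm (fcheck m (\<phi> n) \<xi>))\<^sup>2))"
proof (cases "K = {}")
  case True
  then show ?thesis by (intro exI[of _ "{}"] exI[of _ 1]) simp
next
  case False
  define U where "U n = {\<xi>. fcheck m (\<phi> n) \<xi> \<noteq> 0}" for n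
  have oU: "open (U n)" for n
    unfolding U_def by (intro open_Collect_neq fcheck_continuous \<phi> m continuous_intros)
  have "K \<subseteq> (\<Union>n\<in>UNIV. U n)" using \<phi>(2) by (auto simp: U_def)
  from compactE_image[OF K oU this] obtain I where I: "finite I" "K \<subseteq> (\<Union>n\<in>I. U n)" .
  define G where "G \<xi> = (\<Sum>n\<in>I. (norm (fcheck m (\<phi> n) \<xi>))\<^sup>2)" for \<xi>
  have "continuous_on UNIV G" unfolding G_def by (intro continuous_intros fcheck_continuous \<phi> m)
  then have "continuous_on K G" by (rule continuous_on_subset) simp
  from continuous_attains_inf[OF K False this]
  obtain \<xi>0 where \<xi>0: "\<xi>0 \<in> K" "\<And>\<xi>. \<xi> \<in> K \<Longrightarrow> G \<xi>0 \<le> G \<xi>" by blast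
  obtain n where n: "n \<in> I" "fcheck m (\<phi> n) \<xi>0 \<noteq> 0" using \<xi>0(1) I(2) by (auto simp: U_def)
  have "0 < (norm (fcheck m (\<phi> n) \<xi>0))\<^sup>2" using n(2) by simp
  also have "\<dots> \<le> G \<xi>0" unfolding G_def using n(1) I(1) by (intro member_le_sum) auto
  finally show ?thesis using I(1) \<xi>0(2) unfolding G_def by blast
qed

text \<open>
  The finite measure \<open>|\<phi>\<^sup>\<and>|\<^sup>2 (\<mu>1 - \<mu>2)\<close> vanishes: its integral of the character \<open>\<xi> \<mapsto> \<xi>(x)\<close> is the difference of
  two expressions for the integral of one correlation against \<open>\<gamma>\<close>, because multiplication of \<open>\<phi>\<^sup>\<and>\<close> by
  \<open>\<xi>(x)\<close> corresponds to translation of \<open>\<phi>\<close> by \<open>x\<close>.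
\<close>

lemma cintegral_fcheck_sq_unique:
  fixes m :: "'a::{topological_ab_group_add, t2_space, second_countable_topology} measure"
  assumes lc: "locally_compact_space (euclidean :: 'a topology)" and m: "haar_measure m"
    and ft1: "has_fourier_transform m \<gamma> \<mu>1" and ft2: "has_fourier_transform m \<gamma> \<mu>2"
    and \<phi>: "\<phi> \<in> C_c" and h: "h \<in> borel_measurable borel" "\<And>\<xi>. norm (h \<xi>) \<le> B"
  shows "cintegral \<mu>1 (\<lambda>\<xi>. fcheck_sq m \<phi> \<xi> * h \<xi>) = cintegral \<mu>2 (\<lambda>\<xi>. fcheck_sq m \<phi> \<xi> * h \<xi>)"
proof -
  let ?D = "\<lambda>\<mu>. density (total_variation \<mu>) (\<lambda>\<xi>. ennreal (norm (fcheck_sq m \<phi> \<xi>)))"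
  let ?\<Phi> = "\<lambda>\<mu> f. cintegral \<mu> (\<lambda>\<xi>. fcheck_sq m \<phi> \<xi> * f \<xi>)"
  have D: "rc_regular (?D \<mu>)" "emeasure (?D \<mu>) UNIV < \<infinity>" "L1_functional (?D \<mu>) (?\<Phi> \<mu>)"
    if ft: "has_fourier_transform m \<gamma> \<mu>" for \<mu>
  proof -
    note f = has_fourier_transformD[OF ft]
    have gm: "fcheck_sq m \<phi> \<in> borel_measurable (total_variation \<mu>)"
      using fcheck_sq_borel[OF \<phi> m] by (simp add: measurable_cong_sets[OF sets_total_variation refl])
    show "rc_regular (?D \<mu>)"
      by (rule rc_regular_density[OF tv_rc_regular[OF f(2) fourier_transform_carried[OF lc m ft]] fcheck_sq_borel[OF \<phi> m] fcheck_sq_bound])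
    have "emeasure (?D \<mu>) UNIV = (\<integral>\<^sup>+\<xi>. ennreal (norm (fcheck_sq m \<phi> \<xi>)) \<partial>total_variation \<mu>)"
      using gm by (subst emeasure_density) auto
    also have "\<dots> < \<infinity>"
      using fcheck_sq_integrable[OF f(3)[OF \<phi>]] by (simp only: integrable_iff_bounded)
    finally show "emeasure (?D \<mu>) UNIV < \<infinity>" .
    show "L1_functional (?D \<mu>) (?\<Phi> \<mu>)"
      by (rule L1_functional_density[OF cintegral_L1_functional[OF f(2)] gm])
  qed
  note D1 = D[OF ft1] and D2 = D[OF ft2]
  let ?N = "borel_plus (?D \<mu>1) (?D \<mu>2)"
  have s: "sets (?D \<mu>) = sets borel" for \<mu> by simp
  have N: "rc_regular ?N" by (rule rc_regular_borel_plus[OF D1(1) D2(1)])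
  have "emeasure ?N UNIV = emeasure (?D \<mu>1) UNIV + emeasure (?D \<mu>2) UNIV"
    by (rule emeasure_borel_plus[OF s s]) simp
  with D1(2) D2(2) have Nfin: "emeasure ?N UNIV < \<infinity>"
    by (simp only: infinity_ennreal_def ennreal_add_less_top)
  have L: "L1_functional ?N (\<lambda>f. ?\<Phi> \<mu>1 f + (- 1) * ?\<Phi> \<mu>2 f)"
    by (intro L1_functional_lincomb L1_functional_borel_plus(1)[OF s s D1(3)] L1_functional_borel_plus(2)[OF s s D2(3)])
  have ch: "?\<Phi> \<mu> (\<lambda>\<xi>. char_apply \<xi> x) = cintegral \<gamma> (correlation m (\<lambda>y. \<phi> (y - x)) \<phi>)"
    if ft: "has_fourier_transform m \<gamma> \<mu>" for \<mu> x
  proof -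
    have "(\<lambda>\<xi>. fcheck_sq m \<phi> \<xi> * char_apply \<xi> x) = (\<lambda>\<xi>. fcheck m (\<lambda>y. \<phi> (y - x)) \<xi> * cnj (fcheck m \<phi> \<xi>))"
      by (intro ext) (simp only: complex_norm_square fcheck_translate[OF \<phi> m] mult_ac)
    then show ?thesis
      by (simp only: fourier_transform_polarized[OF m ft C_c_translate[OF \<phi>] \<phi>])
  qed
  have zero: "?\<Phi> \<mu>1 (\<lambda>\<xi>. char_apply \<xi> x) + (- 1) * ?\<Phi> \<mu>2 (\<lambda>\<xi>. char_apply \<xi> x) = 0" for x
    unfolding ch[OF ft1] ch[OF ft2] by simp
  have "space ?N = UNIV" using sets_eq_imp_space_eq[OF sets_borel_plus] by simp
  then interpret finite_measure ?N using Nfin by (intro finite_measureI) auto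
  have "h \<in> borel_measurable ?N" using h(1) by (simp add: measurable_cong_sets[OF sets_borel_plus refl])
  then have "integrable ?N h" using h(2) by (intro integrable_const_bound[of _ B]) auto
  from L1_functional_zero_on_trig_poly[OF N Nfin L zero this] show ?thesis by simp
qed

text \<open>
  On a compact set \<open>K\<close> a finite sum \<open>G\<close> of functions \<open>|\<phi>\<^sub>n\<^sup>\<and>|\<^sup>2\<close> is bounded below, so the indicator of \<open>K\<close> is a
  combination of the functions \<open>|\<phi>\<^sub>n\<^sup>\<and>|\<^sup>2 h\<close> with the bounded function \<open>h = 1\<^sub>K / G\<close>. Hence the two measures
  agree on compact sets, and by inner regularity everywhere.
\<close>

theorem fourier_transform_unique:
  fixes m :: "'a::{topological_ab_group_add, t2_space, second_countable_topology} measure"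
  assumes lc: "locally_compact_space (euclidean :: 'a topology)" and m: "haar_measure m"
    and ft1: "has_fourier_transform m \<gamma> \<mu>1" and ft2: "has_fourier_transform m \<gamma> \<mu>2"
  shows "\<mu>1 = \<mu>2"
proof
  obtain \<phi> :: "nat \<Rightarrow> 'a \<Rightarrow> complex" where \<phi>: "\<And>n. \<phi> n \<in> C_c" "\<And>\<xi>. \<exists>n. fcheck m (\<phi> n) \<xi> \<noteq> 0"
    using fcheck_nonvanishing[OF lc m] by blast
  note f1 = has_fourier_transformD[OF ft1] and f2 = has_fourier_transformD[OF ft2]
  have cmp: "\<mu>1 K = \<mu>2 K" if K: "compact K" for K
  proof -
    obtain I c where I: "finite I" "c > 0" "\<And>\<xi>. \<xi> \<in> K \<Longrightarrow> c \<le> (\<Sum>n\<in>I. (norm (fcheck m (\<phi> n) \<xi>))\<^sup>2)"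
      using compact_fcheck_lower_bound[OF m \<phi> K] by blast
    define G where "G \<xi> = (\<Sum>n\<in>I. (norm (fcheck m (\<phi> n) \<xi>))\<^sup>2)" for \<xi>
    define h where "h \<xi> = (indicator K \<xi> * complex_of_real (inverse (G \<xi>)))" for \<xi>
    have "continuous_on UNIV G" unfolding G_def by (intro continuous_intros fcheck_continuous \<phi> m)
    then have [measurable]: "G \<in> borel_measurable borel" by (rule borel_measurable_continuous_onI)
    have [measurable]: "K \<in> sets borel" using K by (simp add: compact_imp_closed)
    have hm: "h \<in> borel_measurable borel" unfolding h_def by measurable
    have hb: "norm (h \<xi>) \<le> inverse c" for \<xi>
    proof (cases "\<xi> \<in> K")
      case True
      then have "c \<le> G \<xi>" using I(3) by (simp add: G_def)
      then show ?thesis using True I(2) le_imp_inverse_le[of c "G \<xi>"] by (simp add: h_def norm_mult norm_inverse)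
    qed (use I(2) in \<open>simp add: h_def\<close>)
    have ind: "indicator K = (\<lambda>\<xi>. \<Sum>n\<in>I. fcheck_sq m (\<phi> n) \<xi> * h \<xi>)"
    proof
      fix \<xi>
      have "(\<Sum>n\<in>I. fcheck_sq m (\<phi> n) \<xi> * h \<xi>) = complex_of_real (G \<xi>) * h \<xi>"
        by (simp add: G_def sum_distrib_right)
      also have "\<dots> = indicator K \<xi>"
      proof (cases "\<xi> \<in> K")
        case True
        then have "G \<xi> \<noteq> 0" using I(2,3) by (fastforce simp: G_def)
        then show ?thesis using True by (simp add: h_def)
      qed (simp add: h_def)
      finally show "indicator K \<xi> = (\<Sum>n\<in>I. fcheck_sq m (\<phi> n) \<xi> * h \<xi>)" ..
    qed
    have eq: "\<mu> K = (\<Sum>n\<in>I. cintegral \<mu> (\<lambda>\<xi>. fcheck_sq m (\<phi> n) \<xi> * h \<xi>))"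
      if ft: "has_fourier_transform m \<gamma> \<mu>" for \<mu>
    proof -
      note f = has_fourier_transformD[OF ft]
      have hm': "h \<in> borel_measurable (total_variation \<mu>)"
        using hm by (simp add: measurable_cong_sets[OF sets_total_variation refl])
      have "integrable (total_variation \<mu>) (\<lambda>\<xi>. fcheck_sq m (\<phi> n) \<xi> * h \<xi>)" for n
        by (rule integrable_mult_bounded[OF fcheck_sq_integrable[OF f(3)[OF \<phi>(1)]] hm' hb])
      then have "cintegral \<mu> (\<lambda>\<xi>. \<Sum>n\<in>I. fcheck_sq m (\<phi> n) \<xi> * h \<xi>) = (\<Sum>n\<in>I. cintegral \<mu> (\<lambda>\<xi>. fcheck_sq m (\<phi> n) \<xi> * h \<xi>))"
        by (rule L1_functional_sum[OF cintegral_L1_functional[OF f(2)]])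
      then show ?thesis using cintegral_indicator[OF f(2) compact_rc_borel[OF K]] by (simp only: ind[symmetric])
    qed
    show ?thesis
      unfolding eq[OF ft1] eq[OF ft2]
      by (intro sum.cong refl cintegral_fcheck_sq_unique[OF lc m ft1 ft2 \<phi>(1) hm hb])
  qed
  fix A
  show "\<mu>1 A = \<mu>2 A"
  proof (cases "A \<in> rc_borel")
    case A: True
    have approx: "\<exists>K. compact K \<and> K \<subseteq> A \<and> emeasure (total_variation \<mu>) (A - K) < ennreal e"
      if "complex_radon_measure \<mu>" "e > 0" for \<mu> :: "'a character cmeasure" and e
      using that A by (simp add: complex_radon_measure_def)
    have dist: "norm (\<mu> A - \<mu> K) \<le> e"
      if \<mu>: "complex_radon_measure \<mu>" and K: "compact K" "L \<subseteq> K" "K \<subseteq> A" "compact L" and e: "e > 0" "emeasure (total_variation \<mu>) (A - L) < ennreal e"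
      for \<mu> :: "'a character cmeasure" and K L e
    proof -
      have Ks: "K \<in> sets borel" "L \<in> sets borel" using K by (simp_all add: compact_imp_closed)
      have "\<mu> A - \<mu> K = \<mu> (A - K)" by (rule complex_radon_Diff[OF \<mu> A Ks(1) K(3), symmetric])
      then have "ennreal (norm (\<mu> A - \<mu> K)) \<le> emeasure (total_variation \<mu>) (A - K)"
        using norm_le_tv[OF \<mu> rc_borel_Diff[OF A Ks(1)]] by simp
      also have "\<dots> \<le> emeasure (total_variation \<mu>) (A - L)"
        using K(2) Ks rc_borel_sets[OF A] by (intro emeasure_mono) auto
      also have "\<dots> \<le> ennreal e" using e(2) by simp
      finally show ?thesis using e(1) by (simp add: ennreal_le_iff)
    qed
    have "\<mu>1 A - \<mu>2 A = 0"
    proof (rule zero_if_norm_le_eps)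
      fix e :: real assume e: "0 < e" "e \<le> 1"
      obtain K1 where K1: "compact K1" "K1 \<subseteq> A" "emeasure (total_variation \<mu>1) (A - K1) < ennreal e"
        using approx[OF f1(2) e(1)] by blast
      obtain K2 where K2: "compact K2" "K2 \<subseteq> A" "emeasure (total_variation \<mu>2) (A - K2) < ennreal e"
        using approx[OF f2(2) e(1)] by blast
      let ?K = "K1 \<union> K2"
      have K: "compact ?K" "?K \<subseteq> A" using K1 K2 by (auto intro: compact_Un)
      have "norm (\<mu>1 A - \<mu>1 ?K) \<le> e" by (rule dist[OF f1(2) K(1) _ K(2) K1(1) e(1) K1(3)]) simp
      moreover have "norm (\<mu>2 A - \<mu>2 ?K) \<le> e" by (rule dist[OF f2(2) K(1) _ K(2) K2(1) e(1) K2(3)]) simp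
      moreover have eq: "\<mu>1 A - \<mu>2 A = (\<mu>1 A - \<mu>1 ?K) - (\<mu>2 A - \<mu>2 ?K)" using cmp[OF K(1)] by simp
      ultimately show "norm (\<mu>1 A - \<mu>2 A) \<le> 2 * e"
        using norm_triangle_ineq4[of "\<mu>1 A - \<mu>1 ?K" "\<mu>2 A - \<mu>2 ?K"] unfolding eq by argo
    qed
    then show ?thesis by simp
  next
    case False
    then show ?thesis using f1(2) f2(2) by (simp add: complex_radon_measure_def)
  qed
qed

section \<open>Ping and pong\<close>

text \<open>
  A second countable locally compact space is covered by countably many relatively compact open sets.
\<close>

lemma tv_carried_lc:
  fixes \<mu> :: "'a::{t2_space, second_countable_topology} cmeasure"
  assumes lc: "locally_compact_space (euclidean :: 'a topology)" and \<mu>: "complex_radon_measure \<mu>"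
  shows "rc_carried (total_variation \<mu>)"
proof -
  let ?F = "{V :: 'a set. open V \<and> (\<exists>K. compact K \<and> V \<subseteq> K)}"
  obtain \<F> where F: "\<F> \<subseteq> ?F" "countable \<F>" "\<Union>\<F> = \<Union>?F"
    using Lindelof[of ?F] by blast
  have "\<exists>V K. open V \<and> compact K \<and> x \<in> V \<and> V \<subseteq> K" for x :: 'a
    using lc unfolding locally_compact_space_def by simp
  then have "\<Union>?F = UNIV" by blast
  moreover have "V \<in> sets borel \<and> emeasure (total_variation \<mu>) V < \<infinity>" if V: "V \<in> \<F>" for V
  proof -
    have o: "open V" using V F(1) by blast
    obtain K where K: "compact K" "V \<subseteq> K" using V F(1) by blast
    have "V \<in> rc_borel" using o by (intro rc_borel_subset[OF compact_rc_borel[OF K(1)] _ K(2)]) simp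
    then show ?thesis using tv_finite[OF \<mu>] o by simp
  qed
  ultimately show ?thesis using F(2,3) by (intro tv_carried[OF \<mu>, of \<F>]) auto
qed

context
  fixes \<nu> :: "'g::{topological_ab_group_add, t2_space, first_countable_topology} character cmeasure"
  assumes \<nu>: "finite_complex_measure \<nu>"
begin

private lemma \<nu>_radon: "complex_radon_measure \<nu>"
  and \<nu>_finite: "emeasure (total_variation \<nu>) UNIV < \<infinity>"
  using \<nu> by (auto simp: finite_complex_measure_def)

lemma finite_tv: "finite_measure (total_variation \<nu>)"
  using \<nu>_finite by (intro finite_measureI) auto

lemma integrable_bounded_tv:
  fixes f :: "'g character \<Rightarrow> complex"
  assumes "f \<in> borel_measurable borel" "\<And>\<xi>. norm (f \<xi>) \<le> B"
  shows "integrable (total_variation \<nu>) f"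
proof -
  have "f \<in> borel_measurable (total_variation \<nu>)"
    using assms(1) by (simp add: measurable_cong_sets[OF sets_total_variation refl])
  then show ?thesis
    using assms(2) by (intro finite_measure.integrable_const_bound[OF finite_tv, of _ B]) auto
qed

lemma char_eval_borel: "(\<lambda>\<xi>. char_apply \<xi> x) \<in> borel_measurable borel"
  by (rule borel_measurable_continuous_onI[OF char_eval_continuous])

lemma mcheck_continuous: "continuous_on UNIV (mcheck \<nu>)"
proof (rule continuous_on_sequentiallyI)
  fix u :: "nat \<Rightarrow> 'g" and a assume u: "u \<longlonglongrightarrow> a"
  have m: "(\<lambda>\<xi>. char_apply \<xi> x) \<in> borel_measurable (total_variation \<nu>)" for x
    using char_eval_borel by (simp add: measurable_cong_sets[OF sets_total_variation refl])
  show "(\<lambda>n. mcheck \<nu> (u n)) \<longlonglongrightarrow> mcheck \<nu> a"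
    unfolding mcheck_def
  proof (rule L1_functional_tendsto[OF cintegral_L1_functional[OF \<nu>_radon] m m, where w = "\<lambda>_. 1"])
    show "integrable (total_variation \<nu>) (\<lambda>_. 1 :: real)"
      by (rule finite_measure.integrable_const[OF finite_tv])
    have "(\<lambda>n. char_apply \<xi> (u n)) \<longlonglongrightarrow> char_apply \<xi> a" for \<xi>
    proof -
      have "isCont (char_apply \<xi>) a"
        using char_apply_continuous[of UNIV \<xi>] by (simp add: continuous_on_eq_continuous_at)
      then show ?thesis using u by (rule isCont_tendsto_compose)
    qed
    then show "AE \<xi> in total_variation \<nu>. (\<lambda>n. char_apply \<xi> (u n)) \<longlonglongrightarrow> char_apply \<xi> a" by simp
  qed simp
qed

lemma mcheck_bounded: "\<exists>M. \<forall>x. norm (mcheck \<nu> x) \<le> M"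
proof -
  obtain C where C: "C > 0" "\<And>f. integrable (total_variation \<nu>) f \<Longrightarrow> norm (cintegral \<nu> f) \<le> C * (\<integral>x. norm (f x) \<partial>total_variation \<nu>)"
    using L1_functional_bound[OF cintegral_L1_functional[OF \<nu>_radon]] by blast
  have "norm (mcheck \<nu> x) \<le> C * (\<integral>\<xi>. norm (char_apply \<xi> x) \<partial>total_variation \<nu>)" for x
    unfolding mcheck_def by (intro C(2) integrable_bounded_tv[of _ 1] char_eval_borel) simp
  then show ?thesis by (intro exI[of _ "C * (\<integral>\<xi>. 1 \<partial>total_variation \<nu>)"]) simp
qed

end

lemma cintegral_pure_point:
  fixes \<mu> :: "'a::t2_space cmeasure"
  assumes \<mu>: "complex_radon_measure \<mu>" "rc_carried (total_variation \<mu>)"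
    and pp: "\<And>A. A \<in> rc_borel \<Longrightarrow> (\<lambda>n. c n * indicator A (x n)) sums \<mu> A"
    and le: "\<And>f. (\<Sum>n. ennreal (norm (c n)) * f (x n)) \<le> (\<integral>\<^sup>+y. f y \<partial>total_variation \<mu>)"
    and f: "integrable (total_variation \<mu>) f"
  shows "(\<lambda>n. c n * f (x n)) sums cintegral \<mu> f"
proof -
  let ?t = "total_variation \<mu>"
  have sm: "summable (\<lambda>n. norm (c n * g (x n)))" "(\<Sum>n. norm (c n * g (x n))) \<le> (\<integral>y. norm (g y) \<partial>?t)"
    if g: "integrable ?t g" for g
  proof -
    define a where "a n = norm (c n * g (x n))" for n
    have a0: "0 \<le> a n" for n by (simp add: a_def)
    have "(\<Sum>n. ennreal (a n)) = (\<Sum>n. ennreal (norm (c n)) * ennreal (norm (g (x n))))"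
      by (simp add: a_def norm_mult ennreal_mult)
    also have "\<dots> \<le> (\<integral>\<^sup>+y. norm (g y) \<partial>?t)" by (rule le)
    also have "\<dots> = ennreal (\<integral>y. norm (g y) \<partial>?t)" using g by (intro nn_integral_eq_integral) auto
    finally have l: "(\<Sum>n. ennreal (a n)) \<le> ennreal (\<integral>y. norm (g y) \<partial>?t)" .
    then have s: "summable a" by (intro summable_suminf_not_top a0) (auto simp: top_unique)
    then show "summable (\<lambda>n. norm (c n * g (x n)))" by (simp add: a_def[abs_def])
    have "(\<Sum>n. ennreal (a n)) = ennreal (\<Sum>n. a n)" by (intro suminf_ennreal2 a0 s)
    with l have "ennreal (\<Sum>n. a n) \<le> ennreal (\<integral>y. norm (g y) \<partial>?t)" by simp
    then have "(\<Sum>n. a n) \<le> (\<integral>y. norm (g y) \<partial>?t)" by (subst (asm) ennreal_le_iff) simp_all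
    then show "(\<Sum>n. norm (c n * g (x n))) \<le> (\<integral>y. norm (g y) \<partial>?t)" by (simp only: a_def)
  qed
  have L: "L1_functional ?t (\<lambda>g. \<Sum>n. c n * g (x n))"
    unfolding L1_functional_def
  proof (intro conjI allI impI exI[of _ 1])
    fix g h :: "'a \<Rightarrow> complex" and s :: complex
    assume g: "integrable ?t g"
    note sg = summable_norm_cancel[OF sm(1)[OF g]]
    have "(\<Sum>n. s * (c n * g (x n))) = s * (\<Sum>n. c n * g (x n))" by (rule suminf_mult[OF sg])
    then show "(\<Sum>n. c n * (s * g (x n))) = s * (\<Sum>n. c n * g (x n))" by (simp only: mult.left_commute[of s])
    show "norm (\<Sum>n. c n * g (x n)) \<le> 1 * (\<integral>y. norm (g y) \<partial>?t)"
      using summable_norm[OF sm(1)[OF g]] sm(2)[OF g] by simp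
    assume h: "integrable ?t h"
    show "(\<Sum>n. c n * (g (x n) + h (x n))) = (\<Sum>n. c n * g (x n)) + (\<Sum>n. c n * h (x n))"
      unfolding distrib_left by (rule suminf_add[OF sg summable_norm_cancel[OF sm(1)[OF h]], symmetric])
  qed simp
  have "(\<Sum>n. c n * f (x n)) = cintegral \<mu> f"
    by (rule L1_functional_eqI[OF sets_total_variation \<mu>(2) L cintegral_L1_functional[OF \<mu>(1)] _ f])
      (simp add: cintegral_indicator[OF \<mu>(1)] sums_unique[OF pp, symmetric])
  with summable_norm_cancel[OF sm(1)[OF f]] show ?thesis by (simp add: sums_iff)
qed

context
  fixes m :: "'g::{topological_ab_group_add, t2_space, second_countable_topology} measure"
    and \<omega> :: "'g cmeasure" and \<omega>h :: "'g character cmeasure"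
  assumes lc: "locally_compact_space (euclidean :: 'g topology)" and m: "haar_measure m"
    and ft: "has_fourier_transform m \<omega> \<omega>h" and pp: "pure_point \<omega>h"
    and ud: "uniformly_discrete (msupp \<omega>)"
begin

private lemma ft':
  "complex_radon_measure \<omega>" "complex_radon_measure \<omega>h"
  "\<And>\<phi>. \<phi> \<in> C_c \<Longrightarrow> square_integrable (total_variation \<omega>h) (fcheck m \<phi>)"
  "\<And>\<phi>. \<phi> \<in> C_c \<Longrightarrow> cintegral \<omega> (correlation m \<phi> \<phi>) = cintegral \<omega>h (fcheck_sq m \<phi>)"
  using has_fourier_transformD[OF ft] by blast+

private lemma \<omega>_carried: "rc_carried (total_variation \<omega>)"
  by (rule tv_carried_lc[OF lc ft'(1)])

lemma cdensity_mcheck: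
  assumes \<nu>: "finite_complex_measure \<nu>"
  shows "complex_radon_measure (cdensity (mcheck \<nu>) \<omega>)"
    and "msupp (cdensity (mcheck \<nu>) \<omega>) \<subseteq> msupp \<omega>"
    and "\<And>f. f \<in> C_c \<Longrightarrow> cintegral (cdensity (mcheck \<nu>) \<omega>) f = cintegral \<omega> (\<lambda>x. mcheck \<nu> x * f x)"
proof -
  obtain M where M: "\<And>x. norm (mcheck \<nu> x) \<le> M" using mcheck_bounded[OF \<nu>] by blast
  have b: "mcheck \<nu> \<in> borel_measurable borel"
    by (rule borel_measurable_continuous_onI[OF mcheck_continuous[OF \<nu>]])
  show "complex_radon_measure (cdensity (mcheck \<nu>) \<omega>)"
    by (rule cdensity_radon[OF ft'(1) \<omega>_carried b M])
  obtain C where C: "\<And>A. A \<in> sets borel \<Longrightarrow> emeasure (total_variation (cdensity (mcheck \<nu>) \<omega>)) A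
      \<le> ennreal C * (\<integral>\<^sup>+x. ennreal (norm (mcheck \<nu> x)) * indicator A x \<partial>total_variation \<omega>)"
    using tv_cdensity_le[OF ft'(1) \<omega>_carried b M] by blast
  have "emeasure (total_variation (cdensity (mcheck \<nu>) \<omega>)) U = 0"
    if U: "open U" "emeasure (total_variation \<omega>) U = 0" for U
  proof -
    have "U \<in> null_sets (total_variation \<omega>)" using U by (intro null_setsI) simp_all
    then have "(\<integral>\<^sup>+x. ennreal (norm (mcheck \<nu> x)) * indicator U x \<partial>total_variation \<omega>) = 0"
      by (rule nn_integral_null_set)
    then show ?thesis using C[of U] U(1) by simp
  qed
  then show "msupp (cdensity (mcheck \<nu>) \<omega>) \<subseteq> msupp \<omega>" by (auto simp: msupp_def)
  fix f :: "'g \<Rightarrow> complex" assume f: "f \<in> C_c"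
  show "cintegral (cdensity (mcheck \<nu>) \<omega>) f = cintegral \<omega> (\<lambda>x. mcheck \<nu> x * f x)"
    by (rule cintegral_cdensity[OF ft'(1) \<omega>_carried b M C_c_borel[OF f]])
      (rule C_c_integrable_tv[OF C_c_mult[OF f mcheck_continuous[OF \<nu>]] ft'(1)])
qed

text \<open>
  Both sides are \<open>\<nu>\<close>-integrals over \<open>\<eta>\<close> of the value at \<open>\<eta>\<phi>\<close> of the identity that defines \<open>\<omega>h\<close>. On
  the left the \<open>\<nu>\<close>-integral is moved through the finite sum over the support of \<open>\<omega>\<close>.
\<close>

lemma cintegral_cdensity_mcheck:
  assumes \<nu>: "finite_complex_measure \<nu>" and \<phi>: "\<phi> \<in> C_c"
  shows "cintegral (cdensity (mcheck \<nu>) \<omega>) (correlation m \<phi> \<phi>) =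
    cintegral \<nu> (\<lambda>\<eta>. cintegral \<omega>h (\<lambda>\<xi>. fcheck_sq m \<phi> (\<eta> + \<xi>)))"
proof -
  let ?g = "correlation m \<phi> \<phi>"
  have g: "?g \<in> C_c" by (rule correlation_C_c[OF m \<phi> \<phi>])
  let ?F = "msupp \<omega> \<inter> fsupp ?g"
  have sum: "cintegral \<omega> (\<lambda>x. f x * ?g x) = (\<Sum>x\<in>?F. \<omega> {x} * (f x * ?g x))"
    if "continuous_on UNIV f" for f
    using cintegral_uniformly_discrete(2)[OF ft'(1) subset_refl ud C_c_compact[OF g]]
      C_c_borel[OF C_c_mult[OF g that]] notin_fsupp[of _ ?g] by simp
  have \<nu>r: "complex_radon_measure \<nu>" using \<nu> by (simp add: finite_complex_measure_def)
  note L = cintegral_L1_functional[OF \<nu>r]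
  have ci: "integrable (total_variation \<nu>) (\<lambda>\<eta>. char_apply \<eta> x)" for x
    by (rule integrable_bounded_tv[OF \<nu> char_eval_borel[OF \<nu>], of _ 1]) simp
  have "cintegral (cdensity (mcheck \<nu>) \<omega>) ?g = cintegral \<omega> (\<lambda>x. mcheck \<nu> x * ?g x)"
    by (rule cdensity_mcheck(3)[OF \<nu> g])
  also have "\<dots> = (\<Sum>x\<in>?F. \<omega> {x} * (mcheck \<nu> x * ?g x))" by (rule sum[OF mcheck_continuous[OF \<nu>]])
  also have "\<dots> = (\<Sum>x\<in>?F. cintegral \<nu> (\<lambda>\<eta>. \<omega> {x} * ?g x * char_apply \<eta> x))"
    unfolding mcheck_def by (intro sum.cong refl) (simp add: L1_functional_cmult[OF L ci])
  also have "\<dots> = cintegral \<nu> (\<lambda>\<eta>. \<Sum>x\<in>?F. \<omega> {x} * ?g x * char_apply \<eta> x)"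
    by (rule L1_functional_sum[OF L, symmetric]) (intro integrable_mult_right ci)
  also have "(\<lambda>\<eta>. \<Sum>x\<in>?F. \<omega> {x} * ?g x * char_apply \<eta> x) = (\<lambda>\<eta>. cintegral \<omega>h (\<lambda>\<xi>. fcheck_sq m \<phi> (\<eta> + \<xi>)))"
  proof
    fix \<eta>
    have "(\<Sum>x\<in>?F. \<omega> {x} * ?g x * char_apply \<eta> x) = cintegral \<omega> (\<lambda>x. char_apply \<eta> x * ?g x)"
      using sum[OF char_apply_continuous[of UNIV \<eta>]] by (simp add: mult_ac)
    also have "(\<lambda>x. char_apply \<eta> x * ?g x) = correlation m (\<lambda>x. char_apply \<eta> x * \<phi> x) (\<lambda>x. char_apply \<eta> x * \<phi> x)"
      by (intro ext correlation_character[symmetric])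
    also have "cintegral \<omega> \<dots> = cintegral \<omega>h (fcheck_sq m (\<lambda>x. char_apply \<eta> x * \<phi> x))"
      by (rule ft'(4)[OF C_c_mult[OF \<phi> char_apply_continuous]])
    finally show "(\<Sum>x\<in>?F. \<omega> {x} * ?g x * char_apply \<eta> x) = cintegral \<omega>h (\<lambda>\<xi>. fcheck_sq m \<phi> (\<eta> + \<xi>))"
      by (simp only: fcheck_character)
  qed
  finally show ?thesis .
qed

text \<open>
  Translation boundedness of \<open>\<omega>h\<close> on a relatively compact set \<open>A\<close> follows from the uniform bound for the
  functions \<open>|\<phi>\<^sub>i\<^sup>\<and>(\<eta> + \<xi>)|\<^sup>2\<close>, since a multiple of a finite sum of the \<open>|\<phi>\<^sub>i\<^sup>\<and>|\<^sup>2\<close> dominates the indicator of \<open>A\<close>.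
  The same bound makes \<open>|\<phi>\<^sup>\<and>|\<^sup>2\<close> integrable for \<open>\<omega>h * \<nu>\<close> and justifies integrating the series for
  \<open>\<integral> |\<phi>\<^sup>\<and>(\<eta> + \<xi>)|\<^sup>2 d\<omega>h(\<xi>)\<close> term by term over \<open>\<eta>\<close>.
\<close>

theorem pong:
  assumes \<nu>: "finite_complex_measure \<nu>"
  shows "has_fourier_transform m (cdensity (mcheck \<nu>) \<omega>) (cconvolution \<omega>h \<nu>)"
proof -
  let ?N = "total_variation \<nu>" and ?t = "total_variation \<omega>h"
  have \<nu>r: "complex_radon_measure \<nu>" and fin: "emeasure ?N UNIV < \<infinity>"
    using \<nu> by (auto simp: finite_complex_measure_def)
  note car = fourier_transform_carried[OF lc m ft]
  obtain c x where cx: "\<And>A. A \<in> rc_borel \<Longrightarrow> (\<lambda>n. c n * indicator A (x n)) sums \<omega>h A"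
    and le: "\<And>f. (\<Sum>n. ennreal (norm (c n)) * f (x n)) \<le> (\<integral>\<^sup>+y. f y \<partial>?t)"
    using pure_point_sequence[OF ft'(2) car pp] by blast
  have tb: "\<exists>B. \<forall>\<eta>. (\<Sum>n. ennreal (norm (c n)) * ennreal ((norm (fcheck m \<phi> (x n + \<eta>)))\<^sup>2)) \<le> ennreal B"
    if \<phi>: "\<phi> \<in> C_c" for \<phi>
  proof -
    obtain B where B: "\<And>\<eta>. (\<integral>\<^sup>+\<xi>. ennreal ((norm (fcheck m \<phi> (\<eta> + \<xi>)))\<^sup>2) \<partial>?t) \<le> ennreal B"
      using fcheck_square_translation_bounded[OF m sets_total_variation ft'(3) \<phi>] by blast
    have "(\<Sum>n. ennreal (norm (c n)) * ennreal ((norm (fcheck m \<phi> (x n + \<eta>)))\<^sup>2)) \<le> ennreal B" for \<eta>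
      using order_trans[OF le[of "\<lambda>\<xi>. ennreal ((norm (fcheck m \<phi> (\<xi> + \<eta>)))\<^sup>2)"]] B[of \<eta>] by (simp only: add.commute[of _ \<eta>])
    then show ?thesis by blast
  qed
  have bd: "\<exists>M. \<forall>y. (\<Sum>n. ennreal (norm (c n)) * indicator A (x n + y)) \<le> ennreal M" if A: "A \<in> rc_borel" for A
  proof -
    obtain \<phi> :: "nat \<Rightarrow> 'g \<Rightarrow> complex" where \<phi>: "\<And>n. \<phi> n \<in> C_c" "\<And>\<xi>. \<exists>n. fcheck m (\<phi> n) \<xi> \<noteq> 0"
      using fcheck_nonvanishing[OF lc m] by blast
    have "compact (closure A)" using A by (simp add: rc_borel_def)
    from compact_fcheck_lower_bound[OF m \<phi> this]
    obtain I a where I: "finite I" "a > 0" "\<And>\<xi>. \<xi> \<in> closure A \<Longrightarrow> a \<le> (\<Sum>i\<in>I. (norm (fcheck m (\<phi> i) \<xi>))\<^sup>2)"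
      by blast
    obtain B where B: "\<And>i \<eta>. (\<Sum>n. ennreal (norm (c n)) * ennreal ((norm (fcheck m (\<phi> i) (x n + \<eta>)))\<^sup>2)) \<le> ennreal (B i)"
      using tb[OF \<phi>(1)] by metis
    have ind: "indicator A \<xi> \<le> ennreal (inverse a) * (\<Sum>i\<in>I. ennreal ((norm (fcheck m (\<phi> i) \<xi>))\<^sup>2))" for \<xi>
    proof (cases "\<xi> \<in> A")
      case True
      then have "a \<le> (\<Sum>i\<in>I. (norm (fcheck m (\<phi> i) \<xi>))\<^sup>2)" using I(3) closure_subset by blast
      then have "inverse a * a \<le> inverse a * (\<Sum>i\<in>I. (norm (fcheck m (\<phi> i) \<xi>))\<^sup>2)"
        using I(2) by (intro mult_left_mono) auto
      then have "1 \<le> inverse a * (\<Sum>i\<in>I. (norm (fcheck m (\<phi> i) \<xi>))\<^sup>2)" using I(2) by simp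
      then have "ennreal 1 \<le> ennreal (inverse a * (\<Sum>i\<in>I. (norm (fcheck m (\<phi> i) \<xi>))\<^sup>2))" by (rule ennreal_leI)
      also have "\<dots> = ennreal (inverse a) * ennreal (\<Sum>i\<in>I. (norm (fcheck m (\<phi> i) \<xi>))\<^sup>2)"
        using I(2) by (intro ennreal_mult) (auto intro: sum_nonneg)
      also have "ennreal (\<Sum>i\<in>I. (norm (fcheck m (\<phi> i) \<xi>))\<^sup>2) = (\<Sum>i\<in>I. ennreal ((norm (fcheck m (\<phi> i) \<xi>))\<^sup>2))"
        by (rule sum_ennreal[symmetric]) simp
      finally show ?thesis using True by simp
    qed simp
    have "(\<Sum>n. ennreal (norm (c n)) * indicator A (x n + y)) \<le> ennreal (inverse a * (\<Sum>i\<in>I. max 0 (B i)))" for y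
    proof -
      let ?q = "\<lambda>i n. ennreal ((norm (fcheck m (\<phi> i) (x n + y)))\<^sup>2)"
      have "(\<Sum>n. ennreal (norm (c n)) * indicator A (x n + y)) \<le> (\<Sum>n. ennreal (inverse a) * (\<Sum>i\<in>I. ennreal (norm (c n)) * ?q i n))"
      proof (rule suminf_le)
        fix n
        have "ennreal (norm (c n)) * indicator A (x n + y) \<le> ennreal (norm (c n)) * (ennreal (inverse a) * (\<Sum>i\<in>I. ?q i n))"
          by (intro mult_left_mono ind) simp
        also have "\<dots> = ennreal (inverse a) * (\<Sum>i\<in>I. ennreal (norm (c n)) * ?q i n)"
          by (simp only: sum_distrib_left mult.left_commute)
        finally show "ennreal (norm (c n)) * indicator A (x n + y) \<le> ennreal (inverse a) * (\<Sum>i\<in>I. ennreal (norm (c n)) * ?q i n)" .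
      qed simp_all
      also have "\<dots> = ennreal (inverse a) * (\<Sum>i\<in>I. \<Sum>n. ennreal (norm (c n)) * ?q i n)"
        by (simp only: ennreal_suminf_cmult suminf_sum[OF summableI])
      also have "\<dots> \<le> ennreal (inverse a) * (\<Sum>i\<in>I. ennreal (max 0 (B i)))"
        by (intro mult_left_mono sum_mono order_trans[OF B] ennreal_leI) simp_all
      also have "\<dots> = ennreal (inverse a * (\<Sum>i\<in>I. max 0 (B i)))"
        using I(2) by (subst sum_ennreal) (auto simp: ennreal_mult sum_nonneg)
      finally show ?thesis .
    qed
    then show ?thesis by blast
  qed
  have conv: "complex_radon_measure (cconvolution \<omega>h \<nu>)"
    "integrable (translate_sum c x ?N) f \<Longrightarrow> integrable (total_variation (cconvolution \<omega>h \<nu>)) f"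
    "integrable (translate_sum c x ?N) f \<Longrightarrow>
      (\<lambda>n. c n * cintegral \<nu> (\<lambda>y. f (x n + y))) sums cintegral (cconvolution \<omega>h \<nu>) f" for f
    using cconvolution_radon[OF ft'(2) \<nu>, of c x] cconvolution_integrable[OF ft'(2) \<nu>, of c x f]
      cconvolution_cintegral[OF ft'(2) \<nu>, of c x f] cx bd by blast+
  show ?thesis
    unfolding has_fourier_transform_def
  proof (intro conjI ballI)
    show "complex_radon_measure (cdensity (mcheck \<nu>) \<omega>)" by (rule cdensity_mcheck(1)[OF \<nu>])
    show "complex_radon_measure (cconvolution \<omega>h \<nu>)" by (rule conv(1))
    fix \<phi> :: "'g \<Rightarrow> complex" assume \<phi>: "\<phi> \<in> C_c"
    let ?f = "fcheck_sq m \<phi>"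
    have fb: "?f \<in> borel_measurable borel" by (rule fcheck_sq_borel[OF \<phi> m])
    obtain B where B: "\<And>\<eta>. (\<Sum>n. ennreal (norm (c n)) * ennreal ((norm (fcheck m \<phi> (x n + \<eta>)))\<^sup>2)) \<le> ennreal B"
      using tb[OF \<phi>] by blast
    have nf: "ennreal (norm (?f \<xi>)) = ennreal ((norm (fcheck m \<phi> \<xi>))\<^sup>2)" for \<xi> by (simp only: norm_of_real abs_power2)
    have fN: "(\<lambda>\<eta>. ?f (x n + \<eta>)) \<in> borel_measurable ?N" for n
      using borel_measurable_translation[OF fb] by (simp only: measurable_cong_sets[OF sets_total_variation refl])
    have fnb: "(\<lambda>\<xi>. ennreal (norm (?f \<xi>))) \<in> borel_measurable borel"
      by (rule measurable_compose[OF measurable_compose[OF fb borel_measurable_norm] measurable_ennreal])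
    have fnN: "(\<lambda>\<eta>. ennreal (norm (?f (x n + \<eta>)))) \<in> borel_measurable ?N" for n
      by (rule measurable_compose[OF measurable_compose[OF fN borel_measurable_norm] measurable_ennreal])
    have int: "integrable (translate_sum c x ?N) ?f"
    proof (rule integrableI_bounded)
      show "?f \<in> borel_measurable (translate_sum c x ?N)"
        using fb by (simp only: measurable_cong_sets[OF sets_translate_sum refl])
      have "(\<integral>\<^sup>+\<xi>. ennreal (norm (?f \<xi>)) \<partial>translate_sum c x ?N)
          = (\<Sum>n. ennreal (norm (c n)) * (\<integral>\<^sup>+\<eta>. ennreal (norm (?f (x n + \<eta>))) \<partial>?N))"
        by (intro nn_integral_translate_sum[OF sets_total_variation fin] fnb)
      also have "\<dots> = (\<Sum>n. \<integral>\<^sup>+\<eta>. ennreal (norm (c n)) * ennreal (norm (?f (x n + \<eta>))) \<partial>?N)"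
        by (intro suminf_cong nn_integral_cmult[symmetric] fnN)
      also have "\<dots> = (\<integral>\<^sup>+\<eta>. (\<Sum>n. ennreal (norm (c n)) * ennreal (norm (?f (x n + \<eta>)))) \<partial>?N)"
      proof (rule nn_integral_suminf[symmetric])
        fix n
        show "(\<lambda>\<eta>. ennreal (norm (c n)) * ennreal (norm (?f (x n + \<eta>)))) \<in> borel_measurable ?N"
          by (intro borel_measurable_times_ennreal borel_measurable_const fnN)
      qed
      also have "\<dots> \<le> (\<integral>\<^sup>+\<eta>. ennreal B \<partial>?N)" unfolding nf by (intro nn_integral_mono B)
      also have "\<dots> < \<infinity>" using fin by (simp add: ennreal_mult_less_top)
      finally show "(\<integral>\<^sup>+\<xi>. ennreal (norm (?f \<xi>)) \<partial>translate_sum c x ?N) < \<infinity>" .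
    qed
    have "integrable (total_variation (cconvolution \<omega>h \<nu>)) (\<lambda>\<xi>. Re (?f \<xi>))"
      by (rule integrable_Re[OF conv(2)[OF int]])
    moreover have "fcheck m \<phi> \<in> borel_measurable (total_variation (cconvolution \<omega>h \<nu>))"
      using fcheck_borel[OF \<phi> m] by (simp only: measurable_cong_sets[OF sets_total_variation refl])
    ultimately show "square_integrable (total_variation (cconvolution \<omega>h \<nu>)) (fcheck m \<phi>)"
      unfolding square_integrable_def by (simp only: Re_complex_of_real simp_thms)
    have inner: "(\<lambda>n. c n * ?f (x n + \<eta>)) sums cintegral \<omega>h (\<lambda>\<xi>. ?f (\<eta> + \<xi>))" for \<eta>
    proof -
      have "square_integrable ?t (fcheck m (\<lambda>y. char_apply \<eta> y * \<phi> y))"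
        by (rule ft'(3)[OF C_c_mult[OF \<phi> char_apply_continuous]])
      from fcheck_sq_integrable[OF this] have int: "integrable ?t (\<lambda>\<xi>. ?f (\<eta> + \<xi>))"
        by (simp only: fcheck_character)
      have "(\<lambda>n. c n * ?f (\<eta> + x n)) sums cintegral \<omega>h (\<lambda>\<xi>. ?f (\<eta> + \<xi>))"
        using cintegral_pure_point[OF ft'(2) car _ _ int, of c x] cx le by blast
      then show ?thesis by (simp only: add.commute[of _ \<eta>])
    qed
    note L = cintegral_L1_functional[OF \<nu>r]
    have fi: "integrable ?N (\<lambda>\<eta>. ?f (x n + \<eta>))" for n
      by (rule integrable_bounded_tv[OF \<nu> borel_measurable_translation[OF fb] fcheck_sq_bound])
    have lim: "(\<lambda>n. cintegral \<nu> (\<lambda>\<eta>. \<Sum>i<n. c i * ?f (x i + \<eta>))) \<longlonglongrightarrow> cintegral \<nu> (\<lambda>\<eta>. cintegral \<omega>h (\<lambda>\<xi>. ?f (\<eta> + \<xi>)))"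
    proof (rule L1_functional_tendsto[OF L, where w = "\<lambda>_. max 0 B"])
      show pm: "(\<lambda>\<eta>. \<Sum>i<n. c i * ?f (x i + \<eta>)) \<in> borel_measurable ?N" for n
        by (intro borel_measurable_sum borel_measurable_times borel_measurable_const fN)
      have l: "(\<lambda>n. \<Sum>i<n. c i * ?f (x i + \<eta>)) \<longlonglongrightarrow> cintegral \<omega>h (\<lambda>\<xi>. ?f (\<eta> + \<xi>))" for \<eta>
        using inner[of \<eta>] by (simp only: sums_def)
      show "(\<lambda>\<eta>. cintegral \<omega>h (\<lambda>\<xi>. ?f (\<eta> + \<xi>))) \<in> borel_measurable ?N"
        by (rule borel_measurable_LIMSEQ_metric[OF pm l])
      show "integrable ?N (\<lambda>_. max 0 B)" by (rule finite_measure.integrable_const[OF finite_tv[OF \<nu>]])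
      show "AE \<eta> in ?N. (\<lambda>n. \<Sum>i<n. c i * ?f (x i + \<eta>)) \<longlonglongrightarrow> cintegral \<omega>h (\<lambda>\<xi>. ?f (\<eta> + \<xi>))"
        by (intro AE_I2 l)
      show "AE \<eta> in ?N. norm (\<Sum>i<n. c i * ?f (x i + \<eta>)) \<le> max 0 B" for n
      proof (intro AE_I2)
        fix \<eta>
        have t: "ennreal (norm (c i * ?f (x i + \<eta>))) = ennreal (norm (c i)) * ennreal ((norm (fcheck m \<phi> (x i + \<eta>)))\<^sup>2)" for i
          unfolding nf[symmetric] norm_mult by (intro ennreal_mult) simp_all
        have "ennreal (\<Sum>i<n. norm (c i * ?f (x i + \<eta>))) = (\<Sum>i<n. ennreal (norm (c i * ?f (x i + \<eta>))))"
          by (rule sum_ennreal[symmetric]) simp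
        also have "\<dots> \<le> (\<Sum>n. ennreal (norm (c n)) * ennreal ((norm (fcheck m \<phi> (x n + \<eta>)))\<^sup>2))"
          unfolding t by (intro sum_le_suminf) auto
        also have "\<dots> \<le> ennreal (max 0 B)" by (rule order_trans[OF B ennreal_leI]) simp
        finally have "(\<Sum>i<n. norm (c i * ?f (x i + \<eta>))) \<le> max 0 B" by (subst (asm) ennreal_le_iff) auto
        with norm_sum show "norm (\<Sum>i<n. c i * ?f (x i + \<eta>)) \<le> max 0 B" by (rule order_trans)
      qed
    qed
    have "cintegral \<nu> (\<lambda>\<eta>. \<Sum>i<n. c i * ?f (x i + \<eta>)) = (\<Sum>i<n. c i * cintegral \<nu> (\<lambda>\<eta>. ?f (x i + \<eta>)))" for n
    proof -
      have "cintegral \<nu> (\<lambda>\<eta>. \<Sum>i<n. c i * ?f (x i + \<eta>)) = (\<Sum>i<n. cintegral \<nu> (\<lambda>\<eta>. c i * ?f (x i + \<eta>)))"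
        by (rule L1_functional_sum[OF L integrable_mult_right[OF fi]])
      then show ?thesis by (simp only: L1_functional_cmult[OF L fi])
    qed
    with lim have "(\<lambda>n. c n * cintegral \<nu> (\<lambda>\<eta>. ?f (x n + \<eta>))) sums cintegral \<nu> (\<lambda>\<eta>. cintegral \<omega>h (\<lambda>\<xi>. ?f (\<eta> + \<xi>)))"
      by (simp only: sums_def)
    from sums_unique2[OF conv(3)[OF int] this]
    show "cintegral (cdensity (mcheck \<nu>) \<omega>) (correlation m \<phi> \<phi>) = cintegral (cconvolution \<omega>h \<nu>) ?f"
      by (simp only: cintegral_cdensity_mcheck[OF \<nu> \<phi>])
  qed
qed

text \<open>
  The point masses of \<open>\<gamma>\<close> are read off from \<open>\<nu> = |\<phi>\<^sup>\<and>|\<^sup>2 \<gamma>h\<close> as \<open>mcheck \<nu> x = \<gamma> {x}\<close> on the support of \<open>\<omega>\<close>, so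
  that \<open>\<gamma>\<close> is the measure to which \<open>pong\<close> attaches the transform \<open>\<omega>h * \<nu>\<close>.
\<close>

theorem ping:
  assumes \<phi>: "\<phi> \<in> C_c" and g0: "correlation m \<phi> \<phi> 0 = 1"
    and dis: "uniformly_discrete_wrt (fsupp (correlation m \<phi> \<phi>)) (msupp \<omega>)"
    and \<gamma>: "has_fourier_transform m \<gamma> \<gamma>h" and supp: "msupp \<gamma> \<subseteq> \<Lambda>" and one: "\<And>x. x \<in> \<Lambda> \<Longrightarrow> \<omega> {x} = 1"
  shows "finite_complex_measure (cdensity (fcheck_sq m \<phi>) \<gamma>h)"
    and "\<gamma>h = cconvolution \<omega>h (cdensity (fcheck_sq m \<phi>) \<gamma>h)"
proof -
  let ?\<nu> = "cdensity (fcheck_sq m \<phi>) \<gamma>h" and ?g = "correlation m \<phi> \<phi>" and ?S = "msupp \<omega>"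
  note f = has_fourier_transformD[OF \<gamma>]
  note car = fourier_transform_carried[OF lc m \<gamma>]
  note fb = fcheck_sq_borel[OF \<phi> m] and fbd = fcheck_sq_bound[of m \<phi>]
  have g: "?g \<in> C_c" by (rule correlation_C_c[OF m \<phi> \<phi>])
  have \<nu>r: "complex_radon_measure ?\<nu>" by (rule cdensity_radon[OF f(2) car fb fbd])
  obtain C where C: "\<And>A. A \<in> sets borel \<Longrightarrow> emeasure (total_variation ?\<nu>) A
      \<le> ennreal C * (\<integral>\<^sup>+\<xi>. ennreal (norm (fcheck_sq m \<phi> \<xi>)) * indicator A \<xi> \<partial>total_variation \<gamma>h)"
    using tv_cdensity_le[OF f(2) car fb fbd] by blast
  have int: "integrable (total_variation \<gamma>h) (fcheck_sq m \<phi>)" by (rule fcheck_sq_integrable[OF f(3)[OF \<phi>]])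
  have "emeasure (total_variation ?\<nu>) UNIV \<le> ennreal C * (\<integral>\<^sup>+\<xi>. ennreal (norm (fcheck_sq m \<phi> \<xi>)) \<partial>total_variation \<gamma>h)"
    using C[of UNIV] by (simp only: sets.top[of borel, unfolded space_borel] indicator_UNIV mult_1_right)
  also have "\<dots> < \<infinity>"
    using int by (simp only: integrable_iff_bounded infinity_ennreal_def ennreal_mult_less_top ennreal_less_top) simp
  finally show \<nu>: "finite_complex_measure ?\<nu>" using \<nu>r by (simp only: finite_complex_measure_def simp_thms)
  have \<Lambda>S: "\<Lambda> \<subseteq> ?S" using singleton_in_msupp[OF ft'(1)] one by fastforce
  then have S: "msupp \<gamma> \<subseteq> ?S" using supp by blast
  have val: "mcheck ?\<nu> x = \<gamma> {x}" if x: "x \<in> ?S" for x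
  proof -
    have "mcheck ?\<nu> x = cintegral \<gamma>h (\<lambda>\<xi>. fcheck_sq m \<phi> \<xi> * char_apply \<xi> x)"
      unfolding mcheck_def
    proof (rule cintegral_cdensity[OF f(2) car fb fbd])
      show b: "(\<lambda>\<xi>. char_apply \<xi> x) \<in> borel_measurable borel"
        by (rule borel_measurable_continuous_onI[OF char_eval_continuous])
      show "integrable (total_variation \<gamma>h) (\<lambda>\<xi>. fcheck_sq m \<phi> \<xi> * char_apply \<xi> x)"
      proof (rule integrable_mult_bounded[OF int, of _ 1])
        show "(\<lambda>\<xi>. char_apply \<xi> x) \<in> borel_measurable (total_variation \<gamma>h)"
          using b by (simp only: measurable_cong_sets[OF sets_total_variation refl])
      qed simp
    qed
    also have "(\<lambda>\<xi>. fcheck_sq m \<phi> \<xi> * char_apply \<xi> x) = (\<lambda>\<xi>. fcheck m (\<lambda>y. \<phi> (y - x)) \<xi> * cnj (fcheck m \<phi> \<xi>))"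
      by (intro ext) (simp only: complex_norm_square fcheck_translate[OF \<phi> m] mult_ac)
    also have "cintegral \<gamma>h \<dots> = cintegral \<gamma> (correlation m (\<lambda>y. \<phi> (y - x)) \<phi>)"
      by (rule fourier_transform_polarized[OF m \<gamma> C_c_translate[OF \<phi>] \<phi>, symmetric])
    also have "correlation m (\<lambda>y. \<phi> (y - x)) \<phi> = (\<lambda>t. ?g (t - x))"
      by (intro ext correlation_translate[OF m \<phi> \<phi>])
    also have "cintegral \<gamma> (\<lambda>t. ?g (t - x)) = (\<Sum>t\<in>?S \<inter> fsupp (\<lambda>t. ?g (t - x)). \<gamma> {t} * ?g (t - x))"
      by (rule cintegral_uniformly_discrete(2)[OF f(1) S ud C_c_compact C_c_borel notin_fsupp]; (intro C_c_translate g)?)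
    also have "\<dots> = (\<Sum>t\<in>{x}. \<gamma> {t} * ?g (t - x))"
    proof (rule sum.mono_neutral_right)
      show "finite (?S \<inter> fsupp (\<lambda>t. ?g (t - x)))"
        by (rule uniformly_discrete_finite_Int[OF ud C_c_compact[OF C_c_translate[OF g]]])
      have "?g (x - x) \<noteq> 0" using g0 by simp
      then show "{x} \<subseteq> ?S \<inter> fsupp (\<lambda>t. ?g (t - x))" using x notin_fsupp[of x "\<lambda>t. ?g (t - x)"] by blast
      show "\<forall>t\<in>?S \<inter> fsupp (\<lambda>t. ?g (t - x)) - {x}. \<gamma> {t} * ?g (t - x) = 0"
      proof
        fix t assume t: "t \<in> ?S \<inter> fsupp (\<lambda>t. ?g (t - x)) - {x}"
        have "?g (t - x) = 0"
        proof (rule ccontr)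
          assume "?g (t - x) \<noteq> 0"
          then have "t - x \<in> fsupp ?g" using notin_fsupp by metis
          then have 1: "x + (t - x) \<in> (+) x ` fsupp ?g" by (rule imageI)
          \<comment> \<open>Both \<open>t = x + (t - x)\<close> and \<open>t = t + 0\<close> would lie in translates of the support of \<open>?g\<close>.\<close>
          have "?g 0 \<noteq> 0" using g0 by simp
          then have "0 \<in> fsupp ?g" using notin_fsupp by metis
          then have 2: "t + 0 \<in> (+) t ` fsupp ?g" by (rule imageI)
          have "(+) x ` fsupp ?g \<inter> (+) t ` fsupp ?g = {}"
            using dis x t unfolding uniformly_discrete_wrt_def by blast
          then show False using 1 2 by auto
        qed
        then show "\<gamma> {t} * ?g (t - x) = 0" by simp
      qed
    qed
    finally show ?thesis using g0 by simp
  qed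
  have "cdensity (mcheck ?\<nu>) \<omega> = \<gamma>"
  proof
    fix A
    show "cdensity (mcheck ?\<nu>) \<omega> A = \<gamma> A"
    proof (cases "A \<in> rc_borel")
      case A: True
      then have K: "compact (closure A)" by (simp add: rc_borel_def)
      have As: "A \<in> sets borel" by (rule rc_borel_sets[OF A])
      have out: "indicator A y = (0::complex)" if "y \<notin> closure A" for y
        using that closure_subset by (fastforce simp: indicator_def)
      have ib: "(indicator A :: 'g \<Rightarrow> complex) \<in> borel_measurable borel" using As by simp
      have mb: "mcheck ?\<nu> \<in> borel_measurable borel"
        by (rule borel_measurable_continuous_onI[OF mcheck_continuous[OF \<nu>]])
      have "cdensity (mcheck ?\<nu>) \<omega> A = cintegral \<omega> (\<lambda>x. indicator A x * mcheck ?\<nu> x)"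
        using A by (simp add: cdensity_def)
      also have "\<dots> = (\<Sum>x\<in>?S \<inter> closure A. \<omega> {x} * (indicator A x * mcheck ?\<nu> x))"
        by (rule cintegral_uniformly_discrete(2)[OF ft'(1) subset_refl ud K borel_measurable_times[OF ib mb]])
          (simp add: out)
      also have "\<dots> = (\<Sum>x\<in>?S \<inter> closure A. \<gamma> {x} * indicator A x)"
      proof (rule sum.cong[OF refl])
        fix x assume x: "x \<in> ?S \<inter> closure A"
        have "\<omega> {x} * \<gamma> {x} = \<gamma> {x}"
        proof (cases "\<gamma> {x} = 0")
          case False
          then have "x \<in> \<Lambda>" using singleton_in_msupp[OF f(1)] supp by blast
          then show ?thesis using one by simp
        qed simp
        then show "\<omega> {x} * (indicator A x * mcheck ?\<nu> x) = \<gamma> {x} * indicator A x"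
          using val[of x] x by (simp add: indicator_def)
      qed
      also have "\<dots> = cintegral \<gamma> (indicator A)"
        by (rule cintegral_uniformly_discrete(2)[OF f(1) S ud K ib out, symmetric])
      also have "\<dots> = \<gamma> A" by (rule cintegral_indicator[OF f(1) A])
      finally show ?thesis .
    next
      case False
      then show ?thesis using f(1) by (simp add: cdensity_def complex_radon_measure_def)
    qed
  qed
  then have "has_fourier_transform m \<gamma> (cconvolution \<omega>h ?\<nu>)" using pong[OF \<nu>] by simp
  from fourier_transform_unique[OF lc m \<gamma> this] show "\<gamma>h = cconvolution \<omega>h ?\<nu>" .
qed

end

theorem theorem4p3:
  fixes L :: "('g::{topological_ab_group_add, t2_space, second_countable_topology} \<times>
                'h::{topological_ab_group_add, t2_space}) set"
    and W :: "'h set"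
    and m :: "'g measure" and mh :: "'g character measure"
    and \<omega> :: "'g cmeasure" and \<omega>h :: "'g character cmeasure"
    and \<phi> :: "'g \<Rightarrow> complex"
  assumes "locally_compact_space (euclidean :: 'g topology)"
    and "locally_compact_space (euclidean :: 'h topology)"
    and "haar_measure m" and "haar_measure mh"
    and "cut_and_project_scheme L"
    and "compact W"
    and "ping_pong_measure m mh \<omega> (cps_projection L W)"
    and "has_fourier_transform m \<omega> \<omega>h"
    and "auxiliary_function m \<phi> \<omega>"
  shows "(\<forall>\<gamma> \<gamma>h. has_fourier_transform m \<gamma> \<gamma>h \<and> msupp \<gamma> \<subseteq> cps_projection L W \<longrightarrow>
            (let \<nu> = cdensity (\<lambda>\<xi>. complex_of_real ((norm (fcheck m \<phi> \<xi>))\<^sup>2)) \<gamma>h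
             in finite_complex_measure \<nu> \<and> \<gamma>h = cconvolution \<omega>h \<nu>))
       \<and> (\<forall>\<nu>. finite_complex_measure \<nu> \<longrightarrow>
            (let \<gamma> = cdensity (mcheck \<nu>) \<omega>
             in msupp \<gamma> \<subseteq> msupp \<omega> \<and> has_fourier_transform m \<gamma> (cconvolution \<omega>h \<nu>)))"
proof -
  have pp: "pure_point \<omega>h" and ud: "uniformly_discrete (msupp \<omega>)"
    and one: "\<And>x. x \<in> cps_projection L W \<Longrightarrow> \<omega> {x} = 1"
    using assms(7,8) unfolding ping_pong_measure_def by blast+
  have aux: "\<phi> \<in> C_c" "correlation m \<phi> \<phi> 0 = 1"
    "uniformly_discrete_wrt (fsupp (correlation m \<phi> \<phi>)) (msupp \<omega>)"
    using assms(9) unfolding auxiliary_function_def by blast+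
  note data = assms(1,3,8) pp ud
  show ?thesis
    unfolding Let_def
  proof (intro conjI allI impI; (elim conjE)?)
    fix \<gamma> \<gamma>h assume \<gamma>: "has_fourier_transform m \<gamma> \<gamma>h" "msupp \<gamma> \<subseteq> cps_projection L W"
    show "finite_complex_measure (cdensity (fcheck_sq m \<phi>) \<gamma>h)"
      by (rule ping(1)[OF data aux \<gamma> one])
    show "\<gamma>h = cconvolution \<omega>h (cdensity (fcheck_sq m \<phi>) \<gamma>h)"
      by (rule ping(2)[OF data aux \<gamma> one])
  next
    fix \<nu> :: "'g character cmeasure" assume \<nu>: "finite_complex_measure \<nu>"
    show "msupp (cdensity (mcheck \<nu>) \<omega>) \<subseteq> msupp \<omega>" by (rule cdensity_mcheck(2)[OF data \<nu>])
    show "has_fourier_transform m (cdensity (mcheck \<nu>) \<omega>) (cconvolution \<omega>h \<nu>)" by (rule pong[OF data \<nu>])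
  qed
qed

end
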